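(* Let $m,n,s,k,c$ be positive integers such that $2\leq s\leq n$, $2\leq k\leq m$ and $ms=nk$. A magic rectangle set $\mathrm{MRS}(m,n;s,k;c)$ exists if and only if either $nkc$ is odd, or $s$ and $k$ are both even and $sk>4$.
   Context: Let $(\Gamma,+)$ be an abelian group and $\Omega\subseteq\Gamma$ with $|\Omega|>1$. A partially filled array is an array in which some cells may be empty. A magic partially filled array set $\mathrm{MS}_\Omega(m,n;s,k;c)$ is a set of $c$ partially filled $m\times n$ arrays with entries in $\Omega$ such that: every element of $\Omega$ appears exactly once, in exactly one of the arrays; in every array each row contains exactly $s$ filled cells and each column exactly $k$ filled cells; and there exist (not necessarily distinct) $x,y\in\Gamma$ such that in every array the entries of each row sum to $x$ and the entries of each column sum to $y$. A magic rectangle set with empty cells $\mathrm{MRS}(m,n;s,k;c)$ is an $\mathrm{MS}_\Omega(m,n;s,k;c)$ with $\Omega=\{1,2,\ldots,nkc\}\subset(\mathbb Z,+)$. *)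

theory Defs
  imports Main
begin

text \<open>A family of c partially filled m x n arrays is modelled as
  A :: nat => nat => nat => nat option, where A t i j is the content of cell (i,j)
  of array t (t < c, i < m, j < n); None means the cell is empty.\<close>

definition filled_cells :: "(nat \<Rightarrow> nat \<Rightarrow> nat \<Rightarrow> nat option) \<Rightarrow> nat \<Rightarrow> nat \<Rightarrow> nat \<Rightarrow> (nat \<times> nat \<times> nat) set" where
  "filled_cells A m n c = {(t, i, j). t < c \<and> i < m \<and> j < n \<and> A t i j \<noteq> None}"

definition is_MRS :: "nat \<Rightarrow> nat \<Rightarrow> nat \<Rightarrow> nat \<Rightarrow> nat \<Rightarrow> (nat \<Rightarrow> nat \<Rightarrow> nat \<Rightarrow> nat option) \<Rightarrow> bool" where
  "is_MRS m n s k c A \<longleftrightarrow>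
     bij_betw (\<lambda>(t, i, j). the (A t i j)) (filled_cells A m n c) {1..n * k * c} \<and>
     (\<forall>t<c. \<forall>i<m. card {j. j < n \<and> A t i j \<noteq> None} = s) \<and>
     (\<forall>t<c. \<forall>j<n. card {i. i < m \<and> A t i j \<noteq> None} = k) \<and>
     (\<exists>x y. (\<forall>t<c. \<forall>i<m. (\<Sum>j\<in>{j. j < n \<and> A t i j \<noteq> None}. the (A t i j)) = x) \<and>
            (\<forall>t<c. \<forall>j<n. (\<Sum>i\<in>{i. i < m \<and> A t i j \<noteq> None}. the (A t i j)) = y))"

definition MRS_exists :: "nat \<Rightarrow> nat \<Rightarrow> nat \<Rightarrow> nat \<Rightarrow> nat \<Rightarrow> bool" where
  "MRS_exists m n s k c \<longleftrightarrow> (\<exists>A. is_MRS m n s k c A)"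

end

theory Submission
  imports Defs
begin

text \<open>Double counting gives the necessity: both line sums are determined by the mean label, and for \<open>s = k = 2\<close> the
  partners of a label in its row and in its column would have to be equal.

  If \<open>s\<close> and \<open>k\<close> are even, the cells of an array are filled consecutively row by row, cyclically in the columns,
  with pairs of opposite labels. Rows are then balanced; along a column the labels form bundles for which
  the signs can be chosen such that the sums vanish.

  If everything is odd, put \<open>d = gcd s k\<close>. For \<open>d \<ge> 3\<close> it suffices to fill \<open>d\<close> cyclic diagonals of square arrays,
  since rows and columns of different arrays may be merged; the labels are written in mixed radix and each digit runs
  through permutations built from the identity \<open>z/2 + (z-1)/2 + (-z-1) = const\<close> for representatives modulo an odd number.
  For \<open>d = 1\<close> the arrays are block diagonal and one needs completely filled \<open>k \<times> s\<close> rectangles. Their labels are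
  \<open>x s + y\<close>, where a column contains every level \<open>x\<close> once and every level contains every \<open>y\<close> once, so that only the
  row sums have to be controlled; a subset sum argument balances them.\<close>

section \<open>Families of labelled cells\<close>

text \<open>Every row has \<open>s\<close> cells and every column \<open>k\<close>, so translating
  all labels keeps the row sums equal and the column sums equal. Labels are therefore integers from
  any interval of the right length, which permits signed labels and centred digits with target sum
  zero. In the odd rectangles the prime 3 is the obstacle. Rows are balanced by deciding, column by
  column, between two permutations whose differences are the column weights. If
  \<open>3 dvd s\<close>, all weights are 1 modulo 3, and so is \<open>h = (s - 1) / 2\<close>; then
  no \<open>h\<close> columns have total weight 0. The row length must therefore be prime to 3.
  Coprimality of \<open>s\<close> and \<open>k\<close> rescues this: at most one side is divisible
  by 3, such a side is obtained by stacking rectangles with three rows, and transposition covers the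
  remaining orientations.\<close>

definition magic_family ::
  "nat \<Rightarrow> nat \<Rightarrow> nat \<Rightarrow> nat \<Rightarrow> nat \<Rightarrow> 'x set \<Rightarrow> ('x \<Rightarrow> nat) \<Rightarrow> ('x \<Rightarrow> nat) \<Rightarrow> ('x \<Rightarrow> nat) \<Rightarrow> ('x \<Rightarrow> int) \<Rightarrow> bool" where
  "magic_family m n s k c X T I J l \<longleftrightarrow>
     finite X \<and> (\<forall>x\<in>X. T x < c \<and> I x < m \<and> J x < n) \<and>
     inj_on (\<lambda>x. (T x, I x, J x)) X \<and> inj_on l X \<and>
     (\<exists>a. \<forall>x\<in>X. a \<le> l x \<and> l x < a + int (n * k * c)) \<and>
     (\<forall>t<c. \<forall>i<m. card {x \<in> X. T x = t \<and> I x = i} = s) \<and>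
     (\<forall>t<c. \<forall>j<n. card {x \<in> X. T x = t \<and> J x = j} = k) \<and>
     (\<exists>u. \<forall>t<c. \<forall>i<m. (\<Sum>x | x \<in> X \<and> T x = t \<and> I x = i. l x) = u) \<and>
     (\<exists>u. \<forall>t<c. \<forall>j<n. (\<Sum>x | x \<in> X \<and> T x = t \<and> J x = j. l x) = u)"

lemma sum_fibres:
  fixes f :: "'x \<Rightarrow> 'a::comm_monoid_add"
  assumes "finite X" "\<And>x. x \<in> X \<Longrightarrow> P x \<Longrightarrow> \<phi> x < (V::nat)"
  shows "(\<Sum>x | x \<in> X \<and> P x. f x) = (\<Sum>v<V. \<Sum>x | x \<in> X \<and> P x \<and> \<phi> x = v. f x)"
proof -
  have "(\<Sum>v<V. sum f {x \<in> {x. x \<in> X \<and> P x}. \<phi> x = v}) = sum f {x. x \<in> X \<and> P x}"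
    by (rule sum.group) (use assms in auto)
  thus ?thesis by (simp add: conj_assoc)
qed

lemma card_fibres:
  assumes "finite X" "\<And>x. x \<in> X \<Longrightarrow> P x \<Longrightarrow> \<phi> x < (V::nat)"
  shows "card {x \<in> X. P x} = (\<Sum>v<V. card {x \<in> X. P x \<and> \<phi> x = v})"
  using sum_fibres[OF assms, where f = "\<lambda>_. 1::nat"] by simp

lemma magic_family_card:
  assumes "magic_family m n s k c X T I J l"
  shows "card X = n * k * c"
proof -
  have fin: "finite X" and rg: "\<And>x. x \<in> X \<Longrightarrow> T x < c \<and> J x < n"
    and cols: "\<And>t j. t < c \<Longrightarrow> j < n \<Longrightarrow> card {x \<in> X. T x = t \<and> J x = j} = k"
    using assms unfolding magic_family_def by auto
  have "card X = (\<Sum>t<c. card {x \<in> X. T x = t})"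
    using card_fibres[OF fin, of "\<lambda>_. True" T c] rg by simp
  also have "\<dots> = (\<Sum>t<c. \<Sum>j<n. card {x \<in> X. T x = t \<and> J x = j})"
    by (intro sum.cong refl card_fibres fin) (use rg in auto)
  also have "\<dots> = (\<Sum>t<c. \<Sum>j<n. k)" by (intro sum.cong refl cols) auto
  finally show ?thesis by simp
qed

text \<open>The labels are injective and \<open>card X\<close> is the length of the interval that
  contains them, so they fill it. Moving its left end \<open>a\<close> to 1 adds
  \<open>s * (1 - a)\<close> to each row sum and \<open>k * (1 - a)\<close> to each column
  sum.\<close>

lemma MRS_exists_if_magic_family:
  assumes mf: "magic_family m n s k c X T I J l"
  shows "MRS_exists m n s k c"
proof -
  have fin: "finite X" and rg: "\<And>x. x \<in> X \<Longrightarrow> T x < c \<and> I x < m \<and> J x < n"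
    and inj: "inj_on (\<lambda>x. (T x, I x, J x)) X" and injl: "inj_on l X"
    and rows: "\<And>t i. t < c \<Longrightarrow> i < m \<Longrightarrow> card {x \<in> X. T x = t \<and> I x = i} = s"
    and cols: "\<And>t j. t < c \<Longrightarrow> j < n \<Longrightarrow> card {x \<in> X. T x = t \<and> J x = j} = k"
    using mf unfolding magic_family_def by auto
  obtain a where a: "\<And>x. x \<in> X \<Longrightarrow> a \<le> l x \<and> l x < a + int (n * k * c)"
    using mf unfolding magic_family_def by auto
  obtain u where u: "\<And>t i. t < c \<Longrightarrow> i < m \<Longrightarrow> (\<Sum>x | x \<in> X \<and> T x = t \<and> I x = i. l x) = u"
    using mf unfolding magic_family_def by auto
  obtain v where v: "\<And>t j. t < c \<Longrightarrow> j < n \<Longrightarrow> (\<Sum>x | x \<in> X \<and> T x = t \<and> J x = j. l x) = v"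
    using mf unfolding magic_family_def by auto
  define p where "p = (\<lambda>x. (T x, I x, J x))"
  define q where "q = inv_into X p"
  define L where "L = (\<lambda>x. nat (l x - a + 1))"
  define A where "A = (\<lambda>t i j. if (t, i, j) \<in> p ` X then Some (L (q (t, i, j))) else None)"
  have qp: "q (T x, I x, J x) = x" if "x \<in> X" for x
    using inv_into_f_f[of p X x] inj that unfolding p_def q_def by auto
  have Ap: "A (T x) (I x) (J x) = Some (L x)" if "x \<in> X" for x
    using that qp[OF that] by (auto simp: A_def p_def)
  have Lint: "int (L x) = l x - a + 1" if "x \<in> X" for x
    using a[OF that] by (simp add: L_def)
  have fc: "filled_cells A m n c = p ` X"
    unfolding filled_cells_def A_def using rg by (auto simp: p_def split: if_splits)
  have injL: "inj_on L X"
  proof (rule inj_onI)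
    fix x y assume "x \<in> X" "y \<in> X" "L x = L y"
    hence "l x = l y" using Lint[of x] Lint[of y] by simp
    thus "x = y" using injl \<open>x \<in> X\<close> \<open>y \<in> X\<close> by (auto dest: inj_onD)
  qed
  have LX: "L ` X = {1..n * k * c}"
  proof (rule card_subset_eq)
    have "1 \<le> L x \<and> L x \<le> n * k * c" if "x \<in> X" for x
      using a[OF that] Lint[OF that] by linarith
    thus "L ` X \<subseteq> {1..n * k * c}" by auto
    show "card (L ` X) = card {1..n * k * c}"
      using card_image[OF injL] magic_family_card[OF mf] by simp
  qed simp
  have bij: "bij_betw (\<lambda>(t, i, j). the (A t i j)) (filled_cells A m n c) {1..n * k * c}"
  proof -
    have "bij_betw L X {1..n * k * c}" using injL LX by (simp add: bij_betw_def)
    moreover have "bij_betw p X (p ` X)" using inj by (simp add: p_def bij_betw_def)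
    moreover have "((\<lambda>(t, i, j). the (A t i j)) \<circ> p) x = L x" if "x \<in> X" for x
      using Ap[OF that] by (simp add: p_def)
    ultimately have "bij_betw ((\<lambda>(t, i, j). the (A t i j)) \<circ> p) X {1..n * k * c}"
      using bij_betw_cong[of X "(\<lambda>(t, i, j). the (A t i j)) \<circ> p" L] by blast
    thus ?thesis
      unfolding fc using bij_betw_comp_iff[OF \<open>bij_betw p X (p ` X)\<close>] by blast
  qed
  have row: "{j. j < n \<and> A t i j \<noteq> None} = J ` {x \<in> X. T x = t \<and> I x = i}" for t i
    unfolding A_def using rg by (auto simp: p_def split: if_splits)
  have col: "{i. i < m \<and> A t i j \<noteq> None} = I ` {x \<in> X. T x = t \<and> J x = j}" for t j
    unfolding A_def using rg by (auto simp: p_def split: if_splits)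
  have injJ: "inj_on J {x \<in> X. T x = t \<and> I x = i}" for t i
    using inj by (auto simp: inj_on_def)
  have injI: "inj_on I {x \<in> X. T x = t \<and> J x = j}" for t j
    using inj by (auto simp: inj_on_def)
  have srow: "(\<Sum>j\<in>{j. j < n \<and> A t i j \<noteq> None}. the (A t i j)) = nat (u + int s * (1 - a))"
    if "t < c" "i < m" for t i
  proof -
    have "(\<Sum>j\<in>{j. j < n \<and> A t i j \<noteq> None}. the (A t i j)) = (\<Sum>x | x \<in> X \<and> T x = t \<and> I x = i. L x)"
      unfolding row sum.reindex[OF injJ] by (rule sum.cong) (use Ap in auto)
    hence "int (\<Sum>j\<in>{j. j < n \<and> A t i j \<noteq> None}. the (A t i j)) = (\<Sum>x | x \<in> X \<and> T x = t \<and> I x = i. int (L x))"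
      by (simp only: of_nat_sum)
    also have "\<dots> = (\<Sum>x | x \<in> X \<and> T x = t \<and> I x = i. l x + (1 - a))"
      by (intro sum.cong refl) (use Lint in auto)
    also have "\<dots> = u + int s * (1 - a)" using u[OF that] rows[OF that] by (simp add: sum.distrib)
    finally show ?thesis by linarith
  qed
  have scol: "(\<Sum>i\<in>{i. i < m \<and> A t i j \<noteq> None}. the (A t i j)) = nat (v + int k * (1 - a))"
    if "t < c" "j < n" for t j
  proof -
    have "(\<Sum>i\<in>{i. i < m \<and> A t i j \<noteq> None}. the (A t i j)) = (\<Sum>x | x \<in> X \<and> T x = t \<and> J x = j. L x)"
      unfolding col sum.reindex[OF injI] by (rule sum.cong) (use Ap in auto)
    hence "int (\<Sum>i\<in>{i. i < m \<and> A t i j \<noteq> None}. the (A t i j)) = (\<Sum>x | x \<in> X \<and> T x = t \<and> J x = j. int (L x))"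
      by (simp only: of_nat_sum)
    also have "\<dots> = (\<Sum>x | x \<in> X \<and> T x = t \<and> J x = j. l x + (1 - a))"
      by (intro sum.cong refl) (use Lint in auto)
    also have "\<dots> = v + int k * (1 - a)" using v[OF that] cols[OF that] by (simp add: sum.distrib)
    finally show ?thesis by linarith
  qed
  have crow: "card {j. j < n \<and> A t i j \<noteq> None} = s" if "t < c" "i < m" for t i
    unfolding row card_image[OF injJ] by (rule rows[OF that])
  have ccol: "card {i. i < m \<and> A t i j \<noteq> None} = k" if "t < c" "j < n" for t j
    unfolding col card_image[OF injI] by (rule cols[OF that])
  have "is_MRS m n s k c A"
    unfolding is_MRS_def
    using bij crow ccol srow scol by blast
  thus ?thesis unfolding MRS_exists_def by blast
qed

text \<open>The converse passage allows a given array set to be rearranged by changing only the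
  coordinate maps \<open>T\<close>, \<open>I\<close>, \<open>J\<close> and keeping cells and
  labels.\<close>

lemma magic_family_if_MRS_exists:
  assumes "MRS_exists m n s k c"
  shows "\<exists>(X :: (nat \<times> nat \<times> nat) set) T I J l. magic_family m n s k c X T I J l"
proof -
  obtain A where A: "is_MRS m n s k c A" using assms unfolding MRS_exists_def by blast
  define X where "X = filled_cells A m n c"
  define T :: "nat \<times> nat \<times> nat \<Rightarrow> nat" where "T = fst"
  define I :: "nat \<times> nat \<times> nat \<Rightarrow> nat" where "I = fst \<circ> snd"
  define J :: "nat \<times> nat \<times> nat \<Rightarrow> nat" where "J = snd \<circ> snd"
  define F where "F = (\<lambda>(t, i, j). the (A t i j))"
  define l where "l = (\<lambda>(t, i, j). int (the (A t i j)))"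
  have l_F: "l = (\<lambda>x. int (F x))" by (auto simp: l_def F_def)
  have "X \<subseteq> {..<c} \<times> {..<m} \<times> {..<n}" unfolding X_def filled_cells_def by auto
  hence fin: "finite X" by (rule finite_subset) simp
  have bij: "bij_betw (\<lambda>(t, i, j). the (A t i j)) X {1..n * k * c}"
    using A unfolding is_MRS_def X_def by simp
  have row: "{x \<in> X. T x = t \<and> I x = i} = (\<lambda>j. (t, i, j)) ` {j. j < n \<and> A t i j \<noteq> None}" if "t < c" "i < m" for t i
    using that by (auto simp: X_def filled_cells_def T_def I_def)
  have col: "{x \<in> X. T x = t \<and> J x = j} = (\<lambda>i. (t, i, j)) ` {i. i < m \<and> A t i j \<noteq> None}" if "t < c" "j < n" for t j
    using that by (auto simp: X_def filled_cells_def T_def J_def)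
  have ij: "inj_on (\<lambda>j. (t, i, j)) S" for t i :: nat and S :: "nat set" by (auto simp: inj_on_def)
  have ii: "inj_on (\<lambda>i. (t, i, j)) S" for t j :: nat and S :: "nat set" by (auto simp: inj_on_def)
  obtain x y where xy: "\<forall>t<c. \<forall>i<m. (\<Sum>j\<in>{j. j < n \<and> A t i j \<noteq> None}. the (A t i j)) = x"
      "\<forall>t<c. \<forall>j<n. (\<Sum>i\<in>{i. i < m \<and> A t i j \<noteq> None}. the (A t i j)) = y"
    using A unfolding is_MRS_def by blast
  have "magic_family m n s k c X T I J l"
    unfolding magic_family_def
  proof (intro conjI)
    show "\<forall>x\<in>X. T x < c \<and> I x < m \<and> J x < n"
      by (auto simp: X_def filled_cells_def T_def I_def J_def)
    show "inj_on (\<lambda>x. (T x, I x, J x)) X"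
      by (auto simp: inj_on_def T_def I_def J_def)
    show "inj_on l X"
      unfolding l_F using bij_betw_imp_inj_on[OF bij] by (simp add: inj_on_def F_def)
    have "\<forall>x\<in>X. 1 \<le> l x \<and> l x < 1 + int (n * k * c)"
    proof
      fix x assume "x \<in> X"
      hence "F x \<in> {1..n * k * c}" using bij_betwE[OF bij] unfolding F_def by blast
      thus "1 \<le> l x \<and> l x < 1 + int (n * k * c)" unfolding l_F atLeastAtMost_iff by linarith
    qed
    thus "\<exists>a. \<forall>x\<in>X. a \<le> l x \<and> l x < a + int (n * k * c)" by blast
    show "\<forall>t<c. \<forall>i<m. card {x \<in> X. T x = t \<and> I x = i} = s"
      using A unfolding is_MRS_def by (simp add: row card_image[OF ij])
    show "\<forall>t<c. \<forall>j<n. card {x \<in> X. T x = t \<and> J x = j} = k"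
      using A unfolding is_MRS_def by (simp add: col card_image[OF ii])
    have "(\<Sum>x | x \<in> X \<and> T x = t \<and> I x = i. l x) = int x" if "t < c" "i < m" for t i
      using xy(1) that by (simp add: row sum.reindex[OF ij] l_def flip: of_nat_sum)
    thus "\<exists>u. \<forall>t<c. \<forall>i<m. (\<Sum>x | x \<in> X \<and> T x = t \<and> I x = i. l x) = u" by blast
    have "(\<Sum>x | x \<in> X \<and> T x = t \<and> J x = j. l x) = int y" if "t < c" "j < n" for t j
      using xy(2) that by (simp add: col sum.reindex[OF ii] l_def flip: of_nat_sum)
    thus "\<exists>u. \<forall>t<c. \<forall>j<n. (\<Sum>x | x \<in> X \<and> T x = t \<and> J x = j. l x) = u" by blast
  qed (rule fin)
  thus ?thesis by blast
qed

section \<open>Rearranging array sets: transposition, merging, diagonal blocks\<close>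

lemma MRS_exists_transpose:
  assumes "MRS_exists m n s k c" "m * s = n * k"
  shows "MRS_exists n m k s c"
proof -
  obtain X :: "(nat \<times> nat \<times> nat) set" and T I J l where "magic_family m n s k c X T I J l"
    using magic_family_if_MRS_exists[OF assms(1)] by blast
  hence "magic_family n m k s c X T J I l"
    unfolding magic_family_def using assms(2) by (auto simp: inj_on_def)
  thus ?thesis by (rule MRS_exists_if_magic_family)
qed

text \<open>The array index is read as a mixed-radix triple \<open>(t, u, v)\<close>, and this array
  is spread over the cells of the new array \<open>t\<close> whose row is \<open>u\<close> modulo
  \<open>U\<close> and whose column is \<open>v\<close> modulo \<open>V\<close>. A new row joins one
  old row from each of the \<open>V\<close> arrays with its \<open>u\<close>; a new column joins one
  old column from each of the \<open>U\<close> arrays with its \<open>v\<close>.\<close>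

lemma MRS_exists_merge:
  assumes "MRS_exists m n s k (c * U * V)"
  shows "MRS_exists (m * U) (n * V) (s * V) (k * U) c"
proof -
  obtain X :: "(nat \<times> nat \<times> nat) set" and T I J l where mf: "magic_family m n s k (c * U * V) X T I J l"
    using magic_family_if_MRS_exists[OF assms] by blast
  have fin: "finite X" and rg: "\<And>x. x \<in> X \<Longrightarrow> T x < c * U * V \<and> I x < m \<and> J x < n"
    and inj: "inj_on (\<lambda>x. (T x, I x, J x)) X" and injl: "inj_on l X"
    and rows: "\<And>t i. t < c * U * V \<Longrightarrow> i < m \<Longrightarrow> card {x \<in> X. T x = t \<and> I x = i} = s"
    and cols: "\<And>t j. t < c * U * V \<Longrightarrow> j < n \<Longrightarrow> card {x \<in> X. T x = t \<and> J x = j} = k"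
    using mf unfolding magic_family_def by auto
  obtain a where a: "\<And>x. x \<in> X \<Longrightarrow> a \<le> l x \<and> l x < a + int (n * k * (c * U * V))"
    using mf unfolding magic_family_def by auto
  obtain y where y: "\<And>t i. t < c * U * V \<Longrightarrow> i < m \<Longrightarrow> (\<Sum>x | x \<in> X \<and> T x = t \<and> I x = i. l x) = y"
    using mf unfolding magic_family_def by auto
  obtain z where z: "\<And>t j. t < c * U * V \<Longrightarrow> j < n \<Longrightarrow> (\<Sum>x | x \<in> X \<and> T x = t \<and> J x = j. l x) = z"
    using mf unfolding magic_family_def by auto
  define u where "u = (\<lambda>x. T x div V mod U)"
  define v where "v = (\<lambda>x. T x mod V)"
  define T' where "T' = (\<lambda>x. T x div V div U)"
  define I' where "I' = (\<lambda>x. I x * U + u x)"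
  define J' where "J' = (\<lambda>x. J x * V + v x)"
  have pos: "U > 0 \<and> V > 0" if "x \<in> X" for x using rg[OF that] by (auto intro!: gr0I)
  have uv: "u x < U" "v x < V" if "x \<in> X" for x
    using pos[OF that] by (auto simp: u_def v_def)
  have Tdec: "T x = (T' x * U + u x) * V + v x" for x
    unfolding u_def v_def T'_def by (simp add: div_mult_mod_eq)
  have Tlt: "(t * U + u') * V + v' < c * U * V" if "t < c" "u' < U" "v' < V" for t u' v'
  proof -
    have "t * U + u' + 1 \<le> Suc t * U" using that by simp
    also have "\<dots> \<le> c * U" using that by (intro mult_le_mono1) simp
    finally have "(t * U + u' + 1) * V \<le> c * U * V" by (rule mult_le_mono1)
    thus ?thesis using that by (simp add: algebra_simps)
  qed
  have dm: "(t * U + u') * V + v' = T x \<longleftrightarrow> t = T' x \<and> u' = u x \<and> v' = v x" if "u' < U" "v' < V" for t u' v' x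
  proof
    assume e: "(t * U + u') * V + v' = T x"
    have "T x div V = t * U + u'" "T x mod V = v'" using that by (simp_all flip: e)
    moreover have "(t * U + u') div U = t" "(t * U + u') mod U = u'" using that by simp_all
    ultimately show "t = T' x \<and> u' = u x \<and> v' = v x" by (simp add: T'_def u_def v_def)
  next
    assume "t = T' x \<and> u' = u x \<and> v' = v x" thus "(t * U + u') * V + v' = T x" using Tdec[of x] by simp
  qed
  have dI: "I' x = i \<longleftrightarrow> I x = i div U \<and> u x = i mod U" if "x \<in> X" for x i
    using uv[OF that] by (auto simp: I'_def)
  have dJ: "J' x = j \<longleftrightarrow> J x = j div V \<and> v x = j mod V" if "x \<in> X" for x j
    using uv[OF that] by (auto simp: J'_def)
  have row: "{x. x \<in> X \<and> T' x = t \<and> I' x = i \<and> v x = w} = {x \<in> X. T x = (t * U + i mod U) * V + w \<and> I x = i div U}"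
    if "w < V" "i < m * U" for t i w
  proof -
    have "U > 0" using that by (cases U) auto
    hence "i mod U < U" by simp
    show ?thesis
    proof (rule Collect_cong, rule conj_cong[OF refl])
      fix x assume "x \<in> X"
      show "(T' x = t \<and> I' x = i \<and> v x = w) = (T x = (t * U + i mod U) * V + w \<and> I x = i div U)"
        using dm[OF \<open>i mod U < U\<close> \<open>w < V\<close>, of t x] dI[OF \<open>x \<in> X\<close>, of i] by metis
    qed
  qed
  have col: "{x. x \<in> X \<and> T' x = t \<and> J' x = j \<and> u x = w} = {x \<in> X. T x = (t * U + w) * V + j mod V \<and> J x = j div V}"
    if "w < U" "j < n * V" for t j w
  proof -
    have "V > 0" using that by (cases V) auto
    hence "j mod V < V" by simp
    show ?thesis
    proof (rule Collect_cong, rule conj_cong[OF refl])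
      fix x assume "x \<in> X"
      show "(T' x = t \<and> J' x = j \<and> u x = w) = (T x = (t * U + w) * V + j mod V \<and> J x = j div V)"
        using dm[OF \<open>w < U\<close> \<open>j mod V < V\<close>, of t x] dJ[OF \<open>x \<in> X\<close>, of j] by metis
    qed
  qed
  have bi: "i div U < m \<and> i mod U < U" if "i < m * U" for i
    using that by (cases "U = 0") (auto simp: less_mult_imp_div_less)
  have bj: "j div V < n \<and> j mod V < V" if "j < n * V" for j
    using that by (cases "V = 0") (auto simp: less_mult_imp_div_less)
  have "magic_family (m * U) (n * V) (s * V) (k * U) c X T' I' J' l"
    unfolding magic_family_def
  proof (intro conjI)
    show "\<forall>x\<in>X. T' x < c \<and> I' x < m * U \<and> J' x < n * V"
    proof
      fix x assume x: "x \<in> X"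
      have "T' x < c" unfolding T'_def using rg[OF x] by (simp add: less_mult_imp_div_less)
      moreover have "I x * U + u x < m * U"
        using mult_le_mono1[of "Suc (I x)" m U] rg[OF x] uv[OF x] by simp
      moreover have "J x * V + v x < n * V"
        using mult_le_mono1[of "Suc (J x)" n V] rg[OF x] uv[OF x] by simp
      ultimately show "T' x < c \<and> I' x < m * U \<and> J' x < n * V" by (simp add: I'_def J'_def)
    qed
    show "inj_on (\<lambda>x. (T' x, I' x, J' x)) X"
    proof (rule inj_onI)
      fix x x' assume x: "x \<in> X" "x' \<in> X" "(T' x, I' x, J' x) = (T' x', I' x', J' x')"
      have "I x = I x'" "u x = u x'" using x dI[of x "I' x'"] dI[of x' "I' x'"] by auto
      moreover have "J x = J x'" "v x = v x'" using x dJ[of x "J' x'"] dJ[of x' "J' x'"] by auto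
      ultimately have "(\<lambda>x. (T x, I x, J x)) x = (\<lambda>x. (T x, I x, J x)) x'"
        using x Tdec[of x] Tdec[of x'] by simp
      thus "x = x'" using x(1,2) by (rule inj_onD[OF inj])
    qed
    have "n * V * (k * U) * c = n * k * (c * U * V)" by (simp only: ac_simps)
    thus "\<exists>a. \<forall>x\<in>X. a \<le> l x \<and> l x < a + int (n * V * (k * U) * c)"
      by (intro exI[of _ a] ballI) (simp only: a)
    show "\<forall>t<c. \<forall>i<m * U. card {x \<in> X. T' x = t \<and> I' x = i} = s * V"
    proof (intro allI impI)
      fix t i assume t: "t < c" and i: "i < m * U"
      have "card {x \<in> X. T' x = t \<and> I' x = i} = (\<Sum>w<V. card {x \<in> X. (T' x = t \<and> I' x = i) \<and> v x = w})"
        by (rule card_fibres[OF fin]) (use uv in auto)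
      also have "\<dots> = (\<Sum>w<V. s)"
        by (intro sum.cong refl) (use rows Tlt t bi[OF i] i in \<open>simp add: row\<close>)
      finally show "card {x \<in> X. T' x = t \<and> I' x = i} = s * V" by simp
    qed
    show "\<forall>t<c. \<forall>j<n * V. card {x \<in> X. T' x = t \<and> J' x = j} = k * U"
    proof (intro allI impI)
      fix t j assume t: "t < c" and j: "j < n * V"
      have "card {x \<in> X. T' x = t \<and> J' x = j} = (\<Sum>w<U. card {x \<in> X. (T' x = t \<and> J' x = j) \<and> u x = w})"
        by (rule card_fibres[OF fin]) (use uv in auto)
      also have "\<dots> = (\<Sum>w<U. k)"
        by (intro sum.cong refl) (use cols Tlt t bj[OF j] j in \<open>simp add: col\<close>)
      finally show "card {x \<in> X. T' x = t \<and> J' x = j} = k * U" by simp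
    qed
    have "(\<Sum>x | x \<in> X \<and> T' x = t \<and> I' x = i. l x) = int V * y" if t: "t < c" and i: "i < m * U" for t i
    proof -
      have "(\<Sum>x | x \<in> X \<and> T' x = t \<and> I' x = i. l x) = (\<Sum>w<V. \<Sum>x | x \<in> X \<and> (T' x = t \<and> I' x = i) \<and> v x = w. l x)"
        by (rule sum_fibres[OF fin]) (use uv in auto)
      also have "\<dots> = (\<Sum>w<V. y)"
        by (intro sum.cong refl) (use y Tlt t bi[OF i] i in \<open>simp add: row\<close>)
      finally show ?thesis by simp
    qed
    thus "\<exists>u. \<forall>t<c. \<forall>i<m * U. (\<Sum>x | x \<in> X \<and> T' x = t \<and> I' x = i. l x) = u" by blast
    have "(\<Sum>x | x \<in> X \<and> T' x = t \<and> J' x = j. l x) = int U * z" if t: "t < c" and j: "j < n * V" for t j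
    proof -
      have "(\<Sum>x | x \<in> X \<and> T' x = t \<and> J' x = j. l x) = (\<Sum>w<U. \<Sum>x | x \<in> X \<and> (T' x = t \<and> J' x = j) \<and> u x = w. l x)"
        by (rule sum_fibres[OF fin]) (use uv in auto)
      also have "\<dots> = (\<Sum>w<U. z)"
        by (intro sum.cong refl) (use z Tlt t bj[OF j] j in \<open>simp add: col\<close>)
      finally show ?thesis by simp
    qed
    thus "\<exists>u. \<forall>t<c. \<forall>j<n * V. (\<Sum>x | x \<in> X \<and> T' x = t \<and> J' x = j. l x) = u" by blast
  qed (use fin injl in auto)
  thus ?thesis by (rule MRS_exists_if_magic_family)
qed

text \<open>Array \<open>t * e + w\<close> occupies the rows and columns congruent to
  \<open>w\<close> modulo \<open>e\<close>, so every new line is a single old line. Up to a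
  permutation of rows and columns these are blocks along the diagonal.\<close>

lemma MRS_exists_block_diagonal:
  assumes "MRS_exists m n s k (c * e)"
  shows "MRS_exists (m * e) (n * e) s k c"
proof -
  obtain X :: "(nat \<times> nat \<times> nat) set" and T I J l where mf: "magic_family m n s k (c * e) X T I J l"
    using magic_family_if_MRS_exists[OF assms] by blast
  have fin: "finite X" and rg: "\<And>x. x \<in> X \<Longrightarrow> T x < c * e \<and> I x < m \<and> J x < n"
    and inj: "inj_on (\<lambda>x. (T x, I x, J x)) X" and injl: "inj_on l X"
    and rows: "\<And>t i. t < c * e \<Longrightarrow> i < m \<Longrightarrow> card {x \<in> X. T x = t \<and> I x = i} = s"
    and cols: "\<And>t j. t < c * e \<Longrightarrow> j < n \<Longrightarrow> card {x \<in> X. T x = t \<and> J x = j} = k"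
    using mf unfolding magic_family_def by auto
  obtain a where a: "\<And>x. x \<in> X \<Longrightarrow> a \<le> l x \<and> l x < a + int (n * k * (c * e))"
    using mf unfolding magic_family_def by auto
  obtain y where y: "\<And>t i. t < c * e \<Longrightarrow> i < m \<Longrightarrow> (\<Sum>x | x \<in> X \<and> T x = t \<and> I x = i. l x) = y"
    using mf unfolding magic_family_def by auto
  obtain z where z: "\<And>t j. t < c * e \<Longrightarrow> j < n \<Longrightarrow> (\<Sum>x | x \<in> X \<and> T x = t \<and> J x = j. l x) = z"
    using mf unfolding magic_family_def by auto
  define T' where "T' = (\<lambda>x. T x div e)"
  define I' where "I' = (\<lambda>x. I x * e + T x mod e)"
  define J' where "J' = (\<lambda>x. J x * e + T x mod e)"
  have pos: "e > 0" if "x \<in> X" for x using rg[OF that] by (auto intro!: gr0I)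
  have row: "{x. x \<in> X \<and> T' x = t \<and> I' x = i} = {x \<in> X. T x = t * e + i mod e \<and> I x = i div e}" if "e > 0" for t i
    using that by (auto simp: T'_def I'_def)
  have col: "{x. x \<in> X \<and> T' x = t \<and> J' x = j} = {x \<in> X. T x = t * e + j mod e \<and> J x = j div e}" if "e > 0" for t j
    using that by (auto simp: T'_def J'_def)
  have lt: "i div e < w \<and> t * e + i mod e < c * e \<and> e > 0" if "t < c" "i < w * e" for t i w
  proof -
    have e: "e > 0" using that by (cases e) auto
    have "t * e + i mod e < Suc t * e" using e by simp
    also have "\<dots> \<le> c * e" using that by (intro mult_le_mono1) simp
    finally show ?thesis using that e by (simp add: less_mult_imp_div_less)
  qed
  have "magic_family (m * e) (n * e) s k c X T' I' J' l"
    unfolding magic_family_def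
  proof (intro conjI)
    show "\<forall>x\<in>X. T' x < c \<and> I' x < m * e \<and> J' x < n * e"
    proof
      fix x assume x: "x \<in> X"
      have "T' x < c" unfolding T'_def using rg[OF x] by (simp add: less_mult_imp_div_less)
      moreover have "I x * e + T x mod e < m * e"
        using mult_le_mono1[of "Suc (I x)" m e] rg[OF x] mod_less_divisor[OF pos[OF x], of "T x"] by simp
      moreover have "J x * e + T x mod e < n * e"
        using mult_le_mono1[of "Suc (J x)" n e] rg[OF x] mod_less_divisor[OF pos[OF x], of "T x"] by simp
      ultimately show "T' x < c \<and> I' x < m * e \<and> J' x < n * e" by (simp add: I'_def J'_def)
    qed
    show "inj_on (\<lambda>x. (T' x, I' x, J' x)) X"
    proof (rule inj_onI)
      fix x x' assume x: "x \<in> X" "x' \<in> X" "(T' x, I' x, J' x) = (T' x', I' x', J' x')"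
      note e = pos[OF x(1)]
      have "x \<in> {x. x \<in> X \<and> T' x = T' x' \<and> I' x = I' x'}" "x' \<in> {x. x \<in> X \<and> T' x = T' x' \<and> I' x = I' x'}"
        "x \<in> {x. x \<in> X \<and> T' x = T' x' \<and> J' x = J' x'}" "x' \<in> {x. x \<in> X \<and> T' x = T' x' \<and> J' x = J' x'}"
        using x by auto
      hence "T x = T x'" "I x = I x'" "J x = J x'" unfolding row[OF e] col[OF e] by auto
      thus "x = x'" using x inj by (auto dest: inj_onD)
    qed
    have "n * e * k * c = n * k * (c * e)" by (simp only: ac_simps)
    thus "\<exists>a. \<forall>x\<in>X. a \<le> l x \<and> l x < a + int (n * e * k * c)"
      by (intro exI[of _ a] ballI) (simp only: a)
    show "\<forall>t<c. \<forall>i<m * e. card {x \<in> X. T' x = t \<and> I' x = i} = s"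
      using rows lt row by auto
    show "\<forall>t<c. \<forall>j<n * e. card {x \<in> X. T' x = t \<and> J' x = j} = k"
      using cols lt col by auto
    show "\<exists>u. \<forall>t<c. \<forall>i<m * e. (\<Sum>x | x \<in> X \<and> T' x = t \<and> I' x = i. l x) = u"
      using y lt row by (intro exI[of _ y]) auto
    show "\<exists>u. \<forall>t<c. \<forall>j<n * e. (\<Sum>x | x \<in> X \<and> T' x = t \<and> J' x = j. l x) = u"
      using z lt col by (intro exI[of _ z]) auto
  qed (use fin injl in auto)
  thus ?thesis by (rule MRS_exists_if_magic_family)
qed

section \<open>Necessity of the parity conditions\<close>

lemma MRS_exists_necessary:
  assumes "MRS_exists m n s k c" "m * s = n * k" "0 < m" "0 < n" "0 < s" "0 < k" "0 < c"
  shows "odd (n * k * c) \<or> (even s \<and> even k \<and> s * k > 4)"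
proof (rule ccontr)
  assume neg: "\<not> ?thesis"
  hence even_N: "even (n * k * c)" by blast
  obtain X :: "(nat \<times> nat \<times> nat) set" and T I J l where mf: "magic_family m n s k c X T I J l"
    using magic_family_if_MRS_exists[OF assms(1)] by blast
  define N where "N = n * k * c"
  have fin: "finite X" and rg: "\<And>x. x \<in> X \<Longrightarrow> T x < c \<and> I x < m \<and> J x < n"
    and inj: "inj_on (\<lambda>x. (T x, I x, J x)) X" and injl: "inj_on l X"
    and rows: "\<And>t i. t < c \<Longrightarrow> i < m \<Longrightarrow> card {x \<in> X. T x = t \<and> I x = i} = s"
    and cols: "\<And>t j. t < c \<Longrightarrow> j < n \<Longrightarrow> card {x \<in> X. T x = t \<and> J x = j} = k"
    using mf unfolding magic_family_def by auto
  obtain a where a: "\<And>x. x \<in> X \<Longrightarrow> a \<le> l x \<and> l x < a + int N"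
    using mf unfolding magic_family_def N_def by auto
  obtain u where u: "\<And>t i. t < c \<Longrightarrow> i < m \<Longrightarrow> (\<Sum>x | x \<in> X \<and> T x = t \<and> I x = i. l x) = u"
    using mf unfolding magic_family_def by auto
  obtain v where v: "\<And>t j. t < c \<Longrightarrow> j < n \<Longrightarrow> (\<Sum>x | x \<in> X \<and> T x = t \<and> J x = j. l x) = v"
    using mf unfolding magic_family_def by auto
  have lX: "l ` X = {a..<a + int N}"
  proof (rule card_subset_eq)
    show "l ` X \<subseteq> {a..<a + int N}" using a by auto
    show "card (l ` X) = card {a..<a + int N}"
      using card_image[OF injl] magic_family_card[OF mf, folded N_def] by simp
  qed simp
  have total: "2 * (\<Sum>x\<in>X. l x) = int N * (2 * a + int N - 1)"
  proof -
    have "(\<Sum>x\<in>X. l x) = \<Sum>{a..<a + int N}" using sum.reindex[OF injl, of id] lX by simp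
    also have "\<dots> = (\<Sum>i<N. a + int i)"
      by (rule sum.reindex_bij_witness[of _ "\<lambda>i. a + int i" "\<lambda>z. nat (z - a)"]) auto
    also have "2 * \<dots> = int N * (2 * a + int N - 1)"
      by (induction N) (auto simp: algebra_simps)
    finally show ?thesis .
  qed
  have "(\<Sum>x\<in>X. l x) = (\<Sum>t<c. \<Sum>x | x \<in> X \<and> T x = t. l x)"
    using sum_fibres[OF fin, of "\<lambda>_. True" T c l] rg by simp
  also have "\<dots> = (\<Sum>t<c. \<Sum>i<m. \<Sum>x | x \<in> X \<and> T x = t \<and> I x = i. l x)"
    by (intro sum.cong refl sum_fibres fin) (use rg in auto)
  also have "\<dots> = (\<Sum>t<c. \<Sum>i<m. u)" by (intro sum.cong refl u) auto
  finally have tu: "(\<Sum>x\<in>X. l x) = int (c * m) * u" by simp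
  have "(\<Sum>x\<in>X. l x) = (\<Sum>t<c. \<Sum>x | x \<in> X \<and> T x = t. l x)"
    using sum_fibres[OF fin, of "\<lambda>_. True" T c l] rg by simp
  also have "\<dots> = (\<Sum>t<c. \<Sum>j<n. \<Sum>x | x \<in> X \<and> T x = t \<and> J x = j. l x)"
    by (intro sum.cong refl sum_fibres fin) (use rg in auto)
  also have "\<dots> = (\<Sum>t<c. \<Sum>j<n. v)" by (intro sum.cong refl v) auto
  finally have tv: "(\<Sum>x\<in>X. l x) = int (c * n) * v" by simp
  have Ns: "N = c * m * s" and Nk: "N = c * n * k"
    using assms(2) by (simp_all add: N_def ac_simps)
  have "int (c * m) * (2 * u) = int (c * m) * (int s * (2 * a + int N - 1))"
    using total tu Ns by (simp add: ac_simps)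
  hence us: "2 * u = int s * (2 * a + int N - 1)" using assms by simp
  have "int (c * n) * (2 * v) = int (c * n) * (int k * (2 * a + int N - 1))"
    using total tv Nk by (simp add: ac_simps)
  hence vk: "2 * v = int k * (2 * a + int N - 1)" using assms by simp
  \<comment> \<open>This number is twice the mean label. It is odd because \<open>N\<close> is even,
    so the formulas for \<open>2 * u\<close> and \<open>2 * v\<close> force \<open>s\<close> and
    \<open>k\<close> to be even.\<close>
  have odd: "odd (2 * a + int N - 1)" using even_N by (simp add: N_def)
  have "even (int s * (2 * a + int N - 1))" "even (int k * (2 * a + int N - 1))"
    unfolding us[symmetric] vk[symmetric] by simp_all
  hence ev: "even s" "even k" using odd by simp_all
  then obtain s' k' where sk': "s = 2 * s'" "k = 2 * k'" by (auto elim!: evenE)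
  have "s * k \<le> 4" using neg ev by auto
  moreover have "1 \<le> s'" "1 \<le> k'" using sk' assms by auto
  ultimately have "s' = 1" "k' = 1"
    using mult_le_mono[of 2 s' 1 k'] mult_le_mono[of 1 s' 2 k'] sk' by fastforce+
  hence sk: "s = 2" "k = 2" using sk' by auto
  have uv: "u = v" using us vk sk by simp
  have "card X \<noteq> 0" using magic_family_card[OF mf] assms by simp
  then obtain x where x: "x \<in> X" by (cases "X = {}") auto
  have partner: "\<exists>y. y \<noteq> x \<and> S = {x, y}" if "card S = 2" "x \<in> S" for S :: "(nat \<times> nat \<times> nat) set"
    using that by (auto simp: card_2_iff doubleton_eq_iff)
  obtain y where y: "y \<noteq> x" "{z \<in> X. T z = T x \<and> I z = I x} = {x, y}"
    using partner[OF rows[of "T x" "I x", unfolded sk]] rg[OF x] x by blast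
  obtain z where z: "z \<noteq> x" "{z \<in> X. T z = T x \<and> J z = J x} = {x, z}"
    using partner[OF cols[of "T x" "J x", unfolded sk]] rg[OF x] x by blast
  have "l x + l y = u" using u[of "T x" "I x"] rg[OF x] y by simp
  moreover have "l x + l z = u" using v[of "T x" "J x"] rg[OF x] z uv by simp
  ultimately have "l y = l z" by simp
  moreover have yz: "y \<in> X" "T y = T x" "I y = I x" "z \<in> X" "T z = T x" "J z = J x" using y z by blast+
  ultimately have "y = z" using injl by (auto dest: inj_onD)
  hence "(\<lambda>x. (T x, I x, J x)) y = (\<lambda>x. (T x, I x, J x)) x" using yz by simp
  hence "y = x" using yz(1) x by (rule inj_onD[OF inj])
  thus False using y by simp
qed

section \<open>Even rows and columns\<close>

lemma residue_class_below:
  assumes "j < (n::nat)"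
  shows "{p. p < n * k \<and> p mod n = j} = (\<lambda>q. j + n * q) ` {..<k}"
proof (intro set_eqI iffI)
  fix p assume "p \<in> {p. p < n * k \<and> p mod n = j}"
  hence p: "p < n * k" "p mod n = j" by auto
  have "p = j + n * (p div n)" using p mod_mult_div_eq[of p n] by simp
  moreover have "p div n < k" using p by (simp add: less_mult_imp_div_less mult.commute)
  ultimately show "p \<in> (\<lambda>q. j + n * q) ` {..<k}" by blast
next
  fix p assume "p \<in> (\<lambda>q. j + n * q) ` {..<k}"
  then obtain q where q: "q < k" "p = j + n * q" by auto
  have "n * Suc q \<le> n * k" using q by (intro mult_le_mono2) simp
  hence "p < n * k" using q assms by simp
  moreover have "p mod n = j" using q assms by simp
  ultimately show "p \<in> {p. p < n * k \<and> p mod n = j}" by simp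
qed

text \<open>Position \<open>p\<close> of an array is the cell in row \<open>p div s\<close> and column \<open>p mod n\<close>. Positions \<open>2 e\<close> and
  \<open>2 e + 1\<close> hold opposite labels, so that rows of even length are balanced for free.\<close>

lemma MRS_exists_paired_filling:
  fixes w :: "nat \<Rightarrow> nat \<Rightarrow> nat" and \<epsilon> :: "nat \<Rightarrow> nat \<Rightarrow> int" and g :: "nat \<Rightarrow> nat \<Rightarrow> int"
  assumes "0 < s" "s \<le> n" "even s" "even k" "m * s = n * k"
    and g_def: "\<And>t p. g t p = (if even p then 1 else - 1) * \<epsilon> t (p div 2) * (2 * int (w t (p div 2)) + 1)"
    and inj: "inj_on (\<lambda>(t, e). w t e) ({..<c} \<times> {..<n * k div 2})"
    and less: "\<And>t e. t < c \<Longrightarrow> e < n * k div 2 \<Longrightarrow> w t e < n * k div 2 * c"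
    and sign: "\<And>t e. t < c \<Longrightarrow> e < n * k div 2 \<Longrightarrow> \<epsilon> t e = 1 \<or> \<epsilon> t e = - 1"
    and col: "\<And>t j. t < c \<Longrightarrow> j < n \<Longrightarrow> (\<Sum>q<k. g t (j + n * q)) = 0"
  shows "MRS_exists m n s k c"
proof -
  define E where "E = n * k div 2"
  have E: "n * k = 2 * E" using assms by (simp add: E_def)
  \<comment> \<open>Consecutive labels \<open>l\<close> correspond to consecutive odd numbers
    \<open>g = 2 * l + 1\<close>, which lie symmetrically about 0; all balancing is done on
    \<open>g\<close>.\<close>
  define l where "l = (\<lambda>t p. (g t p - 1) div 2)"
  have lg: "2 * l t p + 1 = g t p" if "t < c" "p < n * k" for t p
  proof -
    have "p div 2 < E" using that E by simp
    hence "odd (g t p)" using sign[of t "p div 2"] that by (auto simp: g_def E_def)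
    thus ?thesis by (simp add: l_def)
  qed
  have abs_g: "\<bar>g t p\<bar> = 2 * int (w t (p div 2)) + 1" if "t < c" "p < n * k" for t p
  proof -
    have "p div 2 < E" using that E by simp
    thus ?thesis using sign[of t "p div 2"] that by (auto simp: g_def E_def abs_mult)
  qed
  define X where "X = {..<c} \<times> {..<n * k}"
  define T :: "nat \<times> nat \<Rightarrow> nat" where "T = fst"
  define I :: "nat \<times> nat \<Rightarrow> nat" where "I = (\<lambda>(t, p). p div s)"
  define J :: "nat \<times> nat \<Rightarrow> nat" where "J = (\<lambda>(t, p). p mod n)"
  have n: "0 < n" using assms by simp
  have row: "{x. x \<in> X \<and> T x = t \<and> I x = i} = Pair t ` {i * s..<i * s + s}" if "t < c" "i < m" for t i
  proof (intro set_eqI iffI)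
    fix x assume "x \<in> {x. x \<in> X \<and> T x = t \<and> I x = i}"
    then obtain p where p: "x = (t, p)" "p div s = i" by (auto simp: X_def T_def I_def)
    have "p = i * s + p mod s" using p div_mult_mod_eq[of p s] by simp
    moreover have "p mod s < s" using assms by simp
    ultimately have "p \<in> {i * s..<i * s + s}" unfolding atLeastLessThan_iff by linarith
    thus "x \<in> Pair t ` {i * s..<i * s + s}" using p by blast
  next
    fix x assume "x \<in> Pair t ` {i * s..<i * s + s}"
    then obtain p where p: "x = (t, p)" "i * s \<le> p" "p < i * s + s" by auto
    have "p div s = i" using p by (intro div_nat_eqI) (auto simp: ac_simps)
    moreover have "Suc i * s \<le> m * s" using that by (intro mult_le_mono1) simp
    hence "p < n * k" using p assms by simp
    ultimately show "x \<in> {x. x \<in> X \<and> T x = t \<and> I x = i}"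
      using p that by (simp add: X_def T_def I_def)
  qed
  have cols: "{x. x \<in> X \<and> T x = t \<and> J x = j} = Pair t ` ((\<lambda>q. j + n * q) ` {..<k})" if "t < c" "j < n" for t j
    unfolding residue_class_below[OF that(2), symmetric] using that by (auto simp: X_def T_def J_def)
  have injP: "inj_on (Pair t) S" for t :: nat and S :: "nat set" by (auto simp: inj_on_def)
  have injq: "inj_on (\<lambda>q. j + n * q) S" for j S using n by (auto simp: inj_on_def)
  have "magic_family m n s k c X T I J (\<lambda>(t, p). l t p)"
    unfolding magic_family_def
  proof (intro conjI)
    show "finite X" by (simp add: X_def)
    have "p div s < m" if "p < n * k" for p using that assms(5) by (metis less_mult_imp_div_less)
    thus "\<forall>x\<in>X. T x < c \<and> I x < m \<and> J x < n" using n by (auto simp: X_def T_def I_def J_def)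
    show "inj_on (\<lambda>x. (T x, I x, J x)) X"
    proof (rule inj_onI)
      \<comment> \<open>Positions in one row differ by less than \<open>s\<close>, positions in one
        column by a multiple of \<open>n\<close>; with \<open>s \<le> n\<close> a row and a column
        share at most one position.\<close>
      have eq: "p = p'" if "p \<le> p'" "p div s = p' div s" "p mod n = p' mod n" for p p'
      proof -
        have "p' - p < s" using arg_cong[OF that(2), of "\<lambda>z. z * s"] div_mult_mod_eq[of p s] div_mult_mod_eq[of p' s]
            mod_less_divisor[OF assms(1), of p'] by linarith
        moreover have "n dvd p' - p" using that(1,3) by (metis mod_eq_dvd_iff_nat)
        ultimately have "p' - p = 0" using assms(2) by (meson dvd_imp_le gr0I leD le_trans)
        thus ?thesis using that by simp
      qed
      fix x x' assume "x \<in> X" "x' \<in> X" "(T x, I x, J x) = (T x', I x', J x')"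
      thus "x = x'" using eq[of "snd x" "snd x'"] eq[of "snd x'" "snd x"]
        by (cases "snd x \<le> snd x'") (auto simp: T_def I_def J_def split: prod.splits)
    qed
    show "inj_on (\<lambda>(t, p). l t p) X"
    proof (rule inj_onI, clarsimp simp: X_def)
      fix t p t' p' assume *: "t < c" "p < n * k" "t' < c" "p' < n * k" "l t p = l t' p'"
      have gg: "g t p = g t' p'" using lg[OF *(1,2)] lg[OF *(3,4)] *(5) by simp
      hence "w t (p div 2) = w t' (p' div 2)" using abs_g[OF *(1,2)] abs_g[OF *(3,4)] by simp
      moreover have pE: "p div 2 < E" "p' div 2 < E" using * E by auto
      ultimately have te: "t = t'" "p div 2 = p' div 2"
        using inj_onD[OF inj, of "(t, p div 2)" "(t', p' div 2)"] * by (auto simp: E_def)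
      have "even p = even p'"
        using gg te sign[of t "p div 2"] pE *(1) by (auto simp: g_def E_def split: if_splits)
      hence "p = p'" using te div_mult_mod_eq[of p 2] div_mult_mod_eq[of p' 2]
        by (metis parity_cases)
      thus "t = t' \<and> p = p'" using te by simp
    qed
    have "- int (E * c) \<le> l t p \<and> l t p < - int (E * c) + int (n * k * c)" if "t < c" "p < n * k" for t p
    proof -
      have "p div 2 < E" using that E by simp
      hence "w t (p div 2) < E * c" using less that by (simp add: E_def)
      moreover have "int (n * k * c) = 2 * int (E * c)" using E by simp
      ultimately show ?thesis using lg[OF that] abs_g[OF that] by linarith
    qed
    thus "\<exists>a. \<forall>x\<in>X. a \<le> (case x of (t, p) \<Rightarrow> l t p) \<and> (case x of (t, p) \<Rightarrow> l t p) < a + int (n * k * c)"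
      by (intro exI[of _ "- int (E * c)"]) (auto simp only: X_def split: prod.splits)
    show "\<forall>t<c. \<forall>i<m. card {x \<in> X. T x = t \<and> I x = i} = s"
      by (simp add: row card_image[OF injP])
    show "\<forall>t<c. \<forall>j<n. card {x \<in> X. T x = t \<and> J x = j} = k"
      by (simp add: cols card_image[OF injP] card_image[OF injq])
    have pairs: "(\<Sum>p\<in>{2 * a..<2 * a + 2 * b}. g t p) = 0" for a b t
      by (induction b) (auto simp: g_def)
    have "2 * (\<Sum>x | x \<in> X \<and> T x = t \<and> I x = i. case x of (t, p) \<Rightarrow> l t p) + int s = 0" if ti: "t < c" "i < m" for t i
    proof -
      obtain s' where s': "s = 2 * s'" using assms by (elim evenE)
      have lt: "p < n * k" if "p \<in> {i * s..<i * s + s}" for p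
      proof -
        have "(t, p) \<in> {x. x \<in> X \<and> T x = t \<and> I x = i}" using that row[OF ti] by blast
        thus ?thesis by (simp add: X_def)
      qed
      have "2 * (\<Sum>x | x \<in> X \<and> T x = t \<and> I x = i. case x of (t, p) \<Rightarrow> l t p) + int s
          = (\<Sum>p\<in>{i * s..<i * s + s}. 2 * l t p + 1)"
        unfolding row[OF ti] sum.reindex[OF injP] by (simp add: sum.distrib sum_distrib_left)
      also have "\<dots> = (\<Sum>p\<in>{i * s..<i * s + s}. g t p)"
        by (rule sum.cong[OF refl]) (rule lg[OF ti(1) lt])
      also have "\<dots> = 0" using pairs[of t "i * s'" s'] by (simp add: s' ac_simps)
      finally show ?thesis .
    qed
    hence "(\<Sum>x | x \<in> X \<and> T x = t \<and> I x = i. case x of (t, p) \<Rightarrow> l t p) = - int s div 2" if ti: "t < c" "i < m" for t i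
      using ti by fastforce
    thus "\<exists>u. \<forall>t<c. \<forall>i<m. (\<Sum>x | x \<in> X \<and> T x = t \<and> I x = i. case x of (t, p) \<Rightarrow> l t p) = u" by blast
    have "2 * (\<Sum>x | x \<in> X \<and> T x = t \<and> J x = j. case x of (t, p) \<Rightarrow> l t p) + int k = 0" if tj: "t < c" "j < n" for t j
    proof -
      have lt: "j + n * q < n * k" if "q \<in> {..<k}" for q
        using residue_class_below[OF tj(2), of k] that by blast
      have "2 * (\<Sum>x | x \<in> X \<and> T x = t \<and> J x = j. case x of (t, p) \<Rightarrow> l t p) + int k
          = (\<Sum>q<k. 2 * l t (j + n * q) + 1)"
        unfolding cols[OF tj] sum.reindex[OF injP] sum.reindex[OF injq] by (simp add: sum.distrib sum_distrib_left)
      also have "\<dots> = (\<Sum>q<k. g t (j + n * q))"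
        by (rule sum.cong[OF refl]) (rule lg[OF tj(1) lt])
      finally show ?thesis using col[OF tj] by simp
    qed
    hence "(\<Sum>x | x \<in> X \<and> T x = t \<and> J x = j. case x of (t, p) \<Rightarrow> l t p) = - int k div 2" if tj: "t < c" "j < n" for t j
      using tj by fastforce
    thus "\<exists>u. \<forall>t<c. \<forall>j<n. (\<Sum>x | x \<in> X \<and> T x = t \<and> J x = j. case x of (t, p) \<Rightarrow> l t p) = u" by blast
  qed
  thus ?thesis by (rule MRS_exists_if_magic_family)
qed

section \<open>Signed bundles of odd numbers with sum zero\<close>

text \<open>The periodic pattern \<open>+ - - +\<close>, under which any four consecutive odd
  numbers cancel.\<close>

definition sign4 :: "nat \<Rightarrow> int" where
  "sign4 q = (if q mod 4 = 0 \<or> q mod 4 = 3 then 1 else - 1)"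

lemma sum_sign4:
  "(\<Sum>q<4 * x. sign4 q * (2 * int (v + q) + 1)) = 0"
proof (induction x)
  case (Suc x)
  have "{..<4 * Suc x} = insert (4 * x + 3) (insert (4 * x + 2) (insert (4 * x + 1) (insert (4 * x) {..<4 * x})))"
    by auto
  moreover have "(4 * x) mod 4 = 0" "(4 * x + 1) mod 4 = 1" "(4 * x + 2) mod 4 = 2" "(4 * x + 3) mod 4 = 3"
    by presburger+
  hence "sign4 (4 * x) = 1" "sign4 (4 * x + 1) = - 1" "sign4 (4 * x + 2) = - 1" "sign4 (4 * x + 3) = 1"
    by (simp_all only: sign4_def) simp_all
  ultimately show ?case using Suc by (simp add: algebra_simps)
qed simp

lemma less_mult_add_bound:
  assumes "a < (M::nat)" "b < k"
  shows "a * k + b < M * k"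
proof -
  have "Suc a * k \<le> M * k" using assms by (intro mult_le_mono1) simp
  thus ?thesis using assms by simp
qed

lemma mult_add_unique:
  assumes "a * k + b = a' * k + b'" "b < (k::nat)" "b' < k"
  shows "a = a' \<and> b = b'"
proof -
  have "(a * k + b) div k = a" "(a' * k + b') div k = a'" "(a * k + b) mod k = b" "(a' * k + b') mod k = b'"
    using assms(2,3) by simp_all
  thus ?thesis using assms(1) by metis
qed

text \<open>Twelve consecutive odd numbers split into two balanced sextuples with three plus and three minus
  signs each, so the pattern may be shifted; a single sextuple of consecutive odd numbers is only
  balanced in the position \<open>1, 3, \<dots>, 11\<close>.\<close>

definition sextuple :: "nat \<Rightarrow> nat \<Rightarrow> nat \<Rightarrow> nat" where
  "sextuple M b q =
     (if odd M \<and> b = 0 then q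
      else 6 * (M mod 2) + 12 * ((b - M mod 2) div 2) +
        (if even (b - M mod 2) then [0, 1, 2, 3, 4, 6] else [5, 7, 8, 9, 10, 11]) ! q)"

definition sextuple_sign :: "nat \<Rightarrow> nat \<Rightarrow> nat \<Rightarrow> int" where
  "sextuple_sign M b q =
     (if odd M \<and> b = 0 then [- 1, - 1, - 1, 1, - 1, 1]
      else if even (b - M mod 2) then [1, - 1, 1, - 1, - 1, 1] else [1, - 1, - 1, 1, - 1, 1]) ! q"

lemma less_6_cases: "q < (6::nat) \<Longrightarrow> q = 0 \<or> q = 1 \<or> q = 2 \<or> q = 3 \<or> q = 4 \<or> q = 5"
  by linarith

lemma sextuple_pattern_inject:
  assumes "q < 6" "q' < 6"
    and "(if P then [0, 1, 2, 3, 4, 6] else [5, 7, 8, 9, 10, 11]) ! q =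
         (if P' then [0, 1, 2, 3, 4, 6] else [5, 7, 8, 9, 10, 11::nat]) ! q'"
  shows "P = P' \<and> q = q'"
proof -
  define A B where "A = [0, 1, 2, 3, 4, 6::nat]" and "B = [5, 7, 8, 9, 10, 11::nat]"
  have len: "length A = 6" "length B = 6" by (simp_all add: A_def B_def)
  have nth: "(if P then A else B) ! q = (A @ B) ! (if P then q else q + 6)" if "q < 6" for P q
    using that len by (auto simp: nth_append)
  have "(A @ B) ! (if P then q else q + 6) = (A @ B) ! (if P' then q' else q' + 6)"
    using assms nth by (simp only: A_def B_def)
  moreover have "distinct (A @ B)" by (simp add: A_def B_def)
  ultimately have "(if P then q else q + 6) = (if P' then q' else q' + 6)"
    using assms(1,2) by (subst (asm) nth_eq_iff_index_eq) (auto simp: A_def B_def)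
  thus ?thesis using assms(1,2) by (auto split: if_splits)
qed

lemma sum_sextuple: "(\<Sum>q<6. sextuple_sign M b q * (2 * int (sextuple M b q) + 1)) = 0"
proof -
  have "{..<6} = {0, 1, 2, 3, 4, 5::nat}" by auto
  thus ?thesis by (simp add: sextuple_def sextuple_sign_def algebra_simps)
qed

lemma sextuple_sign: "q < 6 \<Longrightarrow> sextuple_sign M b q = 1 \<or> sextuple_sign M b q = - 1"
  unfolding sextuple_sign_def by (drule less_6_cases, elim disjE) simp_all

lemma sextuple_less:
  assumes "b < M" "q < 6"
  shows "sextuple M b q < 6 * M"
proof (cases "odd M \<and> b = 0")
  case True
  hence "sextuple M b q = q" "0 < M" by (auto simp: sextuple_def elim: oddE)
  thus ?thesis using assms by simp
next
  case False
  define r where "r = b - M mod 2"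
  have "M mod 2 \<le> b" using False by (cases "odd M") (auto simp: odd_iff_mod_2_eq_one)
  hence r: "b = r + M mod 2" by (simp add: r_def)
  have "M = 2 * (M div 2) + M mod 2" by simp
  hence d: "r div 2 < M div 2" using assms r by linarith
  have x: "(if even r then [0, 1, 2, 3, 4, 6] else [5, 7, 8, 9, 10, 11]) ! q < (12::nat)"
    using less_6_cases[OF assms(2)] by auto
  have "sextuple M b q = 6 * (M mod 2) + 12 * (r div 2) + (if even r then [0, 1, 2, 3, 4, 6] else [5, 7, 8, 9, 10, 11]) ! q"
    using False by (simp only: sextuple_def r_def if_False)
  also have "\<dots> < 6 * M" using x d \<open>M = 2 * (M div 2) + M mod 2\<close> by linarith
  finally show ?thesis .
qed

lemma sextuple_inject:
  assumes "b < M" "q < 6" "b' < M" "q' < 6" "sextuple M b q = sextuple M b' q'"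
  shows "b = b' \<and> q = q'"
proof -
  define x where "x = (\<lambda>b q. (if even (b - M mod 2) then [0, 1, 2, 3, 4, 6] else [5, 7, 8, 9, 10, 11]) ! q :: nat)"
  have x: "x b q < 12" if "q < 6" for b q using less_6_cases[OF that] by (auto simp: x_def)
  have xx: "even (b - M mod 2) = even (b' - M mod 2) \<and> q = q'" if "q < 6" "q' < 6" "x b q = x b' q'" for b q b' q'
    using that unfolding x_def by (rule sextuple_pattern_inject)
  have gen: "sextuple M b q = 6 * (M mod 2) + 12 * ((b - M mod 2) div 2) + x b q" if "\<not> (odd M \<and> b = 0)" for b q
    using that by (simp only: sextuple_def x_def if_False)
  have sp: "sextuple M b q = q" if "odd M \<and> b = 0" for b q
    using that by (simp add: sextuple_def)
  consider "odd M \<and> b = 0" "odd M \<and> b' = 0" | "odd M \<and> b = 0" "\<not> (odd M \<and> b' = 0)"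
    | "\<not> (odd M \<and> b = 0)" "odd M \<and> b' = 0" | "\<not> (odd M \<and> b = 0)" "\<not> (odd M \<and> b' = 0)" by blast
  thus ?thesis
  proof cases
    case 1 thus ?thesis using assms sp by simp
  next
    case 2
    have "sextuple M b' q' \<ge> 6" using gen[OF 2(2)] 2 by (simp add: odd_iff_mod_2_eq_one)
    thus ?thesis using sp[OF 2(1)] assms by simp
  next
    case 3
    have "sextuple M b q \<ge> 6" using gen[OF 3(1)] 3 by (simp add: odd_iff_mod_2_eq_one)
    thus ?thesis using sp[OF 3(2)] assms by simp
  next
    case 4
    have "(b - M mod 2) div 2 * 12 + x b q = (b' - M mod 2) div 2 * 12 + x b' q'"
      using assms(5) gen[OF 4(1)] gen[OF 4(2)] by simp
    hence *: "(b - M mod 2) div 2 = (b' - M mod 2) div 2 \<and> x b q = x b' q'"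
      by (rule mult_add_unique) (use x assms in auto)
    hence "even (b - M mod 2) = even (b' - M mod 2)" "q = q'" using xx assms by blast+
    moreover have "b - M mod 2 = b' - M mod 2"
      using * calculation(1) by (metis (no_types) div_mult_mod_eq parity_cases)
    moreover have "M mod 2 \<le> b" "M mod 2 \<le> b'"
      using 4 by presburger+
    ultimately show ?thesis by simp
  qed
qed

text \<open>Made for even \<open>n = 2 * \<nu>\<close>: columns \<open>2 * b\<close> and
  \<open>2 * b + 1\<close> then contain the two halves of the same pairs, with opposite signs, so
  each of the \<open>M = c * \<nu>\<close> bundles has to vanish by itself. Blocks of four suffice
  if \<open>4 dvd k\<close>; otherwise each bundle takes one sextuple from the first
  \<open>6 * M\<close> numbers and blocks of four from the rest.\<close>

lemma ex_balanced_bundles: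
  assumes "even k" "4 \<le> (k::nat)"
  shows "\<exists>(w :: nat \<Rightarrow> nat \<Rightarrow> nat) (\<epsilon> :: nat \<Rightarrow> nat \<Rightarrow> int).
    inj_on (\<lambda>(b, q). w b q) ({..<M} \<times> {..<k}) \<and>
    (\<forall>b<M. \<forall>q<k. w b q < M * k \<and> (\<epsilon> b q = 1 \<or> \<epsilon> b q = - 1)) \<and>
    (\<forall>b<M. (\<Sum>q<k. \<epsilon> b q * (2 * int (w b q) + 1)) = 0)"
proof (cases "4 dvd k")
  case True
  then obtain x where x: "k = 4 * x" by blast
  show ?thesis
  proof (intro exI[of _ "\<lambda>b q. b * k + q"] exI[of _ "\<lambda>b. sign4"] conjI)
    show "inj_on (\<lambda>(b, q). b * k + q) ({..<M} \<times> {..<k})"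
      by (rule inj_onI) (auto dest: mult_add_unique)
    show "\<forall>b<M. \<forall>q<k. b * k + q < M * k \<and> (sign4 q = 1 \<or> sign4 q = - 1)"
      by (auto simp: less_mult_add_bound sign4_def)
    show "\<forall>b<M. (\<Sum>q<k. sign4 q * (2 * int (b * k + q) + 1)) = 0"
      using sum_sign4 unfolding x by blast
  qed
next
  case False
  define r where "r = k - 6"
  have "k mod 4 = 2" using assms False by presburger
  hence k: "k = r + 6" "4 dvd r" using assms unfolding r_def by presburger+
  then obtain x where x: "r = 4 * x" by blast
  define w where "w = (\<lambda>b q. if q < 6 then sextuple M b q else 6 * M + (b * r + (q - 6)))"
  define \<epsilon> where "\<epsilon> = (\<lambda>b q. if q < 6 then sextuple_sign M b q else sign4 (q - 6))"
  show ?thesis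
  proof (intro exI[of _ w] exI[of _ \<epsilon>] conjI allI impI)
    show "inj_on (\<lambda>(b, q). w b q) ({..<M} \<times> {..<k})"
    proof (rule inj_onI, clarsimp)
      fix b q b' q' assume *: "b < M" "q < k" "b' < M" "q' < k" "w b q = w b' q'"
      show "b = b' \<and> q = q'"
      proof (cases "q < 6"; cases "q' < 6")
        assume "q < 6" "q' < 6" thus ?thesis using sextuple_inject * by (simp add: w_def)
      next
        assume "q < 6" "\<not> q' < 6" thus ?thesis using sextuple_less[of b M q] * by (simp add: w_def)
      next
        assume "\<not> q < 6" "q' < 6" thus ?thesis using sextuple_less[of b' M q'] * by (simp add: w_def)
      next
        assume q: "\<not> q < 6" "\<not> q' < 6"
        hence "b * r + (q - 6) = b' * r + (q' - 6)" using * by (simp add: w_def)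
        hence "b = b' \<and> q - 6 = q' - 6" by (rule mult_add_unique) (use q * k in auto)
        thus ?thesis using q by auto
      qed
    qed
    fix b assume b: "b < M"
    show "w b q < M * k" if "q < k" for q
    proof (cases "q < 6")
      case True thus ?thesis using sextuple_less[OF b] k by (fastforce simp: w_def algebra_simps)
    next
      case False
      hence "b * r + (q - 6) < M * r" using that k b by (intro less_mult_add_bound) auto
      thus ?thesis using False k by (simp add: w_def algebra_simps)
    qed
    show "\<epsilon> b q = 1 \<or> \<epsilon> b q = - 1" if "q < k" for q
      using sextuple_sign by (auto simp: \<epsilon>_def sign4_def)
    have "(\<Sum>q<k. \<epsilon> b q * (2 * int (w b q) + 1)) = (\<Sum>q<6. \<epsilon> b q * (2 * int (w b q) + 1)) + (\<Sum>q<r. \<epsilon> b (q + 6) * (2 * int (w b (q + 6)) + 1))"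
      unfolding k(1) by (simp only: lessThan_atLeast0 sum.atLeastLessThan_concat[of 0 6 "r + 6", symmetric] sum.shift_bounds_nat_ivl[of _ 0 6 r, simplified])
    also have "(\<Sum>q<6. \<epsilon> b q * (2 * int (w b q) + 1)) = 0"
      using sum_sextuple[of M b] by (simp add: \<epsilon>_def w_def)
    also have "(\<Sum>q<r. \<epsilon> b (q + 6) * (2 * int (w b (q + 6)) + 1)) = 0"
      using sum_sign4[of "6 * M + b * r" x] by (simp add: \<epsilon>_def w_def x ac_simps)
    finally show "(\<Sum>q<k. \<epsilon> b q * (2 * int (w b q) + 1)) = 0" by simp
  qed
qed

section \<open>Signed bundles with a common sum, for odd \<open>n\<close>\<close>

lemma sum_alternating_sign:
  "(\<Sum>q<2 * y. (if even q then - 1 else 1) * (2 * int (v + q) + 1)) = 2 * int y"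
  by (induction y) (simp_all add: algebra_simps)

text \<open>For \<open>n = 2 h + 1\<close> the sums \<open>b + ((b + h) mod n)\<close> run through \<open>n\<close> consecutive integers.\<close>

definition additive_triple :: "nat \<Rightarrow> nat \<Rightarrow> nat \<Rightarrow> nat" where
  "additive_triple h q b =
     (if q = 0 then b else if q = 1 then (if b \<le> h then b + h else b - h - 1)
      else (if b \<le> h then 2 * b else 2 * b - 2 * h - 1))"

lemma additive_triple:
  assumes "b < 2 * h + 1"
  shows "additive_triple h 0 b + additive_triple h 1 b = additive_triple h 2 b + h"
    and "additive_triple h q b < 2 * h + 1"
  using assms by (auto simp: additive_triple_def)

lemma additive_triple_inject:
  assumes "b < 2 * h + 1" "b' < 2 * h + 1" "additive_triple h q b = additive_triple h q b'"
  shows "b = b'"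
  using assms unfolding additive_triple_def by (simp split: if_splits; presburger)

text \<open>For odd \<open>n\<close> the position \<open>j + n * q\<close> changes parity with
  \<open>q\<close>, so a column takes the even halves of one bundle and the odd halves of another.
  These contribute \<open>F t\<close> and \<open>- F t\<close>; hence a common sum per array is
  enough. If \<open>K\<close> is odd, three members with signs \<open>+ + -\<close> come from
  \<open>additive_triple\<close>, whose defect \<open>h\<close> does not depend on \<open>b\<close>,
  and the other members alternate in sign.\<close>

lemma ex_equal_bundles:
  fixes n K c :: nat
  assumes "odd n" "2 \<le> K"
  shows "\<exists>(w :: nat \<Rightarrow> nat \<Rightarrow> nat \<Rightarrow> nat) (\<epsilon> :: nat \<Rightarrow> nat \<Rightarrow> nat \<Rightarrow> int) (F :: nat \<Rightarrow> int).
    inj_on (\<lambda>(t, b, q). w t b q) ({..<c} \<times> {..<n} \<times> {..<K}) \<and>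
    (\<forall>t<c. \<forall>b<n. \<forall>q<K. w t b q < c * n * K \<and> (\<epsilon> t b q = 1 \<or> \<epsilon> t b q = - 1)) \<and>
    (\<forall>t<c. \<forall>b<n. (\<Sum>q<K. \<epsilon> t b q * (2 * int (w t b q) + 1)) = F t)"
proof (cases "even K")
  case True
  then obtain y where y: "K = 2 * y" by (elim evenE)
  show ?thesis
  proof (intro exI[of _ "\<lambda>t b q. (t * n + b) * K + q"] exI[of _ "\<lambda>t b q. if even q then - 1 else 1"]
      exI[of _ "\<lambda>t. 2 * int y"] conjI)
    show "inj_on (\<lambda>(t, b, q). (t * n + b) * K + q) ({..<c} \<times> {..<n} \<times> {..<K})"
    proof (rule inj_onI, clarsimp)
      fix t b q t' b' q'
      assume *: "b < n" "q < K" "b' < n" "q' < K" "(t * n + b) * K + q = (t' * n + b') * K + q'"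
      have "t * n + b = t' * n + b' \<and> q = q'" using *(5,2,4) by (rule mult_add_unique)
      thus "t = t' \<and> b = b' \<and> q = q'" using mult_add_unique[of t n b t' b'] * by blast
    qed
    show "\<forall>t<c. \<forall>b<n. \<forall>q<K. (t * n + b) * K + q < c * n * K \<and>
        ((if even q then - 1 else 1 :: int) = 1 \<or> (if even q then - 1 else 1 :: int) = - 1)"
      by (auto intro!: less_mult_add_bound)
    show "\<forall>t<c. \<forall>b<n. (\<Sum>q<K. (if even q then - 1 else 1) * (2 * int ((t * n + b) * K + q) + 1)) = 2 * int y"
      using sum_alternating_sign unfolding y by blast
  qed
next
  case False
  define r where "r = K - 3"
  have K: "K = r + 3" "even r" using assms False unfolding r_def by presburger+
  then obtain y where y: "r = 2 * y" by (elim evenE)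
  obtain h where h: "n = 2 * h + 1" using assms by (elim oddE)
  define w where "w = (\<lambda>t b q. if q < 3 then (t * 3 + q) * n + additive_triple h q b
     else 3 * n * c + ((t * n + b) * r + (q - 3)))"
  define \<epsilon> :: "nat \<Rightarrow> nat \<Rightarrow> nat \<Rightarrow> int" where "\<epsilon> = (\<lambda>t b q. if q < 3 then (if q = 2 then - 1 else 1) else (if even (q - 3) then - 1 else 1))"
  have w3: "w t b q < 3 * n * c" if "t < c" "b < n" "q < 3" for t b q
  proof -
    have "(t * 3 + q) * n + additive_triple h q b < c * 3 * n"
      using that additive_triple(2)[of b h q] h by (intro less_mult_add_bound) auto
    thus ?thesis using that by (simp add: w_def ac_simps)
  qed
  show ?thesis
  proof (intro exI[of _ w] exI[of _ \<epsilon>] exI[of _ "\<lambda>t. 2 * (3 * int (t * n) - int n + int h) + 1 + 2 * int y"] conjI allI impI)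
    show "inj_on (\<lambda>(t, b, q). w t b q) ({..<c} \<times> {..<n} \<times> {..<K})"
    proof (rule inj_onI, clarsimp)
      fix t b q t' b' q' assume *: "t < c" "b < n" "q < K" "t' < c" "b' < n" "q' < K" "w t b q = w t' b' q'"
      show "t = t' \<and> b = b' \<and> q = q'"
      proof (cases "q < 3"; cases "q' < 3")
        assume q: "q < 3" "q' < 3"
        hence "(t * 3 + q) * n + additive_triple h q b = (t' * 3 + q') * n + additive_triple h q' b'"
          using * by (simp add: w_def)
        hence 1: "t * 3 + q = t' * 3 + q' \<and> additive_triple h q b = additive_triple h q' b'"
          by (rule mult_add_unique) (use additive_triple(2) * h in auto)
        hence "t = t' \<and> q = q'" using mult_add_unique[of t 3 q t' q'] q by blast
        thus ?thesis using 1 additive_triple_inject[of b h b' q] * h by simp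
      next
        assume "q < 3" "\<not> q' < 3" thus ?thesis using w3[of t b q] * by (simp add: w_def)
      next
        assume "\<not> q < 3" "q' < 3" thus ?thesis using w3[of t' b' q'] * by (simp add: w_def)
      next
        assume q: "\<not> q < 3" "\<not> q' < 3"
        hence "(t * n + b) * r + (q - 3) = (t' * n + b') * r + (q' - 3)" using * by (simp add: w_def)
        hence 1: "t * n + b = t' * n + b' \<and> q - 3 = q' - 3" by (rule mult_add_unique) (use q * K in auto)
        hence "t = t' \<and> b = b'" using mult_add_unique[of t n b t' b'] * by blast
        thus ?thesis using 1 q by auto
      qed
    qed
    fix t b assume t: "t < c" and b: "b < n"
    show "w t b q < c * n * K" if "q < K" for q
    proof (cases "q < 3")
      case True thus ?thesis using w3[OF t b True] by (simp add: K algebra_simps)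
    next
      case False
      hence "(t * n + b) * r + (q - 3) < c * n * r" using that K t b by (intro less_mult_add_bound) auto
      thus ?thesis using False by (simp add: w_def K algebra_simps)
    qed
    show "\<epsilon> t b q = 1 \<or> \<epsilon> t b q = - 1" for q by (simp add: \<epsilon>_def)
    have "(\<Sum>q<K. \<epsilon> t b q * (2 * int (w t b q) + 1)) = (\<Sum>q<3. \<epsilon> t b q * (2 * int (w t b q) + 1)) + (\<Sum>q<r. \<epsilon> t b (q + 3) * (2 * int (w t b (q + 3)) + 1))"
      unfolding K(1) by (simp only: lessThan_atLeast0 sum.atLeastLessThan_concat[of 0 3 "r + 3", symmetric] sum.shift_bounds_nat_ivl[of _ 0 3 r, simplified])
    also have "(\<Sum>q<r. \<epsilon> t b (q + 3) * (2 * int (w t b (q + 3)) + 1)) = 2 * int y"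
      using sum_alternating_sign[of "3 * n * c + (t * n + b) * r" y] by (simp add: \<epsilon>_def w_def y ac_simps)
    also have "(\<Sum>q<3. \<epsilon> t b q * (2 * int (w t b q) + 1)) = 2 * (3 * int (t * n) - int n + int h) + 1"
    proof -
      have "int (additive_triple h 0 b) + int (additive_triple h 1 b) = int (additive_triple h 2 b) + int h"
        using additive_triple(1)[of b h] b h by (simp flip: of_nat_add)
      moreover have "{..<3} = {0, 1, 2::nat}" by auto
      ultimately show ?thesis by (simp add: \<epsilon>_def w_def algebra_simps)
    qed
    finally show "(\<Sum>q<K. \<epsilon> t b q * (2 * int (w t b q) + 1)) = 2 * (3 * int (t * n) - int n + int h) + 1 + 2 * int y" .
  qed
qed

lemma sum_lessThan_double:
  fixes y :: nat
  shows "(\<Sum>q<2 * y. f q) = (\<Sum>q<y. f (2 * q) + f (2 * q + 1) :: 'a::comm_monoid_add)"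
  by (induction y) (simp_all add: ac_simps)

lemma MRS_exists_even_columns:
  assumes "0 < s" "s \<le> n" "even s" "even k" "4 \<le> k" "m * s = n * k"
  shows "MRS_exists m n s k c"
proof (cases "even n")
  case True
  then obtain \<nu> where n: "n = 2 * \<nu>" by (elim evenE)
  have \<nu>: "0 < \<nu>" using assms n by simp
  obtain w :: "nat \<Rightarrow> nat \<Rightarrow> nat" and \<epsilon> :: "nat \<Rightarrow> nat \<Rightarrow> int"
    where inj: "inj_on (\<lambda>(b, q). w b q) ({..<c * \<nu>} \<times> {..<k})"
      and w: "\<forall>b<c * \<nu>. \<forall>q<k. w b q < c * \<nu> * k \<and> (\<epsilon> b q = 1 \<or> \<epsilon> b q = - 1)"
      and bal: "\<forall>b<c * \<nu>. (\<Sum>q<k. \<epsilon> b q * (2 * int (w b q) + 1)) = 0"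
    using ex_balanced_bundles[OF assms(4,5), of "c * \<nu>"] by blast
  have half: "n * k div 2 = \<nu> * k" by (simp add: n)
  define W where "W = (\<lambda>t e. w (t * \<nu> + e mod \<nu>) (e div \<nu>))"
  define E where "E = (\<lambda>t e. \<epsilon> (t * \<nu> + e mod \<nu>) (e div \<nu>))"
  have bd: "t * \<nu> + e mod \<nu> < c * \<nu> \<and> e div \<nu> < k" if "t < c" "e < \<nu> * k" for t e
    using less_mult_add_bound[OF that(1), of "e mod \<nu>" \<nu>] less_mult_imp_div_less[of e k \<nu>] that \<nu>
    by (simp add: mult.commute)
  show ?thesis
  proof (rule MRS_exists_paired_filling[where w = W and \<epsilon> = E and g = "\<lambda>t p. (if even p then 1 else - 1) * E t (p div 2) * (2 * int (W t (p div 2)) + 1)"])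
    show "inj_on (\<lambda>(t, e). W t e) ({..<c} \<times> {..<n * k div 2})"
    proof (rule inj_onI, clarsimp simp: half)
      fix t e t' e' assume *: "t < c" "e < \<nu> * k" "t' < c" "e' < \<nu> * k" "W t e = W t' e'"
      have "t * \<nu> + e mod \<nu> = t' * \<nu> + e' mod \<nu> \<and> e div \<nu> = e' div \<nu>"
        using inj_onD[OF inj, of "(t * \<nu> + e mod \<nu>, e div \<nu>)" "(t' * \<nu> + e' mod \<nu>, e' div \<nu>)"]
          bd[OF *(1,2)] bd[OF *(3,4)] *(5) by (simp add: W_def)
      moreover from this have "t = t' \<and> e mod \<nu> = e' mod \<nu>"
        using \<nu> by (intro mult_add_unique) auto
      ultimately show "t = t' \<and> e = e'" by (metis div_mult_mod_eq)
    qed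
    show "W t e < n * k div 2 * c" if "t < c" "e < n * k div 2" for t e
      using w bd[of t e] that unfolding half W_def by (simp add: ac_simps)
    show "E t e = 1 \<or> E t e = - 1" if "t < c" "e < n * k div 2" for t e
      using w bd[of t e] that unfolding half E_def by simp
    show "(\<Sum>q<k. (if even (j + n * q) then 1 else - 1) * E t ((j + n * q) div 2) * (2 * int (W t ((j + n * q) div 2)) + 1)) = 0"
      if "t < c" "j < n" for t j
    proof -
      have j: "j div 2 < \<nu>" using that n by simp
      have "(j + n * q) div 2 = j div 2 + \<nu> * q" for q by (simp add: n)
      hence "(\<Sum>q<k. (if even (j + n * q) then 1 else - 1) * E t ((j + n * q) div 2) * (2 * int (W t ((j + n * q) div 2)) + 1))
        = (\<Sum>q<k. (if even j then 1 else - 1) * (\<epsilon> (t * \<nu> + j div 2) q * (2 * int (w (t * \<nu> + j div 2) q) + 1)))"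
        using j by (simp add: n E_def W_def mult.assoc)
      also have "\<dots> = (if even j then 1 else - 1) * (\<Sum>q<k. \<epsilon> (t * \<nu> + j div 2) q * (2 * int (w (t * \<nu> + j div 2) q) + 1))"
        by (simp only: sum_distrib_left)
      also have "\<dots> = 0" using bal j that less_mult_add_bound[of t c "j div 2" \<nu>] by simp
      finally show ?thesis .
    qed
  qed (use assms in auto)
next
  case False
  obtain K where K: "k = 2 * K" using assms by (elim evenE)
  have n: "0 < n" using assms by simp
  obtain w :: "nat \<Rightarrow> nat \<Rightarrow> nat \<Rightarrow> nat" and \<epsilon> :: "nat \<Rightarrow> nat \<Rightarrow> nat \<Rightarrow> int" and F :: "nat \<Rightarrow> int"
    where inj: "inj_on (\<lambda>(t, b, q). w t b q) ({..<c} \<times> {..<n} \<times> {..<K})"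
      and w: "\<forall>t<c. \<forall>b<n. \<forall>q<K. w t b q < c * n * K \<and> (\<epsilon> t b q = 1 \<or> \<epsilon> t b q = - 1)"
      and bal: "\<forall>t<c. \<forall>b<n. (\<Sum>q<K. \<epsilon> t b q * (2 * int (w t b q) + 1)) = F t"
    using ex_equal_bundles[of n K c] False assms K by auto
  have half: "n * k div 2 = n * K" by (simp add: K)
  define W where "W = (\<lambda>t e. w t (e mod n) (e div n))"
  define E where "E = (\<lambda>t e. \<epsilon> t (e mod n) (e div n))"
  have bd: "e mod n < n \<and> e div n < K" if "e < n * K" for e
    using that n by (auto simp: less_mult_imp_div_less mult.commute)
  show ?thesis
  proof (rule MRS_exists_paired_filling[where w = W and \<epsilon> = E and g = "\<lambda>t p. (if even p then 1 else - 1) * E t (p div 2) * (2 * int (W t (p div 2)) + 1)"])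
    show "inj_on (\<lambda>(t, e). W t e) ({..<c} \<times> {..<n * k div 2})"
    proof (rule inj_onI, clarsimp simp: half)
      fix t e t' e' assume *: "t < c" "e < n * K" "t' < c" "e' < n * K" "W t e = W t' e'"
      have "t = t' \<and> e mod n = e' mod n \<and> e div n = e' div n"
        using inj_onD[OF inj, of "(t, e mod n, e div n)" "(t', e' mod n, e' div n)"]
          bd[OF *(2)] bd[OF *(4)] * by (simp add: W_def)
      thus "t = t' \<and> e = e'" by (metis div_mult_mod_eq)
    qed
    show "W t e < n * k div 2 * c" if "t < c" "e < n * k div 2" for t e
      using w bd[of e] that unfolding half W_def by (simp add: ac_simps)
    show "E t e = 1 \<or> E t e = - 1" if "t < c" "e < n * k div 2" for t e
      using w bd[of e] that unfolding half E_def by simp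
    show "(\<Sum>q<k. (if even (j + n * q) then 1 else - 1) * E t ((j + n * q) div 2) * (2 * int (W t ((j + n * q) div 2)) + 1)) = 0"
      if t: "t < c" and j: "j < n" for t j
    proof -
      define f where "f = (\<lambda>p. (if even p then 1 else - 1) * E t (p div 2) * (2 * int (W t (p div 2)) + 1))"
      have plus: "(\<Sum>q<K. f (2 * b + 2 * n * q)) = F t" if "b < n" for b
      proof -
        have "(2 * b + 2 * n * q) div 2 = b + n * q" for q by simp
        thus ?thesis using bal t that by (simp add: f_def E_def W_def)
      qed
      have minus: "(\<Sum>q<K. f (2 * b + 1 + 2 * n * q)) = - F t" if "b < n" for b
      proof -
        have "(2 * b + 1 + 2 * n * q) div 2 = b + n * q" for q by simp
        hence "(\<Sum>q<K. f (2 * b + 1 + 2 * n * q)) = (\<Sum>q<K. - (\<epsilon> t b q * (2 * int (w t b q) + 1)))"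
          using that by (simp add: f_def E_def W_def)
        thus ?thesis using bal t that by (simp only: sum_negf)
      qed
      \<comment> \<open>Separating even from odd \<open>q\<close> separates the even positions of
        the column from the odd ones; each part runs through one complete bundle.\<close>
      have "(\<Sum>q<k. f (j + n * q)) = (\<Sum>q<K. f (j + 2 * n * q)) + (\<Sum>q<K. f (j + n + 2 * n * q))"
        unfolding K sum_lessThan_double by (simp add: sum.distrib algebra_simps)
      also have "\<dots> = 0"
      proof (cases "even j")
        case True
        then obtain b where b: "j = 2 * b" by (elim evenE)
        have eq: "2 * ((j + n) div 2) + 1 = j + n" and lt: "(j + n) div 2 < n" using True False j by presburger+
        show ?thesis using plus[of b] minus[OF lt, unfolded eq] b j by simp
      next
        case odd: False
        then obtain b where b: "j = 2 * b + 1" by (elim oddE)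
        have eq: "2 * ((j + n) div 2) = j + n" and lt: "(j + n) div 2 < n" using odd False j by presburger+
        show ?thesis using minus[of b] plus[OF lt, unfolded eq] b j by simp
      qed
      finally show ?thesis by (simp add: f_def)
    qed
  qed (use assms in auto)
qed

text \<open>Two even numbers with product above 4 cannot both be 2, and the column construction
  needs \<open>4 \<le> k\<close>; for \<open>k = 2\<close> it is applied to the transposed
  problem.\<close>

lemma MRS_exists_even:
  assumes "0 < s" "0 < k" "s \<le> n" "k \<le> m" "even s" "even k" "4 < s * k" "m * s = n * k"
  shows "MRS_exists m n s k c"
proof (cases "4 \<le> k")
  case True
  thus ?thesis using assms MRS_exists_even_columns by blast
next
  case False
  hence "k = 2" using assms by presburger
  hence "4 \<le> s" using assms by presburger
  hence "MRS_exists n m k s c" using assms by (intro MRS_exists_even_columns) auto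
  thus ?thesis using assms MRS_exists_transpose by metis
qed

section \<open>Odd squares with \<open>d\<close> filled diagonals\<close>

text \<open>Halving modulo an odd \<open>e\<close>, since \<open>(e + 1) div 2\<close> is then the
  inverse of 2.\<close>

definition half_mod :: "int \<Rightarrow> int \<Rightarrow> int" where
  "half_mod e z = z * ((e + 1) div 2) mod e"

lemma half_mod_eq:
  assumes "odd e" "0 < e"
  shows "half_mod e z = (if even (z mod e) then z mod e div 2 else (z mod e + e) div 2)"
proof -
  obtain h where h: "e = 2 * h + 1" using assms by (elim oddE)
  define y where "y = z mod e"
  have y: "0 \<le> y" "y < e" using assms by (simp_all add: y_def)
  have "(e + 1) div 2 = h + 1" using h by simp
  hence "half_mod e z = y * (h + 1) mod e" by (simp only: half_mod_def y_def mod_mult_left_eq)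
  also have "\<dots> = (if even y then y div 2 else (y + e) div 2)"
  proof (cases "even y")
    case True
    then obtain x where x: "y = 2 * x" by (elim evenE)
    have "y * (h + 1) = x + x * e" by (simp add: x h algebra_simps)
    thus ?thesis using y x by simp
  next
    case False
    then obtain x where x: "y = 2 * x + 1" by (elim oddE)
    have "y * (h + 1) = (x + h + 1) + x * e" by (simp add: x h algebra_simps)
    moreover have "(x + h + 1) mod e = x + h + 1" using y x h by simp
    ultimately show ?thesis using x h by simp
  qed
  finally show ?thesis by (simp add: y_def)
qed

lemma neg_mod_eq:
  assumes "0 < (e::int)"
  shows "(- z - 1) mod e = e - 1 - z mod e"
proof -
  have "- z - 1 = (e - 1 - z mod e) + (- (z div e) - 1) * e"
    using div_mult_mod_eq[of z e] by (simp add: algebra_simps)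
  hence "(- z - 1) mod e = (e - 1 - z mod e) mod e" by (metis mod_mult_self1)
  also have "\<dots> = e - 1 - z mod e"
    using assms pos_mod_bound[OF assms, of z] pos_mod_sign[OF assms, of z] by (intro mod_pos_pos_trivial) linarith+
  finally show ?thesis .
qed

text \<open>Modulo \<open>e\<close> the sum is \<open>-3/2\<close> for every \<open>z\<close>. The
  chosen representatives also have a constant sum: for \<open>y > 0\<close> exactly one of
  \<open>y\<close> and \<open>y - 1\<close> is odd and picks up the summand \<open>e\<close> before
  it is halved, and the wrap-around at \<open>y = 0\<close> gives
  \<open>0 + h + 2 * h\<close>.\<close>

lemma half_mod_triple:
  assumes "odd e" "0 < e"
  shows "half_mod e z + half_mod e (z - 1) + (- z - 1) mod e = 3 * ((e - 1) div 2)"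
proof -
  obtain h where h: "e = 2 * h + 1" using assms by (elim oddE)
  define y where "y = z mod e"
  have y: "0 \<le> y" "y < e" using assms by (simp_all add: y_def)
  have y1: "(z - 1) mod e = (if y = 0 then 2 * h else y - 1)"
  proof -
    have "(z - 1) mod e = (y - 1) mod e" by (simp add: y_def mod_diff_left_eq)
    also have "\<dots> = (if y = 0 then 2 * h else y - 1)"
      using y h by (auto simp: zmod_minus1)
    finally show ?thesis .
  qed
  show ?thesis
    unfolding half_mod_eq[OF assms] neg_mod_eq[OF assms(2)] y1 y_def[symmetric]
    using y h by (cases "y = 0"; cases "even y") (auto elim!: evenE oddE)
qed

lemma half_mod_cong: "z mod e = z' mod e \<Longrightarrow> half_mod e z = half_mod e z'"
  unfolding half_mod_def by (metis mod_mult_left_eq)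

lemma half_mod_inject:
  assumes "odd e" "half_mod e z = half_mod e z'"
  shows "z mod e = z' mod e"
proof -
  obtain h where h: "e = 2 * h + 1" using assms by (elim oddE)
  have "(e + 1) div 2 = h + 1" using h by simp
  hence "e dvd (z - z') * (h + 1)"
    using assms(2) by (simp only: half_mod_def mod_eq_dvd_iff left_diff_distrib)
  hence "e dvd 2 * ((z - z') * (h + 1)) - (z - z') * e"
    using dvd_mult[OF _, of e _ 2] by (intro dvd_diff dvd_triv_right) blast
  also have "2 * ((z - z') * (h + 1)) - (z - z') * e = z - z'" by (simp add: h algebra_simps)
  finally show ?thesis by (simp add: mod_eq_dvd_iff)
qed

lemma half_mod_range: "0 < e \<Longrightarrow> 0 \<le> half_mod e z \<and> half_mod e z < e"
  by (simp add: half_mod_def)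

text \<open>One permutation of the residues modulo \<open>e\<close> for each diagonal \<open>r < d\<close>: a row meets the diagonals at a common
  argument, a column at the arguments \<open>z - r\<close>, and both sums have to be constant. Each of the lists below has this
  property on its own.\<close>

definition diagonal_base :: "nat \<Rightarrow> nat" where
  "diagonal_base d = (if d mod 4 = 3 then 3 else 5)"

definition diagonal_perm :: "nat \<Rightarrow> int \<Rightarrow> nat \<Rightarrow> int \<Rightarrow> int" where
  "diagonal_perm d e r z =
    (if r < diagonal_base d then
       (if d mod 4 = 3 then [half_mod e (z - 1), (- z - 1) mod e, half_mod e z]
        else [(- z - 1) mod e, half_mod e (z - 1), (z + 2) mod e, half_mod e z, (- (z + 2) - 1) mod e]) ! r
     else [z mod e, (- z - 1) mod e, (- (z + 2) - 1) mod e, (z + 2) mod e] ! ((r - diagonal_base d) mod 4))"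

text \<open>Every entry is an affine map of the residues with slope 1, -1 or 1/2. Range, invariance
  under congruence and injectivity are then checked once per slope.\<close>

lemma diagonal_perm_cases:
  obtains c where "diagonal_perm d e r = (\<lambda>z. (z + c) mod e)"
  | c where "diagonal_perm d e r = (\<lambda>z. (- z + c) mod e)"
  | c where "diagonal_perm d e r = (\<lambda>z. half_mod e (z + c))"
proof -
  have 4: "(r - diagonal_base d) mod 4 \<in> {0, 1, 2, 3}" by auto
  consider "r < 3" "d mod 4 = 3" | "r < 5" "d mod 4 \<noteq> 3" | "\<not> r < diagonal_base d"
    by (cases "d mod 4 = 3"; cases "r < diagonal_base d") (auto simp: diagonal_base_def)
  thus ?thesis
  proof cases
    case 1
    hence "r = 0 \<or> r = 1 \<or> r = 2" by linarith
    thus ?thesis using 1 that(2)[of "-1"] that(3)[of "-1"] that(3)[of 0]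
      by (auto simp: diagonal_perm_def diagonal_base_def fun_eq_iff)
  next
    case 2
    hence "r = 0 \<or> r = 1 \<or> r = 2 \<or> r = 3 \<or> r = 4" by linarith
    thus ?thesis using 2 that(1)[of 2] that(2)[of "-1"] that(2)[of "-3"] that(3)[of "-1"] that(3)[of 0]
      by (auto simp: diagonal_perm_def diagonal_base_def fun_eq_iff algebra_simps)
  next
    case 3
    thus ?thesis using 4 that(1)[of 0] that(1)[of 2] that(2)[of "-1"] that(2)[of "-3"]
      by (auto simp: diagonal_perm_def fun_eq_iff algebra_simps)
  qed
qed

lemma diagonal_perm_range:
  assumes "0 < e"
  shows "0 \<le> diagonal_perm d e r z \<and> diagonal_perm d e r z < e"
  by (rule diagonal_perm_cases[of d e r]) (use assms half_mod_range in auto)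

lemma diagonal_perm_cong:
  assumes "z mod e = z' mod e"
  shows "diagonal_perm d e r z = diagonal_perm d e r z'"
proof (rule diagonal_perm_cases[of d e r])
  fix c
  show ?thesis if "diagonal_perm d e r = (\<lambda>z. (z + c) mod e)" using that mod_add_cong[OF assms refl] by simp
  show ?thesis if "diagonal_perm d e r = (\<lambda>z. (- z + c) mod e)"
    unfolding that by (rule mod_add_cong[OF mod_minus_cong[OF assms] refl])
  show ?thesis if "diagonal_perm d e r = (\<lambda>z. half_mod e (z + c))"
    using that half_mod_cong[OF mod_add_cong[OF assms refl]] by simp
qed

lemma diagonal_perm_inject:
  assumes "odd e" "diagonal_perm d e r z = diagonal_perm d e r z'"
  shows "z mod e = z' mod e"
proof (rule diagonal_perm_cases[of d e r])
  fix c
  show ?thesis if "diagonal_perm d e r = (\<lambda>z. (z + c) mod e)" using that assms(2) by (simp add: mod_eq_dvd_iff)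
  show ?thesis if "diagonal_perm d e r = (\<lambda>z. (- z + c) mod e)"
    using that assms(2) by (simp add: mod_eq_dvd_iff) (metis dvd_minus_iff minus_diff_eq)
  show ?thesis if "diagonal_perm d e r = (\<lambda>z. half_mod e (z + c))"
    using half_mod_inject[OF assms(1), of "z + c" "z' + c"] assms(2) that by (simp add: mod_eq_dvd_iff)
qed

lemma sum_lessThan_four:
  fixes f :: "nat \<Rightarrow> int"
  assumes "\<And>i. f (4 * i) + f (4 * i + 1) + f (4 * i + 2) + f (4 * i + 3) = S"
  shows "(\<Sum>r<4 * q. f r) = int q * S"
proof (induction q)
  case (Suc q)
  have "{..<4 * Suc q} = insert (4 * q + 3) (insert (4 * q + 2) (insert (4 * q + 1) (insert (4 * q) {..<4 * q})))"
    by auto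
  thus ?case using Suc assms[of q] by (simp add: algebra_simps)
qed simp

lemma odd_diagonal_base:
  assumes "odd d" "3 \<le> d"
  obtains q where "d = diagonal_base d + 4 * q"
proof -
  have "d mod 4 = 3 \<or> d mod 4 = 1" using assms by presburger
  moreover have "d = 3 + 4 * (d div 4)" if "d mod 4 = 3" using that by presburger
  moreover have "d = 5 + 4 * (d div 4 - 1)" if "d mod 4 = 1" using that assms by presburger
  ultimately show ?thesis using that by (fastforce simp: diagonal_base_def)
qed

lemma sum_diagonal_split:
  fixes f :: "nat \<Rightarrow> int"
  shows "(\<Sum>r<b + 4 * q. f r) = (\<Sum>r<b. f r) + (\<Sum>r<4 * q. f (b + r))"
  by (induction q) (simp_all add: ac_simps numeral_eq_Suc)

text \<open>At a common argument the base list is the halving triple, joined for length five by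
  \<open>z + 2\<close> and its complement \<open>-(z + 2) - 1\<close>. In a block of four, entries
  0, 1 and entries 2, 3 are complementary.\<close>

lemma sum_diagonal_perm_row:
  assumes "odd d" "3 \<le> d" "odd e" "0 < e"
  shows "(\<Sum>r<d. diagonal_perm d e r z) = int d * ((e - 1) div 2)"
proof -
  obtain q where q: "d = diagonal_base d + 4 * q" using odd_diagonal_base assms by blast
  obtain h where h: "e = 2 * h + 1" using assms by (elim oddE)
  have "(\<Sum>r<4 * q. diagonal_perm d e (diagonal_base d + r) z) = int q * (2 * (e - 1))"
  proof (rule sum_lessThan_four)
    fix i :: nat
    have "(4 * i) mod 4 = 0" "(4 * i + 1) mod 4 = 1" "(4 * i + 2) mod 4 = 2" "(4 * i + 3) mod 4 = 3" by presburger+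
    thus "diagonal_perm d e (diagonal_base d + 4 * i) z + diagonal_perm d e (diagonal_base d + (4 * i + 1)) z
        + diagonal_perm d e (diagonal_base d + (4 * i + 2)) z + diagonal_perm d e (diagonal_base d + (4 * i + 3)) z = 2 * (e - 1)"
      unfolding diagonal_perm_def diff_add_inverse neg_mod_eq[OF assms(4)] by simp
  qed
  moreover have "(\<Sum>r<diagonal_base d. diagonal_perm d e r z) = int (diagonal_base d) * h"
  proof (cases "d mod 4 = 3")
    case True
    have "{..<3} = {0, 1, 2::nat}" by auto
    thus ?thesis using half_mod_triple[OF assms(3,4), of z] True h
      by (simp add: diagonal_perm_def diagonal_base_def)
  next
    case False
    have "{..<5} = {0, 1, 2, 3, 4::nat}" by auto
    thus ?thesis using half_mod_triple[OF assms(3,4), of z] neg_mod_eq[OF assms(4), of "z + 2"] False h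
      by (simp add: diagonal_perm_def diagonal_base_def)
  qed
  moreover have "int d = int (diagonal_base d) + 4 * int q" using q by linarith
  ultimately show ?thesis
    using sum_diagonal_split[of "\<lambda>r. diagonal_perm d e r z" "diagonal_base d" q] h
    unfolding q[symmetric] by (simp add: algebra_simps)
qed

text \<open>The shift by \<open>r\<close> only regroups the terms. The base list becomes the halving
  triple at \<open>z - 1\<close> (length three), or the triple at \<open>z - 2\<close> together with
  \<open>z\<close> and its complement (length five). In a block of four the complementary entries
  are now 0, 2 and 1, 3.\<close>

lemma sum_diagonal_perm_column:
  assumes "odd d" "3 \<le> d" "odd e" "0 < e"
  shows "(\<Sum>r<d. diagonal_perm d e r (z - int r)) = int d * ((e - 1) div 2)"
proof -
  obtain q where q: "d = diagonal_base d + 4 * q" using odd_diagonal_base assms by blast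
  obtain h where h: "e = 2 * h + 1" using assms by (elim oddE)
  define b where "b = diagonal_base d"
  have "(\<Sum>r<4 * q. diagonal_perm d e (b + r) (z - int (b + r))) = int q * (2 * (e - 1))"
  proof (rule sum_lessThan_four)
    fix i :: nat
    define y where "y = z - int (b + 4 * i)"
    have m: "(4 * i) mod 4 = 0" "(4 * i + 1) mod 4 = 1" "(4 * i + 2) mod 4 = 2" "(4 * i + 3) mod 4 = 3" by presburger+
    have p: "diagonal_perm d e (b + 4 * i) y = y mod e"
      "diagonal_perm d e (b + (4 * i + 1)) (y - 1) = (- (y - 1) - 1) mod e"
      "diagonal_perm d e (b + (4 * i + 2)) (y - 2) = (- y - 1) mod e"
      "diagonal_perm d e (b + (4 * i + 3)) (y - 3) = (y - 1) mod e"
      unfolding diagonal_perm_def b_def[symmetric] diff_add_inverse m by simp_all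
    have z: "z - int (b + (4 * i + 1)) = y - 1" "z - int (b + (4 * i + 2)) = y - 2" "z - int (b + (4 * i + 3)) = y - 3"
      by (simp_all add: y_def)
    show "diagonal_perm d e (b + 4 * i) (z - int (b + 4 * i))
        + diagonal_perm d e (b + (4 * i + 1)) (z - int (b + (4 * i + 1)))
        + diagonal_perm d e (b + (4 * i + 2)) (z - int (b + (4 * i + 2)))
        + diagonal_perm d e (b + (4 * i + 3)) (z - int (b + (4 * i + 3))) = 2 * (e - 1)"
      unfolding z y_def[symmetric] p neg_mod_eq[OF assms(4)] by simp
  qed
  moreover have "(\<Sum>r<b. diagonal_perm d e r (z - int r)) = int b * h"
  proof (cases "d mod 4 = 3")
    case True
    have "{..<3} = {0, 1, 2::nat}" by auto
    thus ?thesis using half_mod_triple[OF assms(3,4), of "z - 1"] True h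
      by (simp add: diagonal_perm_def diagonal_base_def b_def)
  next
    case False
    have "{..<5} = {0, 1, 2, 3, 4::nat}" by auto
    thus ?thesis using half_mod_triple[OF assms(3,4), of "z - 2"] neg_mod_eq[OF assms(4), of z] False h
      by (simp add: diagonal_perm_def diagonal_base_def b_def)
  qed
  moreover have "int d = int b + 4 * int q" using q unfolding b_def by linarith
  ultimately show ?thesis
    using sum_diagonal_split[of "\<lambda>r. diagonal_perm d e r (z - int r)" b q] h
    unfolding q[symmetric, folded b_def] by (simp add: algebra_simps)
qed


section \<open>Mixed-radix labels on the diagonals of odd squares\<close>

lemma int_mult_add_unique:
  fixes a b a' b' k :: int
  assumes "a * k + b = a' * k + b'" "0 \<le> b" "b < k" "0 \<le> b'" "b' < k"
  shows "a = a' \<and> b = b'"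
proof -
  have "(a * k + b) div k = a" "(a' * k + b') div k = a'" using assms(2-5) by simp_all
  thus ?thesis using assms(1) by auto
qed

text \<open>The digits of a label are a permuted \<open>t\<close>, a permuted \<open>i\<close> and
  the diagonal \<open>r\<close>. Every row and every column meets each diagonal once, at a fixed
  \<open>t\<close>, so the first digit always falls under the row identity. The second digit is
  taken at a fixed \<open>i\<close> along a row and at \<open>j - r\<close> along a column, which is
  the column identity; the last digit takes each value once.\<close>

lemma MRS_exists_odd_square:
  assumes "odd d" "3 \<le> d" "d \<le> e" "odd e" "odd C"
  shows "MRS_exists e e d d C"
proof -
  define D where "D = diagonal_perm d"
  have e: "odd (int e)" "0 < int e" and C: "odd (int C)" "0 < int C" and d: "0 < d"
    using assms by (auto elim: oddE)
  define X where "X = {..<C} \<times> {..<e} \<times> {..<d}"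
  define T :: "nat \<times> nat \<times> nat \<Rightarrow> nat" where "T = (\<lambda>(t, i, r). t)"
  define I :: "nat \<times> nat \<times> nat \<Rightarrow> nat" where "I = (\<lambda>(t, i, r). i)"
  define J :: "nat \<times> nat \<times> nat \<Rightarrow> nat" where "J = (\<lambda>(t, i, r). (i + r) mod e)"
  define l where "l = (\<lambda>(t, i, r). (D (int C) r (int t) * int e + D (int e) r (int i)) * int d + int r)"
  define S where "S = int d * ((int C - 1) div 2) * int e * int d + int d * ((int e - 1) div 2) * int d + (\<Sum>r<d. int r)"
  have row: "{x. x \<in> X \<and> T x = t \<and> I x = i} = (\<lambda>r. (t, i, r)) ` {..<d}" if "t < C" "i < e" for t i
    using that by (auto simp: X_def T_def I_def)
  have shift: "int ((j + (e - r)) mod e) = (int j - int r) mod int e" if "r < d" for j r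
  proof -
    have "int ((j + (e - r)) mod e) = (int j - int r + int e) mod int e"
      using that assms by (simp add: of_nat_mod of_nat_diff algebra_simps)
    thus ?thesis by simp
  qed
  have col: "{x. x \<in> X \<and> T x = t \<and> J x = j} = (\<lambda>r. (t, (j + (e - r)) mod e, r)) ` {..<d}" if "t < C" "j < e" for t j
  proof (intro set_eqI iffI)
    fix x assume "x \<in> {x. x \<in> X \<and> T x = t \<and> J x = j}"
    then obtain i r where x: "x = (t, i, r)" "i < e" "r < d" "(i + r) mod e = j"
      by (auto simp: X_def T_def J_def)
    have "(j + (e - r)) mod e = (i + r + (e - r)) mod e" using x(4) by (metis mod_add_left_eq)
    also have "\<dots> = i" using x assms by simp
    finally show "x \<in> (\<lambda>r. (t, (j + (e - r)) mod e, r)) ` {..<d}" using x by force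
  next
    fix x assume "x \<in> (\<lambda>r. (t, (j + (e - r)) mod e, r)) ` {..<d}"
    then obtain r where r: "r < d" "x = (t, (j + (e - r)) mod e, r)" by auto
    have "((j + (e - r)) mod e + r) mod e = (j + (e - r) + r) mod e" by (rule mod_add_left_eq)
    also have "\<dots> = j" using r assms that by simp
    finally show "x \<in> {x. x \<in> X \<and> T x = t \<and> J x = j}"
      using r that e by (simp add: X_def T_def J_def)
  qed
  have inj1: "inj_on (\<lambda>r. (t, i, r)) A" for t i :: nat and A :: "nat set" by (auto simp: inj_on_def)
  have inj2: "inj_on (\<lambda>r. (t, (j + (e - r)) mod e, r)) A" for t j :: nat and A :: "nat set" by (auto simp: inj_on_def)
  have lin: "(\<Sum>r<d. (f r * int e + g r) * int d + int r) = (\<Sum>r<d. f r) * int e * int d + (\<Sum>r<d. g r) * int d + (\<Sum>r<d. int r)"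
    for f g :: "nat \<Rightarrow> int"
    by (simp add: sum.distrib sum_distrib_right distrib_right)
  have bound: "0 \<le> D (int N) r z \<and> D (int N) r z < int N" if "0 < int N" for N r z
    unfolding D_def using that by (rule diagonal_perm_range)
  have "magic_family e e d d C X T I J l"
    unfolding magic_family_def
  proof (intro conjI)
    show "finite X" by (simp add: X_def)
    show "\<forall>x\<in>X. T x < C \<and> I x < e \<and> J x < e" using e by (auto simp: X_def T_def I_def J_def)
    show "inj_on (\<lambda>x. (T x, I x, J x)) X"
    proof (rule inj_onI, clarsimp simp: X_def T_def I_def J_def)
      fix i r r' assume *: "r < d" "r' < d" "(i + r) mod e = (i + r') mod e"
      have "int e dvd (int i + int r) - (int i + int r')"
        using *(3) by (metis mod_eq_dvd_iff of_nat_add of_nat_mod)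
      hence "int e dvd int r - int r'" by simp
      moreover have "\<bar>int r - int r'\<bar> < int e" using * assms by linarith
      ultimately show "r = r'" using dvd_imp_le_int[of "int r - int r'" "int e"] by fastforce
    qed
    show "inj_on l X"
    proof (rule inj_onI, clarsimp simp: X_def l_def)
      fix t i r t' i' r'
      assume *: "t < C" "i < e" "r < d" "t' < C" "i' < e" "r' < d"
        "(D (int C) r (int t) * int e + D (int e) r (int i)) * int d + int r
         = (D (int C) r' (int t') * int e + D (int e) r' (int i')) * int d + int r'"
      have 1: "D (int C) r (int t) * int e + D (int e) r (int i) = D (int C) r' (int t') * int e + D (int e) r' (int i') \<and> int r = int r'"
        using *(7) by (rule int_mult_add_unique) (use * in auto)
      hence 2: "D (int C) r (int t) = D (int C) r (int t') \<and> D (int e) r (int i) = D (int e) r (int i')"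
        by (intro int_mult_add_unique) (use bound e in auto)
      hence "int t mod int C = int t' mod int C" "int i mod int e = int i' mod int e"
        unfolding D_def using diagonal_perm_inject C e by blast+
      thus "t = t' \<and> i = i' \<and> r = r'" using * 1 by simp
    qed
    have "0 \<le> l x \<and> l x < 0 + int (e * d * C)" if xX: "x \<in> X" for x
    proof -
      obtain t i r where x: "x = (t, i, r)" "t < C" "i < e" "r < d" using xX by (auto simp: X_def)
      define a b where "a = D (int C) r (int t)" and "b = D (int e) r (int i)"
      have a: "0 \<le> a" "a < int C" and b: "0 \<le> b" "b < int e"
        using bound[OF C(2)] bound[OF e(2)] by (auto simp: a_def b_def)
      have "(a + 1) * int e \<le> int C * int e" using a by (intro mult_right_mono) auto
      hence "a * int e + b + 1 \<le> int C * int e" using b by (simp add: algebra_simps)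
      hence "(a * int e + b + 1) * int d \<le> int C * int e * int d" by (intro mult_right_mono) auto
      hence "(a * int e + b) * int d + int r < int (e * d * C)" using x by (simp add: algebra_simps)
      moreover have "0 \<le> (a * int e + b) * int d + int r" using a b by simp
      ultimately show ?thesis by (simp add: x l_def a_def b_def)
    qed
    thus "\<exists>a. \<forall>x\<in>X. a \<le> l x \<and> l x < a + int (e * d * C)" by blast
    show "\<forall>t<C. \<forall>i<e. card {x \<in> X. T x = t \<and> I x = i} = d"
      by (simp add: row card_image[OF inj1])
    show "\<forall>t<C. \<forall>j<e. card {x \<in> X. T x = t \<and> J x = j} = d"
      by (simp add: col card_image[OF inj2])
    have "(\<Sum>x | x \<in> X \<and> T x = t \<and> I x = i. l x) = S" if "t < C" "i < e" for t i
    proof -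
      have "(\<Sum>x | x \<in> X \<and> T x = t \<and> I x = i. l x) = (\<Sum>r<d. (D (int C) r (int t) * int e + D (int e) r (int i)) * int d + int r)"
        unfolding row[OF that] sum.reindex[OF inj1] by (simp add: l_def)
      also have "\<dots> = S" unfolding lin S_def
        by (simp only: D_def sum_diagonal_perm_row[OF assms(1,2) C] sum_diagonal_perm_row[OF assms(1,2) e])
      finally show ?thesis .
    qed
    thus "\<exists>u. \<forall>t<C. \<forall>i<e. (\<Sum>x | x \<in> X \<and> T x = t \<and> I x = i. l x) = u" by blast
    have "(\<Sum>x | x \<in> X \<and> T x = t \<and> J x = j. l x) = S" if "t < C" "j < e" for t j
    proof -
      have "(\<Sum>x | x \<in> X \<and> T x = t \<and> J x = j. l x) = (\<Sum>r<d. (D (int C) r (int t) * int e + D (int e) r (int ((j + (e - r)) mod e))) * int d + int r)"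
        unfolding col[OF that] sum.reindex[OF inj2] by (simp add: l_def)
      also have "\<dots> = (\<Sum>r<d. (D (int C) r (int t) * int e + D (int e) r (int j - int r)) * int d + int r)"
      proof (rule sum.cong[OF refl])
        fix r assume "r \<in> {..<d}"
        hence "D (int e) r (int ((j + (e - r)) mod e)) = D (int e) r (int j - int r)"
          unfolding D_def by (intro diagonal_perm_cong) (simp add: shift)
        thus "(D (int C) r (int t) * int e + D (int e) r (int ((j + (e - r)) mod e))) * int d + int r
            = (D (int C) r (int t) * int e + D (int e) r (int j - int r)) * int d + int r" by simp
      qed
      also have "\<dots> = S" unfolding lin S_def
        by (simp only: D_def sum_diagonal_perm_row[OF assms(1,2) C] sum_diagonal_perm_column[OF assms(1,2) e])
      finally show ?thesis .
    qed
    thus "\<exists>u. \<forall>t<C. \<forall>j<e. (\<Sum>x | x \<in> X \<and> T x = t \<and> J x = j. l x) = u" by blast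
  qed
  thus ?thesis by (rule MRS_exists_if_magic_family)
qed

section \<open>Odd rectangles\<close>

definition magic_rectangle :: "nat \<Rightarrow> nat \<Rightarrow> (nat \<Rightarrow> nat \<Rightarrow> int) \<Rightarrow> bool" where
  "magic_rectangle k s w \<longleftrightarrow>
     inj_on (\<lambda>(i, j). w i j) ({..<k} \<times> {..<s}) \<and>
     (\<exists>a. \<forall>i<k. \<forall>j<s. a \<le> w i j \<and> w i j < a + int (k * s)) \<and>
     (\<exists>u. \<forall>i<k. (\<Sum>j<s. w i j) = u) \<and> (\<exists>u. \<forall>j<s. (\<Sum>i<k. w i j) = u)"

text \<open>The permutations assigned to the cells cancel along rows and columns: a Latin square on three zero-sum
  permutations fills one corner, opposite pairs fill the rest.\<close>

definition corner_perm :: "int \<Rightarrow> nat \<Rightarrow> int \<Rightarrow> int" where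
  "corner_perm C i t = [half_mod C t, half_mod C (t - 1), (- t - 1) mod C] ! i - (C - 1) div 2"

definition cell_perm :: "int \<Rightarrow> nat \<Rightarrow> nat \<Rightarrow> int \<Rightarrow> int" where
  "cell_perm C i j t =
     (if i < 3 \<and> j < 3 then corner_perm C ((i + j) mod 3) t
      else (if i < 3 then if even j then 1 else - 1
            else if j < 3 then if even i then 1 else - 1
            else if even i = even j then 1 else - 1) *
           (if i < 3 then corner_perm C i t else if j < 3 then corner_perm C j t else t mod C - (C - 1) div 2))"

text \<open>By this symmetry the column sums need no calculation of their own.\<close>

lemma cell_perm_commute: "cell_perm C i j t = cell_perm C j i t"
  by (cases "i < 3"; cases "j < 3"; cases "even i"; cases "even j") (simp_all add: cell_perm_def add.commute)

lemma corner_perm_range: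
  assumes "odd C" "0 < C" "i < 3"
  shows "\<bar>corner_perm C i t\<bar> \<le> (C - 1) div 2"
proof -
  obtain h where h: "C = 2 * h + 1" using assms by (elim oddE)
  have b: "0 \<le> half_mod C z \<and> half_mod C z < C" "0 \<le> z mod C \<and> z mod C < C" for z
    using half_mod_range[OF assms(2)] assms by auto
  have "i = 0 \<or> i = 1 \<or> i = 2" using assms by linarith
  hence "\<exists>z. corner_perm C i t = z - (C - 1) div 2 \<and> 0 \<le> z \<and> z < C"
    using b by (auto simp: corner_perm_def)
  thus ?thesis using h by auto
qed

lemma cell_perm_range:
  assumes "odd C" "0 < C"
  shows "\<bar>cell_perm C i j t\<bar> \<le> (C - 1) div 2"
proof -
  obtain h where h: "C = 2 * h + 1" using assms by (elim oddE)
  have "0 \<le> t mod C \<and> t mod C < C" using assms by simp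
  hence "\<bar>t mod C - (C - 1) div 2\<bar> \<le> (C - 1) div 2" using h by auto
  thus ?thesis using corner_perm_range[OF assms] by (auto simp: cell_perm_def)
qed

lemma corner_perm_inject:
  assumes "odd C" "i < 3" "corner_perm C i t = corner_perm C i t'"
  shows "t mod C = t' mod C"
proof -
  have "i = 0 \<or> i = 1 \<or> i = 2" using assms by linarith
  thus ?thesis
  proof (elim disjE)
    assume "i = 0" thus ?thesis using assms half_mod_inject[OF assms(1), of t t'] by (simp add: corner_perm_def)
  next
    assume "i = 1"
    thus ?thesis using assms half_mod_inject[OF assms(1), of "t - 1" "t' - 1"]
      by (simp add: corner_perm_def mod_eq_dvd_iff)
  next
    assume "i = 2"
    hence "(- t - 1) mod C = (- t' - 1) mod C" using assms by (simp add: corner_perm_def)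
    thus ?thesis by (simp add: mod_eq_dvd_iff) (metis dvd_minus_iff minus_diff_eq)
  qed
qed

lemma cell_perm_inject:
  assumes "odd C" "cell_perm C i j t = cell_perm C i j t'"
  shows "t mod C = t' mod C"
  using assms(2) corner_perm_inject[OF assms(1), of "(i + j) mod 3" t t']
    corner_perm_inject[OF assms(1), of i t t'] corner_perm_inject[OF assms(1), of j t t']
  by (cases "i < 3"; cases "j < 3") (simp_all add: cell_perm_def split: if_splits)

lemma sum_corner_perm:
  assumes "odd C" "0 < C"
  shows "corner_perm C 0 t + corner_perm C 1 t + corner_perm C 2 t = 0"
  using half_mod_triple[OF assms, of t] by (simp add: corner_perm_def)

lemma sum_alternating_from_3:
  fixes s :: nat
  assumes "odd s" "3 \<le> s"
  shows "(\<Sum>j\<in>{3..<s}. (if even j then 1 else - 1) * (x::int)) = 0"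
proof -
  define y where "y = (s - 3) div 2"
  have "s = 3 + 2 * y" unfolding y_def using assms by presburger
  moreover have "(\<Sum>j\<in>{3..<3 + 2 * y}. (if even j then 1 else - 1) * x) = 0"
  proof (induction y)
    case (Suc y)
    have "{3..<3 + 2 * Suc y} = insert (4 + 2 * y) (insert (3 + 2 * y) {3..<3 + 2 * y})" by auto
    thus ?case using Suc by simp
  qed simp
  ultimately show ?thesis by simp
qed

text \<open>The first three columns meet each corner permutation once, by the Latin square for
  \<open>i < 3\<close> and with a common sign otherwise. The other \<open>s - 3\<close> columns,
  even in number, carry one fixed value with alternating signs.\<close>

lemma sum_cell_perm_row:
  assumes "odd C" "0 < C" "odd s" "3 \<le> s"
  shows "(\<Sum>j<s. cell_perm C i j t) = 0"
proof -
  have "(\<Sum>j<s. cell_perm C i j t) = (\<Sum>j<3. cell_perm C i j t) + (\<Sum>j\<in>{3..<s}. cell_perm C i j t)"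
    using sum.atLeastLessThan_concat[of 0 3 s "\<lambda>j. cell_perm C i j t"] assms by (simp add: lessThan_atLeast0)
  moreover have "(\<Sum>j<3. cell_perm C i j t) = 0"
  proof -
    have 3: "{..<3} = {0, 1, 2::nat}" by auto
    show ?thesis
    proof (cases "i < 3")
      case True
      hence "i = 0 \<or> i = 1 \<or> i = 2" by linarith
      thus ?thesis using sum_corner_perm[OF assms(1,2), of t] by (auto simp: cell_perm_def 3 numeral_2_eq_2)
    next
      case False
      thus ?thesis using sum_corner_perm[OF assms(1,2), of t] by (auto simp: cell_perm_def 3 numeral_2_eq_2)
    qed
  qed
  moreover have "(\<Sum>j\<in>{3..<s}. cell_perm C i j t) = 0"
  proof -
    define x where "x = (if i < 3 then corner_perm C i t else (if even i then 1 else - 1) * (t mod C - (C - 1) div 2))"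
    have "(\<Sum>j\<in>{3..<s}. cell_perm C i j t) = (\<Sum>j\<in>{3..<s}. (if even j then 1 else - 1) * x)"
      by (rule sum.cong) (auto simp: cell_perm_def x_def)
    thus ?thesis using sum_alternating_from_3[OF assms(3,4)] by simp
  qed
  ultimately show ?thesis by simp
qed

text \<open>All \<open>C\<close> rectangles share the low digit \<open>w\<close>; the high digit is
  the permutation of the cell at \<open>t\<close>. In a fixed cell different \<open>t\<close> give
  different high digits, so labels are distinct, and along each line the high digits add up to
  zero.\<close>

lemma MRS_exists_magic_rectangles:
  assumes "magic_rectangle k s w" "odd k" "odd s" "3 \<le> k" "3 \<le> s" "odd C"
  shows "MRS_exists k s s k C"
proof -
  have C: "odd (int C)" "0 < int C" using assms by (auto elim: oddE)
  obtain hC where hC: "int C = 2 * hC + 1" using C by (elim oddE)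
  have injw: "inj_on (\<lambda>(i, j). w i j) ({..<k} \<times> {..<s})" using assms unfolding magic_rectangle_def by blast
  obtain a where a: "\<forall>i<k. \<forall>j<s. a \<le> w i j \<and> w i j < a + int (k * s)"
    using assms unfolding magic_rectangle_def by blast
  obtain u where u: "\<forall>i<k. (\<Sum>j<s. w i j) = u" using assms unfolding magic_rectangle_def by blast
  obtain v where v: "\<forall>j<s. (\<Sum>i<k. w i j) = v" using assms unfolding magic_rectangle_def by blast
  define X where "X = {..<C} \<times> {..<k} \<times> {..<s}"
  define T :: "nat \<times> nat \<times> nat \<Rightarrow> nat" where "T = (\<lambda>(t, i, j). t)"
  define I :: "nat \<times> nat \<times> nat \<Rightarrow> nat" where "I = (\<lambda>(t, i, j). i)"
  define J :: "nat \<times> nat \<times> nat \<Rightarrow> nat" where "J = (\<lambda>(t, i, j). j)"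
  define l where "l = (\<lambda>(t, i, j). cell_perm (int C) i j (int t) * int (k * s) + (w i j - a))"
  have row: "{x. x \<in> X \<and> T x = t \<and> I x = i} = (\<lambda>j. (t, i, j)) ` {..<s}" if "t < C" "i < k" for t i
    using that by (auto simp: X_def T_def I_def)
  have col: "{x. x \<in> X \<and> T x = t \<and> J x = j} = (\<lambda>i. (t, i, j)) ` {..<k}" if "t < C" "j < s" for t j
    using that by (auto simp: X_def T_def J_def)
  have inj1: "inj_on (\<lambda>j. (t, i, j)) A" for t i :: nat and A :: "nat set" by (auto simp: inj_on_def)
  have inj2: "inj_on (\<lambda>i. (t, i, j)) A" for t j :: nat and A :: "nat set" by (auto simp: inj_on_def)
  have "magic_family k s s k C X T I J l"
    unfolding magic_family_def
  proof (intro conjI)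
    show "finite X" by (simp add: X_def)
    show "\<forall>x\<in>X. T x < C \<and> I x < k \<and> J x < s" by (auto simp: X_def T_def I_def J_def)
    show "inj_on (\<lambda>x. (T x, I x, J x)) X" by (auto simp: inj_on_def T_def I_def J_def)
    show "inj_on l X"
    proof (rule inj_onI)
      fix x x' assume xx: "x \<in> X" "x' \<in> X" "l x = l x'"
      obtain t i j t' i' j' where *: "x = (t, i, j)" "x' = (t', i', j')" "t < C" "i < k" "j < s" "t' < C" "i' < k" "j' < s"
        using xx by (auto simp: X_def)
      have "cell_perm (int C) i j (int t) * int (k * s) + (w i j - a) = cell_perm (int C) i' j' (int t') * int (k * s) + (w i' j' - a)"
        using xx(3) by (simp only: * l_def prod.case)
      moreover have "0 \<le> w i j - a" "w i j - a < int (k * s)" "0 \<le> w i' j' - a" "w i' j' - a < int (k * s)"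
        using a * by (auto simp only: diff_ge_0_iff_ge diff_less_eq add.commute)
      ultimately have 1: "cell_perm (int C) i j (int t) = cell_perm (int C) i' j' (int t') \<and> w i j - a = w i' j' - a"
        by (rule int_mult_add_unique)
      hence ij: "i = i' \<and> j = j'" using inj_onD[OF injw, of "(i, j)" "(i', j')"] * by simp
      hence "int t mod int C = int t' mod int C" using cell_perm_inject[OF C(1)] 1 by blast
      thus "x = x'" using * ij by simp
    qed
    have "- hC * int (k * s) \<le> l x \<and> l x < - hC * int (k * s) + int (s * k * C)" if xX: "x \<in> X" for x
    proof -
      obtain t i j where x: "x = (t, i, j)" "t < C" "i < k" "j < s" using xX by (auto simp: X_def)
      define z where "z = cell_perm (int C) i j (int t)"
      have z: "\<bar>z\<bar> \<le> hC" using cell_perm_range[OF C] hC by (simp add: z_def)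
      have "- hC * int (k * s) \<le> z * int (k * s)" using z by (intro mult_right_mono) auto
      moreover have "z * int (k * s) \<le> hC * int (k * s)" using z by (intro mult_right_mono) auto
      moreover have "int (s * k * C) = 2 * (hC * int (k * s)) + int (k * s)" by (simp add: hC algebra_simps)
      moreover have "a \<le> w i j \<and> w i j < a + int (k * s)" using a x by blast
      moreover have "l x = z * int (k * s) + (w i j - a)" by (simp add: x l_def z_def)
      ultimately show ?thesis by linarith
    qed
    thus "\<exists>a. \<forall>x\<in>X. a \<le> l x \<and> l x < a + int (s * k * C)" by blast
    show "\<forall>t<C. \<forall>i<k. card {x \<in> X. T x = t \<and> I x = i} = s"
      by (simp add: row card_image[OF inj1])
    show "\<forall>t<C. \<forall>j<s. card {x \<in> X. T x = t \<and> J x = j} = k"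
      by (simp add: col card_image[OF inj2])
    have "(\<Sum>x | x \<in> X \<and> T x = t \<and> I x = i. l x) = u - int s * a" if "t < C" "i < k" for t i
    proof -
      have "(\<Sum>x | x \<in> X \<and> T x = t \<and> I x = i. l x) = (\<Sum>j<s. cell_perm (int C) i j (int t)) * int (k * s) + ((\<Sum>j<s. w i j) - int s * a)"
        unfolding row[OF that] sum.reindex[OF inj1]
        by (simp add: l_def sum.distrib sum_subtractf sum_distrib_right)
      thus ?thesis using u that sum_cell_perm_row[OF C assms(3,5)] by simp
    qed
    thus "\<exists>u. \<forall>t<C. \<forall>i<k. (\<Sum>x | x \<in> X \<and> T x = t \<and> I x = i. l x) = u" by blast
    have "(\<Sum>x | x \<in> X \<and> T x = t \<and> J x = j. l x) = v - int k * a" if "t < C" "j < s" for t j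
    proof -
      have "(\<Sum>x | x \<in> X \<and> T x = t \<and> J x = j. l x) = (\<Sum>i<k. cell_perm (int C) j i (int t)) * int (k * s) + ((\<Sum>i<k. w i j) - int k * a)"
        unfolding col[OF that] sum.reindex[OF inj2]
        by (simp add: l_def sum.distrib sum_subtractf sum_distrib_right cell_perm_commute[of _ j])
      thus ?thesis using v that sum_cell_perm_row[OF C assms(2,4)] by simp
    qed
    thus "\<exists>u. \<forall>t<C. \<forall>j<s. (\<Sum>x | x \<in> X \<and> T x = t \<and> J x = j. l x) = u" by blast
  qed
  thus ?thesis by (rule MRS_exists_if_magic_family)
qed

section \<open>Choosing columns of prescribed total weight\<close>

text \<open>Every value between the smallest and the largest sum of \<open>e\<close> elements is
  attained: the largest element is taken only if \<open>e\<close> or \<open>T\<close> is out of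
  reach without it.\<close>

lemma ex_subset_with_sum:
  fixes n e :: nat and T :: int
  assumes "e \<le> n" "int e * (int e + 1) \<le> 2 * T" "2 * T \<le> int e * (2 * int n - int e + 1)"
  shows "\<exists>V\<subseteq>{1..n}. card V = e \<and> (\<Sum>v\<in>V. int v) = T"
  using assms
proof (induction n arbitrary: e T)
  case 0
  thus ?case by (intro exI[of _ "{}"]) auto
next
  case (Suc n)
  show ?case
  proof (cases "e \<le> n \<and> 2 * T \<le> int e * (2 * int n - int e + 1)")
    case True
    then obtain V where "V \<subseteq> {1..n}" "card V = e" "(\<Sum>v\<in>V. int v) = T"
      using Suc.IH[of e T] Suc.prems by blast
    thus ?thesis by (intro exI[of _ V]) auto
  next
    case False
    show ?thesis
    proof (cases e)
      case 0
      thus ?thesis using False Suc.prems by auto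
    next
      case (Suc e')
      define T' where "T' = T - int (Suc n)"
      have up: "2 * T' \<le> int e' * (2 * int n - int e' + 1)"
        using Suc.prems(3) by (simp add: T'_def Suc algebra_simps)
      have low: "int e' * (int e' + 1) \<le> 2 * T'"
      proof (cases "e \<le> n")
        case False
        hence "e' = n" using Suc Suc.prems(1) by simp
        thus ?thesis using Suc.prems(2) by (simp add: T'_def Suc algebra_simps)
      next
        case True
        hence "int e * (2 * int n - int e + 1) < 2 * T" using False by simp
        hence 1: "int e' * (2 * int n - int e' - 1) - 2 < 2 * T'" by (simp add: T'_def Suc algebra_simps)
        have "int e' * (int e' + 1) \<le> int e' * (2 * int n - int e' - 1)"
          using True Suc by (intro mult_left_mono) auto
        hence 2: "int e' * (int e' + 1) - 2 < 2 * T'" using 1 by linarith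
        \<comment> \<open>The strict inequality leaves a slack of 2, and both sides are even, so the
          weak inequality follows.\<close>
        have "even (int e' * (int e' + 1))" by simp
        then obtain z where "int e' * (int e' + 1) = 2 * z" by (elim evenE)
        moreover from this have "2 * z - 2 < 2 * T'" using 2 by simp
        ultimately show ?thesis by simp
      qed
      obtain V where V: "V \<subseteq> {1..n}" "card V = e'" "(\<Sum>v\<in>V. int v) = T'"
        using Suc.IH[OF _ low up] Suc Suc.prems(1) by auto
      have "finite V" "Suc n \<notin> V" using V(1) by (auto intro: finite_subset)
      hence "card (insert (Suc n) V) = e" "(\<Sum>v\<in>insert (Suc n) V. int v) = T"
        using V Suc by (auto simp: T'_def)
      thus ?thesis using V(1) by (intro exI[of _ "insert (Suc n) V"]) auto
    qed
  qed
qed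

text \<open>The weight of column \<open>j\<close> is the difference of two of the three permutations used on the exceptional levels of
  the rectangles below.\<close>

definition column_weight :: "nat \<Rightarrow> nat \<Rightarrow> int" where
  "column_weight h j = (if even j then 3 * int (j div 2) - 2 * int h else 3 * int ((j + 1) div 2) - 1 - int h)"

text \<open>\<open>K - {h}\<close> will be one half of the columns other than 0, \<open>h\<close>
  and \<open>2 * h\<close>, and the rest the other half; \<theta> is \<open>h\<close> for three rows
  and 0 for more. Modulo 3 a weight is \<open>h\<close> at even and \<open>-1 - h\<close> at odd
  columns. These residues coincide exactly if \<open>h mod 3 = 1\<close>; otherwise the number of
  odd columns in \<open>K\<close> adjusts the sum modulo 3.\<close>

definition column_set :: "nat \<Rightarrow> nat \<Rightarrow> bool" where
  "column_set h \<theta> \<longleftrightarrow> (\<exists>K\<subseteq>{1..2 * h - 1}. h \<in> K \<and> card K = h \<and> (\<Sum>j\<in>K. column_weight h j) = int \<theta>)"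

lemma sum_symmetric_interval:
  fixes a b :: nat
  assumes "a \<le> b"
  shows "(\<Sum>v\<in>{b - a..b + a}. int v) = (2 * int a + 1) * int b"
  using assms
proof (induction a)
  case (Suc a)
  have "{b - Suc a..b + Suc a} = insert (b - Suc a) (insert (b + Suc a) {b - a..b + a})"
    using Suc.prems by auto
  moreover have "b - Suc a \<notin> insert (b + Suc a) {b - a..b + a}" using Suc.prems by auto
  ultimately show ?case using Suc by (simp add: of_nat_diff algebra_simps)
qed simp

text \<open>Odd columns \<open>2 u - 1\<close> are taken from \<open>U\<close>, even columns \<open>2 v\<close> from \<open>V\<close>; the set whose parity is that of \<open>h\<close>
  is an interval around \<open>h\<close>, the other one is adjusted to reach the required sum.\<close>

lemma column_setI:
  assumes U: "U \<subseteq> {1..h}" and V: "V \<subseteq> {1..h - 1}"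
    and h: "if odd h then (h + 1) div 2 \<in> U else h div 2 \<in> V"
    and card: "card U + card V = h"
    and sum: "3 * (\<Sum>u\<in>U. int u) - int (card U) * (1 + int h) + 3 * (\<Sum>v\<in>V. int v) - int (card V) * (2 * int h) = int \<theta>"
  shows "column_set h \<theta>"
proof -
  define f :: "nat \<Rightarrow> nat" where "f u = 2 * u - 1" for u
  define g :: "nat \<Rightarrow> nat" where "g v = 2 * v" for v
  have fin: "finite U" "finite V" using U V by (auto intro: finite_subset)
  have f: "inj_on f U" using U by (intro inj_onI) (auto simp: f_def subset_iff)
  have g: "inj_on g V" by (intro inj_onI) (auto simp: g_def)
  have oddf: "odd (f u)" if "u \<in> U" for u using that U by (auto simp: f_def subset_iff)
  have "f u \<noteq> g v" if "u \<in> U" for u v using oddf[OF that] by (auto simp: g_def)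
  hence disj: "f ` U \<inter> g ` V = {}" by auto
  have wf: "column_weight h (f u) = 3 * int u - (1 + int h)" if "u \<in> U" for u
  proof -
    have "u \<ge> 1" using that U by auto
    hence "(f u + 1) div 2 = u" by (simp add: f_def)
    thus ?thesis using oddf[OF that] by (simp add: column_weight_def)
  qed
  have wg: "column_weight h (g v) = 3 * int v - 2 * int h" for v by (simp add: g_def column_weight_def)
  show ?thesis
    unfolding column_set_def
  proof (intro exI[of _ "f ` U \<union> g ` V"] conjI)
    show "f ` U \<union> g ` V \<subseteq> {1..2 * h - 1}"
    proof -
      have "f u \<in> {1..2 * h - 1}" if "u \<in> U" for u
        using that U by (auto simp: f_def subset_iff)
      moreover have "g v \<in> {1..2 * h - 1}" if "v \<in> V" for v
      proof -
        have "1 \<le> v" "v \<le> h - 1" using that V by auto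
        thus ?thesis by (auto simp: g_def)
      qed
      ultimately show ?thesis by blast
    qed
    show "h \<in> f ` U \<union> g ` V"
    proof (cases "odd h")
      case True
      hence "h = f ((h + 1) div 2)" unfolding f_def by presburger
      thus ?thesis using h True by auto
    next
      case False
      hence "h = g (h div 2)" by (simp add: g_def)
      thus ?thesis using h False by auto
    qed
    show "card (f ` U \<union> g ` V) = h"
      using card_Un_disjoint[OF _ _ disj] fin card by (simp add: card_image[OF f] card_image[OF g])
    have "(\<Sum>j\<in>f ` U \<union> g ` V. column_weight h j) = (\<Sum>u\<in>U. column_weight h (f u)) + (\<Sum>v\<in>V. column_weight h (g v))"
      using sum.union_disjoint[OF _ _ disj] fin by (simp add: sum.reindex[OF f] sum.reindex[OF g])
    also have "(\<Sum>u\<in>U. column_weight h (f u)) = (\<Sum>u\<in>U. 3 * int u - (1 + int h))"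
      using wf by (intro sum.cong) auto
    finally show "(\<Sum>j\<in>f ` U \<union> g ` V. column_weight h j) = int \<theta>"
      using sum by (simp add: wg sum_subtractf sum_distrib_left)
  qed
qed

text \<open>Estimates for the next two lemmas, where \<open>b = 2 * a + \<delta>\<close> and
  \<open>A\<close> stands for \<open>a * a\<close>, so that for each value of \<delta> they are
  linear. The leading terms of the required deviation cancel near \<open>a = b / 2\<close>, leaving
  a term linear in \<open>a\<close> against a quadratic range; only negative \<delta> demand a
  larger \<open>a\<close>.\<close>

lemma window_bounds:
  fixes a \<delta> \<theta> A :: int
  assumes "\<delta> \<in> {- 2, - 1, 0, 1, 2, 3}" "2 \<le> a" "2 * a \<le> A" "\<delta> < 0 \<Longrightarrow> 4 \<le> a" "\<delta> < 0 \<Longrightarrow> 4 * a \<le> A" "\<delta> = - 2 \<Longrightarrow> 5 * a \<le> A"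
  shows "\<theta> = 0 \<or> \<theta> = 4 * a + 2 * \<delta> + 1 \<Longrightarrow> \<bar>\<theta> + 2 * \<delta> * (2 * a + \<delta>) - 3 * a - 1\<bar> \<le> 6 * A + 6 * a * \<delta>"
    and "\<theta> = 0 \<or> \<theta> = 4 * a + 2 * \<delta> \<Longrightarrow>
      \<bar>2 * \<theta> - 8 * a * \<delta> - 4 * \<delta> * \<delta> + 6 * a + 2 * \<delta> + 1\<bar> \<le> 12 * A + 12 * a * \<delta> + 6 * \<delta> - 3"
  using assms by (auto simp: abs_le_iff)

text \<open>\<open>U\<close> is the interval of \<open>2 * a + 1\<close> numbers around
  \<open>b + 1\<close>, and \<open>V\<close> has \<open>2 * (b - a)\<close> elements of
  \<open>{1..2 * b}\<close>. \<open>N a / 3\<close> is the deviation from its mean that the sum of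
  \<open>V\<close> must have. Modulo 3, \<open>N\<close> changes by \<open>- b\<close> from
  \<open>a\<close> to \<open>a + 1\<close>, a unit, so one of three consecutive \<open>a\<close>
  makes it integral. The window lies near \<open>b / 2\<close>, where
  \<open>2 * b * b - 4 * a * b\<close> is small.\<close>

lemma column_set_odd_half:
  assumes h: "h = 2 * b + 1" and b: "b mod 3 \<noteq> 0" "7 \<le> b" and \<theta>: "\<theta> = 0 \<or> \<theta> = h"
  shows "column_set h \<theta>"
proof -
  define N where "N a = int \<theta> + 2 * int b * int b - 4 * int a * int b - 3 * int a - 1" for a
  define a0 where "a0 = (b - 2) div 2"
  have N: "N (a0 + 1) = N a0 - 4 * int b - 3" "N (a0 + 2) = N a0 - 8 * int b - 6"
    by (simp_all add: N_def algebra_simps)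
  have "int b mod 3 \<noteq> 0" using b by presburger
  hence "3 dvd N a0 \<or> 3 dvd N (a0 + 1) \<or> 3 dvd N (a0 + 2)" unfolding N by presburger
  then obtain a where a: "3 dvd N a" "a = a0 \<or> a = a0 + 1 \<or> a = a0 + 2" by blast
  then obtain N3 where N3: "N a = 3 * N3" by (elim dvdE)
  define \<delta> where "\<delta> = int b - 2 * int a"
  have a0: "b = 2 * a0 + 2 \<or> b = 2 * a0 + 3" using b(2) unfolding a0_def by presburger
  hence \<delta>: "\<delta> \<in> {- 2, - 1, 0, 1, 2, 3}" "2 \<le> a" "a < b" "\<delta> < 0 \<Longrightarrow> 4 \<le> a" "\<delta> = - 2 \<Longrightarrow> 5 \<le> a"
    using a(2) b(2) by (elim disjE; simp add: \<delta>_def)+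
  have b\<delta>: "int b = 2 * int a + \<delta>" by (simp add: \<delta>_def)
  have N\<delta>: "N a = int \<theta> + 2 * \<delta> * (2 * int a + \<delta>) - 3 * int a - 1"
    unfolding N_def b\<delta> by (simp add: algebra_simps)
  have aa: "2 * int a \<le> int a * int a" using \<delta> by (intro mult_right_mono) auto
  have aa4: "\<delta> < 0 \<Longrightarrow> 4 * int a \<le> int a * int a" using \<delta> by (intro mult_right_mono) auto
  have aa5: "\<delta> = - 2 \<Longrightarrow> 5 * int a \<le> int a * int a" using \<delta> by (intro mult_right_mono) auto
  have th: "int \<theta> = 0 \<or> int \<theta> = 4 * int a + 2 * \<delta> + 1" using \<theta> h b\<delta> by auto
  \<comment> \<open>The right side is three times the largest deviation from the mean that a sum of
    \<open>2 * (b - a)\<close> elements of \<open>{1..2 * b}\<close> can have.\<close>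
  have bound: "\<bar>N a\<bar> \<le> 6 * int a * (int b - int a)"
  proof -
    have "6 * int a * (int b - int a) = 6 * (int a * int a) + 6 * int a * \<delta>"
      unfolding b\<delta> by (simp add: algebra_simps)
    thus ?thesis using window_bounds(1)[OF \<delta>(1) _ aa _ aa4 aa5 th] \<delta>(2,4) unfolding N\<delta> by simp
  qed
  define e where "e = 2 * (b - a)"
  define T where "T = N3 + int (b - a) * (2 * int b + 1)"
  have e: "int e = 2 * (int b - int a)" using \<delta> by (simp add: e_def of_nat_diff)
  have T2: "2 * T = 2 * N3 + int e * (2 * int b + 1)" using \<delta> by (simp add: T_def e of_nat_diff algebra_simps)
  have N3b: "\<bar>2 * N3\<bar> \<le> int e * (2 * int a)"
    using bound N3 by (simp add: e algebra_simps)
  have "\<exists>V\<subseteq>{1..2 * b}. card V = e \<and> (\<Sum>v\<in>V. int v) = T"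
  proof (rule ex_subset_with_sum)
    show "e \<le> 2 * b" by (simp add: e_def)
    have "int e * (int e + 1) = int e * (2 * int b + 1) - int e * (2 * int a)" by (simp add: e algebra_simps)
    thus "int e * (int e + 1) \<le> 2 * T" using N3b T2 by linarith
    have "int e * (2 * int (2 * b) - int e + 1) = int e * (2 * int b + 1) + int e * (2 * int a)"
      by (simp add: e algebra_simps)
    thus "2 * T \<le> int e * (2 * int (2 * b) - int e + 1)" using N3b T2 by linarith
  qed
  then obtain V where V: "V \<subseteq> {1..2 * b}" "card V = e" "(\<Sum>v\<in>V. int v) = T" by blast
  define U where "U = {b + 1 - a..b + 1 + a}"
  have cU: "card U = 2 * a + 1" using \<delta> by (simp add: U_def)
  have sU: "(\<Sum>u\<in>U. int u) = (2 * int a + 1) * (int b + 1)"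
    unfolding U_def using sum_symmetric_interval[of a "b + 1"] \<delta> by simp
  show ?thesis
  proof (rule column_setI[of U _ V])
    show "U \<subseteq> {1..h}" using \<delta> h by (auto simp: U_def)
    show "V \<subseteq> {1..h - 1}" using V h by simp
    show "if odd h then (h + 1) div 2 \<in> U else h div 2 \<in> V" using h by (simp add: U_def)
    show "card U + card V = h" using V cU \<delta> h by (simp add: e_def)
    have "3 * T = N a + 3 * (int b - int a) * (2 * int b + 1)" using \<delta> N3 by (simp add: T_def of_nat_diff algebra_simps)
    thus "3 * (\<Sum>u\<in>U. int u) - int (card U) * (1 + int h) + 3 * (\<Sum>v\<in>V. int v) - int (card V) * (2 * int h) = int \<theta>"
      unfolding sU V(2,3) cU e using h by (simp add: N_def algebra_simps)
  qed
qed

text \<open>Now \<open>h\<close> is an even column, so \<open>V\<close> is the interval, around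
  \<open>b\<close>, and \<open>U\<close> is adjusted. The required sum of \<open>U\<close> is
  \<open>M a / 3\<close>, and \<open>M\<close> steps by \<open>- 2 * (b + 1)\<close> modulo 3, a
  unit because \<open>b mod 3 \<noteq> 2\<close>. The mean sum of \<open>U\<close> is a
  half-integer, hence the doubled deviation \<open>D\<close>.\<close>

lemma column_set_even_half:
  assumes h: "h = 2 * b" and b: "b mod 3 \<noteq> 2" "7 \<le> b" and \<theta>: "\<theta> = 0 \<or> \<theta> = h"
  shows "column_set h \<theta>"
proof -
  define M where "M a = int \<theta> + (2 * int b - 2 * int a - 1) * (2 * int b + 1) + (2 * int a + 1) * int b" for a
  define a0 where "a0 = (b - 2) div 2"
  have M: "M (a0 + 1) = M a0 - 2 * int b - 2" "M (a0 + 2) = M a0 - 4 * int b - 4"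
    by (simp_all add: M_def algebra_simps)
  have "int b mod 3 \<noteq> 2" using b by presburger
  hence "3 dvd M a0 \<or> 3 dvd M (a0 + 1) \<or> 3 dvd M (a0 + 2)" unfolding M by presburger
  then obtain a where a: "3 dvd M a" "a = a0 \<or> a = a0 + 1 \<or> a = a0 + 2" by blast
  then obtain T where T: "M a = 3 * T" by (elim dvdE)
  define \<delta> where "\<delta> = int b - 2 * int a"
  have a0: "b = 2 * a0 + 2 \<or> b = 2 * a0 + 3" using b(2) unfolding a0_def by presburger
  hence \<delta>: "\<delta> \<in> {- 2, - 1, 0, 1, 2, 3}" "2 \<le> a" "a < b" "\<delta> < 0 \<Longrightarrow> 4 \<le> a" "\<delta> = - 2 \<Longrightarrow> 5 \<le> a"
    using a(2) b(2) by (elim disjE; simp add: \<delta>_def)+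
  have b\<delta>: "int b = 2 * int a + \<delta>" by (simp add: \<delta>_def)
  define U' where "U' = 2 * (b - a) - 1"
  have o: "int U' = 2 * int b - 2 * int a - 1" using \<delta> by (simp add: U'_def of_nat_diff)
  define D where "D = 2 * T - int U' * (2 * int b + 1)"
  have D: "3 * D = 2 * int \<theta> - 4 * int b * \<delta> + 2 * int a + 2 * int b + 1"
    unfolding D_def using T by (simp add: M_def o \<delta>_def algebra_simps)
  have aa: "2 * int a \<le> int a * int a" using \<delta> by (intro mult_right_mono) auto
  have aa4: "\<delta> < 0 \<Longrightarrow> 4 * int a \<le> int a * int a" using \<delta> by (intro mult_right_mono) auto
  have aa5: "\<delta> = - 2 \<Longrightarrow> 5 * int a \<le> int a * int a" using \<delta> by (intro mult_right_mono) auto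
  have th: "int \<theta> = 0 \<or> int \<theta> = 4 * int a + 2 * \<delta>" using \<theta> h b\<delta> by auto
  have bound: "\<bar>D\<bar> \<le> int U' * (2 * int a + 1)"
  proof -
    have "3 * (int U' * (2 * int a + 1)) = 12 * (int a * int a) + 12 * int a * \<delta> + 6 * \<delta> - 3"
      unfolding o b\<delta> by (simp add: algebra_simps)
    moreover have "3 * D = 2 * int \<theta> - 8 * int a * \<delta> - 4 * \<delta> * \<delta> + 6 * int a + 2 * \<delta> + 1"
      unfolding D b\<delta> by (simp add: algebra_simps)
    ultimately have "\<bar>3 * D\<bar> \<le> 3 * (int U' * (2 * int a + 1))"
      using window_bounds(2)[OF \<delta>(1) _ aa _ aa4 aa5 th] \<delta>(2,4) by simp
    thus ?thesis by linarith
  qed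
  have "\<exists>U\<subseteq>{1..2 * b}. card U = U' \<and> (\<Sum>u\<in>U. int u) = T"
  proof (rule ex_subset_with_sum)
    show "U' \<le> 2 * b" by (simp add: U'_def)
    have "int U' * (int U' + 1) = int U' * (2 * int b + 1) - int U' * (2 * int a + 1)" by (simp add: o algebra_simps)
    thus "int U' * (int U' + 1) \<le> 2 * T" using bound unfolding D_def by linarith
    have "int U' * (2 * int (2 * b) - int U' + 1) = int U' * (2 * int b + 1) + int U' * (2 * int a + 1)"
      by (simp add: o algebra_simps)
    thus "2 * T \<le> int U' * (2 * int (2 * b) - int U' + 1)" using bound unfolding D_def by linarith
  qed
  then obtain U where U: "U \<subseteq> {1..2 * b}" "card U = U'" "(\<Sum>u\<in>U. int u) = T" by blast
  define V where "V = {b - a..b + a}"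
  have cV: "card V = 2 * a + 1" using \<delta> by (simp add: V_def)
  have sV: "(\<Sum>v\<in>V. int v) = (2 * int a + 1) * int b"
    unfolding V_def using sum_symmetric_interval[of a b] \<delta> by simp
  show ?thesis
  proof (rule column_setI[of U _ V])
    show "U \<subseteq> {1..h}" using U h by simp
    show "V \<subseteq> {1..h - 1}" using \<delta> h by (auto simp: V_def)
    show "if odd h then (h + 1) div 2 \<in> U else h div 2 \<in> V" using h by (simp add: V_def)
    show "card U + card V = h" using U cV \<delta> h by (simp add: U'_def)
    show "3 * (\<Sum>u\<in>U. int u) - int (card U) * (1 + int h) + 3 * (\<Sum>v\<in>V. int v) - int (card V) * (2 * int h) = int \<theta>"
      unfolding sV U(2,3) cV o using h T by (simp add: M_def algebra_simps)
  qed
qed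

text \<open>Explicit sets for the admissible \<open>h\<close> from 5 to 12; the estimates above
  start at \<open>b = 7\<close>, that is \<open>h = 14\<close>, and 13 is 1 modulo 3.\<close>

lemma column_set_small:
  shows "column_set 5 0" and "column_set 5 5" and "column_set 6 0" and "column_set 6 6" and "column_set 8 0" and "column_set 8 8" and "column_set 9 0" and "column_set 9 9" and "column_set 11 0" and "column_set 11 11" and "column_set 12 0" and "column_set 12 12"
  unfolding column_set_def
  subgoal by (rule exI[of _ "{3, 4, 5, 6, 8}"]) (simp add: column_weight_def)
  subgoal by (rule exI[of _ "{1, 3, 5, 6, 7}"]) (simp add: column_weight_def)
  subgoal by (rule exI[of _ "{3, 4, 5, 6, 8, 9}"]) (simp add: column_weight_def)
  subgoal by (rule exI[of _ "{4, 5, 6, 7, 8, 9}"]) (simp add: column_weight_def)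
  subgoal by (rule exI[of _ "{3, 4, 5, 7, 8, 9, 10, 11}"]) (simp add: column_weight_def)
  subgoal by (rule exI[of _ "{5, 6, 7, 8, 9, 10, 11, 12}"]) (simp add: column_weight_def)
  subgoal by (rule exI[of _ "{3, 4, 5, 7, 8, 9, 10, 11, 13}"]) (simp add: column_weight_def)
  subgoal by (rule exI[of _ "{3, 5, 6, 7, 9, 10, 11, 12, 13}"]) (simp add: column_weight_def)
  subgoal by (rule exI[of _ "{1, 3, 5, 7, 9, 10, 11, 12, 13, 14, 15}"]) (simp add: column_weight_def)
  subgoal by (rule exI[of _ "{3, 5, 7, 9, 10, 11, 12, 13, 14, 15, 16}"]) (simp add: column_weight_def)
  subgoal by (rule exI[of _ "{1, 3, 5, 7, 9, 10, 11, 12, 13, 14, 15, 17}"]) (simp add: column_weight_def)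
  subgoal by (rule exI[of _ "{1, 3, 5, 7, 9, 11, 12, 13, 14, 15, 17, 18}"]) (simp add: column_weight_def)
  done

lemma column_set_exists:
  assumes "h mod 3 \<noteq> 1" "5 \<le> h" "\<theta> = 0 \<or> \<theta> = h"
  shows "column_set h \<theta>"
proof (cases "14 \<le> h")
  case True
  show ?thesis
  proof (cases "odd h")
    case odd: True
    show ?thesis by (rule column_set_odd_half[of h "h div 2"]) (use odd True assms in presburger)+
  next
    case False
    show ?thesis by (rule column_set_even_half[of h "h div 2"]) (use False True assms in presburger)+
  qed
next
  case False
  hence "h \<in> {5, 6, 8, 9, 11, 12}" using assms by (simp; presburger)
  thus ?thesis using assms(3) column_set_small by auto
qed

section \<open>Rectangles described by levels\<close>

lemma sum_centred_perm:
  fixes F :: "'a \<Rightarrow> int"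
  assumes "inj_on F A" "finite A" "card A = 2 * h + 1" "\<And>x. x \<in> A \<Longrightarrow> \<bar>F x\<bar> \<le> int h"
  shows "(\<Sum>x\<in>A. F x) = 0"
proof -
  have "F ` A = {- int h..int h}"
  proof (rule card_subset_eq)
    show "F ` A \<subseteq> {- int h..int h}" using assms(4) by (auto simp: abs_le_iff minus_le_iff)
    show "card (F ` A) = card {- int h..int h}" using assms card_image[OF assms(1)] by simp
  qed simp
  hence "(\<Sum>x\<in>A. F x) = \<Sum>{- int h..int h}" using sum.reindex[OF assms(1), of id] by simp
  moreover have "\<Sum>{- int h..int h} = (\<Sum>x\<in>{- int h..int h}. - x)"
    by (rule sum.reindex_bij_witness[of _ uminus uminus]) auto
  hence "\<Sum>{- int h..int h} = - \<Sum>{- int h..int h}" by (simp only: sum_negf)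
  ultimately show ?thesis by linarith
qed

text \<open>A label is divided by \<open>s\<close> with centred remainder: the quotient tells the
  level, the remainder then tells the column, and both together tell the row. Since each column
  visits every level once, the quotients contribute equally to all columns.\<close>

lemma magic_rectangle_levels:
  fixes X :: "int \<Rightarrow> int" and P :: "int \<Rightarrow> nat \<Rightarrow> int" and L :: "nat \<Rightarrow> nat \<Rightarrow> int"
  assumes ks: "k = 2 * g + 1" "s = 2 * h + 1"
    and X: "inj_on X {0..<int k}" "\<And>J. J \<in> {0..<int k} \<Longrightarrow> \<bar>X J\<bar> \<le> int g"
    and P: "\<And>J. J \<in> {0..<int k} \<Longrightarrow> inj_on (P J) {..<s}" "\<And>J j. J \<in> {0..<int k} \<Longrightarrow> j < s \<Longrightarrow> \<bar>P J j\<bar> \<le> int h"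
    and L: "\<And>j. j < s \<Longrightarrow> inj_on (\<lambda>i. L i j) {..<k}" "\<And>i j. i < k \<Longrightarrow> j < s \<Longrightarrow> L i j \<in> {0..<int k}"
    and col: "\<And>j. j < s \<Longrightarrow> (\<Sum>J\<in>{0..<int k}. P J j) = 0"
    and rowX: "\<And>i. i < k \<Longrightarrow> (\<Sum>j<s. X (L i j)) = 0"
    and rowP: "\<And>i. i < k \<Longrightarrow> (\<Sum>j<s. P (L i j) j) = 0"
  shows "magic_rectangle k s (\<lambda>i j. X (L i j) * int s + P (L i j) j)"
  unfolding magic_rectangle_def
proof (intro conjI)
  have LX: "(\<lambda>i. L i j) ` {..<k} = {0..<int k}" if "j < s" for j
    by (rule card_subset_eq) (use L that card_image[OF L(1)[OF that]] in auto)
  show "inj_on (\<lambda>(i, j). X (L i j) * int s + P (L i j) j) ({..<k} \<times> {..<s})"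
  proof (rule inj_onI)
    fix x x' assume xx: "x \<in> {..<k} \<times> {..<s}" "x' \<in> {..<k} \<times> {..<s}"
      "(case x of (i, j) \<Rightarrow> X (L i j) * int s + P (L i j) j) = (case x' of (i, j) \<Rightarrow> X (L i j) * int s + P (L i j) j)"
    obtain i j i' j' where x: "x = (i, j)" "x' = (i', j')" "i < k" "j < s" "i' < k" "j' < s" using xx by auto
    define p p' where "p = P (L i j) j" and "p' = P (L i' j') j'"
    have "\<bar>p\<bar> \<le> int h" "\<bar>p'\<bar> \<le> int h" using P L x by (simp_all add: p_def p'_def)
    hence b: "0 \<le> p + int h" "p + int h < int s" "0 \<le> p' + int h" "p' + int h < int s" using ks by auto
    have "X (L i j) * int s + (p + int h) = X (L i' j') * int s + (p' + int h)"
      using xx(3) x by (simp add: p_def p'_def)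
    from arg_cong[OF this, of "\<lambda>z. z div int s"] have XX: "X (L i j) = X (L i' j')" using b by simp
    hence pp: "p = p'" using xx(3) x by (simp add: p_def p'_def)
    have LL: "L i j = L i' j'" using inj_onD[OF X(1) XX] L(2) x by blast
    have "P (L i j) j = P (L i j) j'" using pp LL by (simp add: p_def p'_def)
    hence "j = j'" using inj_onD[OF P(1)[OF L(2)[of i j]]] x by blast
    moreover from this have "i = i'" using LL inj_onD[OF L(1)[of j], of i i'] x by simp
    ultimately show "x = x'" using x by simp
  qed
  have "- (int g * int s + int h) \<le> X (L i j) * int s + P (L i j) j \<and>
      X (L i j) * int s + P (L i j) j < - (int g * int s + int h) + int (k * s)" if "i < k" "j < s" for i j
  proof -
    have "- int g * int s \<le> X (L i j) * int s"
      using X(2)[OF L(2)[OF that]] by (intro mult_right_mono) auto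
    moreover have "X (L i j) * int s \<le> int g * int s"
      using X(2)[OF L(2)[OF that]] by (intro mult_right_mono) auto
    moreover have "\<bar>P (L i j) j\<bar> \<le> int h" using P(2) L that by blast
    moreover have "int (k * s) = 2 * (int g * int s) + 2 * int h + 1" using ks by (simp add: algebra_simps)
    ultimately show ?thesis by linarith
  qed
  thus "\<exists>a. \<forall>i<k. \<forall>j<s. a \<le> X (L i j) * int s + P (L i j) j \<and> X (L i j) * int s + P (L i j) j < a + int (k * s)"
    by blast
  show "\<exists>u. \<forall>i<k. (\<Sum>j<s. X (L i j) * int s + P (L i j) j) = u"
    using rowX rowP by (intro exI[of _ 0]) (simp add: sum.distrib flip: sum_distrib_right)
  have "(\<Sum>i<k. X (L i j) * int s + P (L i j) j) = (\<Sum>J\<in>{0..<int k}. X J) * int s" if "j < s" for j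
  proof -
    have "(\<Sum>i<k. X (L i j) * int s + P (L i j) j) = (\<Sum>J\<in>{0..<int k}. X J * int s + P J j)"
      using sum.reindex[OF L(1)[OF that], of "\<lambda>J. X J * int s + P J j"] LX[OF that] by simp
    thus ?thesis using col[OF that] by (simp add: sum.distrib sum_distrib_right)
  qed
  thus "\<exists>u. \<forall>j<s. (\<Sum>i<k. X (L i j) * int s + P (L i j) j) = u" by blast
qed

lemma half_mod_double: "odd e \<Longrightarrow> half_mod e (2 * z) = z mod e"
proof -
  assume "odd e"
  then obtain h where h: "e = 2 * h + 1" by (elim oddE)
  have "2 * z * (h + 1) = z + z * e" by (simp add: h algebra_simps)
  moreover have "(e + 1) div 2 = h + 1" using h by simp
  ultimately show ?thesis by (simp add: half_mod_def)
qed

lemma half_mod_neg: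
  assumes "odd e" "0 < e"
  shows "half_mod e (- z - 2) = e - 1 - half_mod e z"
proof -
  obtain h where h: "e = 2 * h + 1" using assms by (elim oddE)
  have "(- z - 2) * (h + 1) = (- (z * (h + 1)) - 1) - e" by (simp add: h algebra_simps)
  moreover have "(e + 1) div 2 = h + 1" using h by simp
  ultimately have "half_mod e (- z - 2) = (- (z * (h + 1)) - 1 - e) mod e" by (simp only: half_mod_def)
  also have "\<dots> = (- (z * (h + 1)) - 1) mod e" by (simp only: minus_mod_self2)
  also have "\<dots> = e - 1 - half_mod e z"
    unfolding neg_mod_eq[OF assms(2)] using \<open>(e + 1) div 2 = h + 1\<close> by (simp only: half_mod_def)
  finally show ?thesis .
qed

text \<open>On levels \<open>0, \<dots>, 2 g\<close> (residues modulo \<open>2 g + 1\<close>): the maps \<open>J \<mapsto> J - 1\<close>, \<open>J \<mapsto> - 2 J - 2\<close> and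
  \<open>J \<mapsto> - J - 2\<close>. Level \<open>J\<close> carries the multiple \<open>J / 2\<close> (centred) of \<open>s\<close>, so that the last map is negation.\<close>

definition level_pred :: "int \<Rightarrow> int \<Rightarrow> int" where
  "level_pred g J = (if J = 0 then 2 * g else J - 1)"

definition level_double :: "int \<Rightarrow> int \<Rightarrow> int" where
  "level_double g J = (if J < g then 2 * g - 1 - 2 * J else 4 * g - 2 * J)"

definition level_neg :: "int \<Rightarrow> int \<Rightarrow> int" where
  "level_neg g J = (if J = 2 * g then 2 * g else 2 * g - 1 - J)"

text \<open>The quotients balance in every row for any permutation \<iota>: columns
  \<open>2 * h\<close>, 0 and \<open>h\<close> lie on levels \<open>i\<close>, \<open>i - 1\<close>
  and \<open>- 2 * i - 2\<close>, whose halves form the halving triple, and \<open>J1\<close>,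
  \<open>J2\<close> are equally large with opposite quotients. Only the condition \<open>row\<close>
  on the remainders is left.\<close>

lemma magic_rectangle_columns:
  fixes P :: "int \<Rightarrow> nat \<Rightarrow> int" and \<iota> :: "int \<Rightarrow> int"
  assumes ks: "k = 2 * g + 1" "s = 2 * h + 1" and gh: "1 \<le> g" "1 \<le> h"
    and J: "J1 \<inter> J2 = {}" "J1 \<union> J2 = {1..2 * h - 1} - {h}" "card J1 = card J2"
    and P: "\<And>J. J \<in> {0..<int k} \<Longrightarrow> inj_on (P J) {..<s}" "\<And>J j. J \<in> {0..<int k} \<Longrightarrow> j < s \<Longrightarrow> \<bar>P J j\<bar> \<le> int h"
    and col: "\<And>j. j < s \<Longrightarrow> (\<Sum>J\<in>{0..<int k}. P J j) = 0"
    and \<iota>: "inj_on \<iota> {0..<int k}" "\<iota> ` {0..<int k} \<subseteq> {0..<int k}"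
    and row: "\<And>i. i \<in> {0..<int k} \<Longrightarrow> P i (2 * h) + P (level_pred (int g) i) 0 + P (level_double (int g) i) h +
      (\<Sum>j\<in>J1. P (\<iota> i) j) + (\<Sum>j\<in>J2. P (level_neg (int g) (\<iota> i)) j) = 0"
  shows "\<exists>w. magic_rectangle k s w"
proof -
  define X where "X J = half_mod (int k) J - int g" for J
  define L where "L i j = (if j = 2 * h then int i else if j = 0 then level_pred (int g) (int i)
    else if j = h then level_double (int g) (int i) else if j \<in> J1 then \<iota> (int i)
    else level_neg (int g) (\<iota> (int i)))" for i j
  have k: "odd (int k)" "0 < int k" "int k = 2 * int g + 1" using ks by auto
  have fin: "finite J1" "finite J2" using J(2) by (metis finite_Diff finite_Un finite_atLeastAtMost)+
  have split: "(\<Sum>j<s. F j) = F (2 * h) + F 0 + F h + (\<Sum>j\<in>J1. F j) + (\<Sum>j\<in>J2. F j)" for F :: "nat \<Rightarrow> int"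
  proof -
    have "{..<s} = insert (2 * h) (insert 0 (insert h (J1 \<union> J2)))"
      unfolding J(2) using ks gh by auto
    moreover have "2 * h \<notin> insert 0 (insert h (J1 \<union> J2))" "0 \<notin> insert h (J1 \<union> J2)" "h \<notin> J1 \<union> J2"
      unfolding J(2) using gh by auto
    moreover have "(\<Sum>j\<in>J1 \<union> J2. F j) = (\<Sum>j\<in>J1. F j) + (\<Sum>j\<in>J2. F j)"
      using fin J(1) by (rule sum.union_disjoint)
    ultimately show ?thesis using fin by simp
  qed
  have nJ: "2 * h \<notin> J1" "0 \<notin> J1" "h \<notin> J1" "2 * h \<notin> J2" "0 \<notin> J2" "h \<notin> J2"
  proof -
    have "J1 \<subseteq> {1..2 * h - 1} - {h}" "J2 \<subseteq> {1..2 * h - 1} - {h}" using J(2) by blast+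
    thus "2 * h \<notin> J1" "0 \<notin> J1" "h \<notin> J1" "2 * h \<notin> J2" "0 \<notin> J2" "h \<notin> J2"
      using gh by auto
  qed
  have splitL: "(\<Sum>j<s. Q (L i j) j) = Q (int i) (2 * h) + Q (level_pred (int g) (int i)) 0 + Q (level_double (int g) (int i)) h +
      (\<Sum>j\<in>J1. Q (\<iota> (int i)) j) + (\<Sum>j\<in>J2. Q (level_neg (int g) (\<iota> (int i))) j)" for Q :: "int \<Rightarrow> nat \<Rightarrow> int" and i
  proof -
    have "(\<Sum>j\<in>J1. Q (L i j) j) = (\<Sum>j\<in>J1. Q (\<iota> (int i)) j)"
      by (rule sum.cong[OF refl]) (use nJ in \<open>auto simp: L_def\<close>)
    moreover have "(\<Sum>j\<in>J2. Q (L i j) j) = (\<Sum>j\<in>J2. Q (level_neg (int g) (\<iota> (int i))) j)"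
      by (rule sum.cong[OF refl]) (use nJ J(1) in \<open>auto simp: L_def\<close>)
    ultimately show ?thesis unfolding split[of "\<lambda>j. Q (L i j) j"] using gh by (simp add: L_def)
  qed
  have \<iota>mem: "\<iota> z \<in> {0..<int k}" if "z \<in> {0..<int k}" for z using \<iota>(2) that by blast
  have X_neg: "X (level_neg (int g) J) = - X J" if "J \<in> {0..<int k}" for J
  proof -
    have "level_neg (int g) J mod int k = (- J - 2) mod int k"
      by (auto simp: mod_eq_dvd_iff level_neg_def k(3) algebra_simps intro: dvdI[of _ _ 2] dvdI[of _ _ 1])
    from half_mod_cong[OF this] show ?thesis using half_mod_neg[OF k(1,2), of J] k(3) by (simp add: X_def)
  qed
  have "magic_rectangle k s (\<lambda>i j. X (L i j) * int s + P (L i j) j)"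
  proof (rule magic_rectangle_levels[OF ks])
    show "inj_on X {0..<int k}"
    proof (rule inj_onI)
      fix x y assume "x \<in> {0..<int k}" "y \<in> {0..<int k}" "X x = X y"
      thus "x = y" using half_mod_inject[OF k(1), of x y] by (simp add: X_def)
    qed
    show "\<bar>X J\<bar> \<le> int g" for J using half_mod_range[OF k(2), of J] k(3) by (auto simp: X_def)
    show "L i j \<in> {0..<int k}" if "i < k" "j < s" for i j
    proof -
      have "\<iota> (int i) \<in> {0..<int k}" using \<iota>mem[of "int i"] that by simp
      thus ?thesis using that k(3) gh by (auto simp: L_def level_pred_def level_double_def level_neg_def)
    qed
    show "inj_on (\<lambda>i. L i j) {..<k}" if "j < s" for j
    proof (rule inj_onI)
      fix x y assume xy: "x \<in> {..<k}" "y \<in> {..<k}" "L x j = L y j"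
      have \<iota>xy: "\<iota> (int x) = \<iota> (int y) \<Longrightarrow> x = y" using inj_onD[OF \<iota>(1), of "int x" "int y"] xy by simp
      have "x = y" if "level_neg (int g) (\<iota> (int x)) = level_neg (int g) (\<iota> (int y))"
      proof -
        have "\<iota> (int x) \<in> {0..<int k}" "\<iota> (int y) \<in> {0..<int k}" using \<iota>mem[of "int x"] \<iota>mem[of "int y"] xy by simp_all
        hence "\<iota> (int x) = \<iota> (int y)" using that k(3) by (auto simp: level_neg_def split: if_splits)
        thus ?thesis by (rule \<iota>xy)
      qed
      moreover have "x = y" if "level_double (int g) (int x) = level_double (int g) (int y)"
        using that unfolding level_double_def by (simp split: if_splits; presburger)
      moreover have "x = y" if "level_pred (int g) (int x) = level_pred (int g) (int y)"
        using that xy k(3) unfolding level_pred_def by (auto split: if_splits)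
      ultimately show "x = y" using xy(3) \<iota>xy by (simp add: L_def split: if_splits)
    qed
    show "(\<Sum>j<s. X (L i j)) = 0" if "i < k" for i
    proof -
      define z where "z = int i"
      have z: "z \<in> {0..<int k}" using that by (simp add: z_def)
      have "level_pred (int g) z mod int k = (z - 1) mod int k"
        using k(3) by (auto simp: mod_eq_dvd_iff level_pred_def)
      hence "half_mod (int k) (level_pred (int g) z) = half_mod (int k) (z - 1)" by (rule half_mod_cong)
      moreover have "half_mod (int k) (level_double (int g) z) = (- z - 1) mod int k"
      proof -
        have "level_double (int g) z mod int k = (2 * (- z - 1)) mod int k"
          by (auto simp: mod_eq_dvd_iff level_double_def k(3) algebra_simps intro: dvdI[of _ _ 2] dvdI[of _ _ 1])
        from half_mod_cong[OF this] show ?thesis using half_mod_double[OF k(1), of "- z - 1"] by simp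
      qed
      ultimately have "X z + X (level_pred (int g) z) + X (level_double (int g) z) = 0"
        using half_mod_triple[OF k(1,2), of z] k(3) by (simp add: X_def)
      moreover have "X (level_neg (int g) (\<iota> z)) = - X (\<iota> z)" using X_neg \<iota>(2) z by blast
      ultimately show ?thesis using splitL[of "\<lambda>J j. X J" i] J(3) by (simp add: z_def)
    qed
    show "(\<Sum>j<s. P (L i j) j) = 0" if "i < k" for i
      using splitL[of P i] row[of "int i"] that by simp
  qed (use P col in auto)
  thus ?thesis by blast
qed

section \<open>Three zero-sum permutations of the columns and the partition of the columns\<close>

text \<open>\<open>colP\<close>, \<open>colQ\<close> and \<open>colR\<close> are the three terms of
  the halving identity modulo \<open>s = 2 * h + 1\<close>, centred by \<open>h\<close>. The middle
  one, \<open>- j - 1\<close>, simplifies to \<open>h - j\<close> for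
  \<open>j \<le> 2 * h\<close>.\<close>

definition colP :: "nat \<Rightarrow> nat \<Rightarrow> int" where
  "colP h j = half_mod (2 * int h + 1) (int j - 1) - int h"

definition colQ :: "nat \<Rightarrow> nat \<Rightarrow> int" where
  "colQ h j = int h - int j"

definition colR :: "nat \<Rightarrow> nat \<Rightarrow> int" where
  "colR h j = half_mod (2 * int h + 1) (int j) - int h"

lemma col_sum:
  assumes "j < 2 * h + 1"
  shows "colP h j + colQ h j + colR h j = 0"
proof -
  have "(- int j - 1) mod (2 * int h + 1) = 2 * int h - int j"
    using neg_mod_eq[of "2 * int h + 1" "int j"] assms by simp
  thus ?thesis using half_mod_triple[of "2 * int h + 1" "int j"] by (simp add: colP_def colQ_def colR_def)
qed

lemma col_inj:
  "inj_on (colP h) {..<2 * h + 1}" "inj_on (colQ h) {..<2 * h + 1}" "inj_on (colR h) {..<2 * h + 1}"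
proof -
  show "inj_on (colQ h) {..<2 * h + 1}" by (auto simp: inj_on_def colQ_def)
  have *: "i = j" if "i < 2 * h + 1" "j < 2 * h + 1"
    "half_mod (2 * int h + 1) (int i - c) = half_mod (2 * int h + 1) (int j - c)" for i j c
  proof -
    have "(int i - c) mod (2 * int h + 1) = (int j - c) mod (2 * int h + 1)"
      by (rule half_mod_inject) (use that in auto)
    hence "int i mod (2 * int h + 1) = int j mod (2 * int h + 1)" by (simp add: mod_eq_dvd_iff)
    thus ?thesis using that(1,2) by simp
  qed
  show "inj_on (colP h) {..<2 * h + 1}"
    by (rule inj_onI) (use *[of _ _ 1] in \<open>simp add: colP_def\<close>)
  show "inj_on (colR h) {..<2 * h + 1}"
    by (rule inj_onI) (use *[of _ _ 0] in \<open>simp add: colR_def\<close>)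
qed

lemma col_range:
  assumes "j < 2 * h + 1"
  shows "\<bar>colP h j\<bar> \<le> int h" "\<bar>colQ h j\<bar> \<le> int h" "\<bar>colR h j\<bar> \<le> int h"
  using assms half_mod_range[of "2 * int h + 1" "int j - 1"] half_mod_range[of "2 * int h + 1" "int j"]
  by (auto simp: colP_def colQ_def colR_def)

lemma col_special:
  assumes "1 \<le> h"
  shows "colP h 0 = 0" "colQ h 0 = int h" "colR h 0 = - int h"
    and "colP h (2 * h) = int h" "colQ h (2 * h) = - int h" "colR h (2 * h) = 0"
    and "colQ h h = 0" "colP h h = - colR h h"
proof -
  have s: "odd (2 * int h + 1)" "0 < 2 * int h + 1" by auto
  show "colQ h 0 = int h" "colQ h (2 * h) = - int h" "colQ h h = 0" by (simp_all add: colQ_def)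
  show R0: "colR h 0 = - int h" by (simp add: colR_def half_mod_eq[OF s])
  show R2: "colR h (2 * h) = 0" by (simp add: colR_def half_mod_eq[OF s])
  show "colP h 0 = 0" using col_sum[of 0 h] R0 by (simp add: colQ_def)
  show "colP h (2 * h) = int h" using col_sum[of "2 * h" h] R2 by (simp add: colQ_def)
  show "colP h h = - colR h h" using col_sum[of h h] by (simp add: colQ_def)
qed

lemma colR_minus_colQ:
  assumes "j < 2 * h + 1"
  shows "colR h j - colQ h j = column_weight h j"
proof -
  have s: "odd (2 * int h + 1)" "0 < 2 * int h + 1" by auto
  have m: "int j mod (2 * int h + 1) = int j" using assms by simp
  show ?thesis
  proof (cases "even j")
    case True
    then obtain v where "j = 2 * v" by (elim evenE)
    thus ?thesis using m by (simp add: colR_def colQ_def half_mod_eq[OF s] column_weight_def)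
  next
    case False
    then obtain v where v: "j = 2 * v + 1" by (elim oddE)
    have "(int j + (2 * int h + 1)) div 2 = int v + int h + 1" using v by simp
    thus ?thesis using m v by (simp add: colR_def colQ_def half_mod_eq[OF s] column_weight_def)
  qed
qed

locale column_partition =
  fixes h :: nat and J1 J2 :: "nat set"
  assumes h: "1 \<le> h" and disjoint: "J1 \<inter> J2 = {}" and union: "J1 \<union> J2 = {1..2 * h - 1} - {h}"
    and card: "card J1 = h - 1"
begin

lemma finite: "finite J1" "finite J2"
  using union by (metis finite_Diff finite_Un finite_atLeastAtMost)+

lemma card2: "card J2 = h - 1"
proof -
  have "card J1 + card J2 = card ({1..2 * h - 1} - {h})"
    using card_Un_disjoint[OF finite disjoint] union by simp
  also have "\<dots> = 2 * h - 2" using h by simp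
  finally show ?thesis using card by simp
qed

lemma bound: "j \<in> J1 \<union> J2 \<Longrightarrow> j < 2 * h + 1 \<and> j \<noteq> 0 \<and> j \<noteq> h \<and> j \<noteq> 2 * h"
  unfolding union using h by auto

lemma sum_split:
  "(\<Sum>j<2 * h + 1. F j) = F (2 * h) + F 0 + F h + (\<Sum>j\<in>J1. F j) + (\<Sum>j\<in>J2. F j)" for F :: "nat \<Rightarrow> int"
proof -
  have "{..<2 * h + 1} = insert (2 * h) (insert 0 (insert h (J1 \<union> J2)))"
    unfolding union using h by auto
  moreover have "2 * h \<notin> insert 0 (insert h (J1 \<union> J2))" "0 \<notin> insert h (J1 \<union> J2)" "h \<notin> J1 \<union> J2"
    unfolding union using h by auto
  moreover have "(\<Sum>j\<in>J1 \<union> J2. F j) = (\<Sum>j\<in>J1. F j) + (\<Sum>j\<in>J2. F j)"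
    using finite disjoint by (rule sum.union_disjoint)
  ultimately show ?thesis using finite by simp
qed

text \<open>Each of the three is a permutation of the interval from \<open>- h\<close> to
  \<open>h\<close> and totals zero, so its sum over \<open>J1\<close> and \<open>J2\<close> is minus
  its values at 0, \<open>h\<close> and \<open>2 * h\<close>.\<close>

lemma sum_J:
  "(\<Sum>j\<in>J1. colP h j) + (\<Sum>j\<in>J2. colP h j) = colR h h - int h"
  "(\<Sum>j\<in>J1. colQ h j) + (\<Sum>j\<in>J2. colQ h j) = 0"
  "(\<Sum>j\<in>J1. colR h j) + (\<Sum>j\<in>J2. colR h j) = int h - colR h h"
proof -
  have "(\<Sum>j<2 * h + 1. colP h j) = 0" "(\<Sum>j<2 * h + 1. colQ h j) = 0" "(\<Sum>j<2 * h + 1. colR h j) = 0"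
    by (rule sum_centred_perm[of _ _ h]; use col_inj col_range in auto)+
  thus "(\<Sum>j\<in>J1. colP h j) + (\<Sum>j\<in>J2. colP h j) = colR h h - int h"
    "(\<Sum>j\<in>J1. colQ h j) + (\<Sum>j\<in>J2. colQ h j) = 0"
    "(\<Sum>j\<in>J1. colR h j) + (\<Sum>j\<in>J2. colR h j) = int h - colR h h"
    unfolding sum_split using col_special[OF h] by auto
qed

lemma sum_weight:
  assumes "S \<subseteq> J1 \<union> J2"
  shows "(\<Sum>j\<in>S. column_weight h j) = (\<Sum>j\<in>S. colR h j) - (\<Sum>j\<in>S. colQ h j)"
proof -
  have "(\<Sum>j\<in>S. column_weight h j) = (\<Sum>j\<in>S. colR h j - colQ h j)"
    by (rule sum.cong[OF refl]) (use assms bound colR_minus_colQ in fastforce)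
  thus ?thesis by (simp add: sum_subtractf)
qed

text \<open>Each level carries one permutation. Row 1 balances by \<open>sum_J\<close>, and rows 0
  and 2 reduce to one equation, \<open>colQ\<close> on \<open>J1\<close> plus \<open>colR\<close> on
  \<open>J2\<close> equals \<open>h - colR h h\<close>. As \<open>colQ\<close> totals zero on both
  parts, this prescribes the weight of \<open>J2\<close>. With more rows the defects
  \<open>- h\<close> and \<open>colR h h\<close> occur in different rows; here they meet in row 0,
  which explains the different target.\<close>

lemma three_row_rectangle:
  assumes "(\<Sum>j\<in>J2. column_weight h j) = int h - colR h h"
  shows "\<exists>w. magic_rectangle 3 (2 * h + 1) w"
proof -
  define P where "P J = (if J = 0 then colQ h else if J = 1 then colR h else colP h)" for J :: int
  define \<iota> where "\<iota> J = (if J = 0 then 0 else 3 - J)" for J :: int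
  have lev: "{0..<int 3} = {0, 1, 2}" by auto
  have e: "(\<Sum>j\<in>J1. colQ h j) + (\<Sum>j\<in>J2. colR h j) = int h - colR h h"
    using assms sum_weight[of J2] sum_J(2) by auto
  show ?thesis
  proof (rule magic_rectangle_columns[where g = 1 and h = h and P = P and \<iota> = \<iota> and ?J1.0 = J1 and ?J2.0 = J2])
    show "inj_on (P J) {..<2 * h + 1}" for J using col_inj by (auto simp: P_def)
    show "\<bar>P J j\<bar> \<le> int h" if "j < 2 * h + 1" for J j using col_range[OF that] by (auto simp: P_def)
    show "(\<Sum>J\<in>{0..<int 3}. P J j) = 0" if "j < 2 * h + 1" for j
      unfolding lev using col_sum[OF that] by (simp add: P_def)
    show "inj_on \<iota> {0..<int 3}" by (auto simp: inj_on_def \<iota>_def)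
    show "\<iota> ` {0..<int 3} \<subseteq> {0..<int 3}" by (auto simp: \<iota>_def)
    fix i assume "i \<in> {0..<int 3}"
    hence "i = 0 \<or> i = 1 \<or> i = 2" unfolding lev by auto
    thus "P i (2 * h) + P (level_pred (int 1) i) 0 + P (level_double (int 1) i) h
      + (\<Sum>j\<in>J1. P (\<iota> i) j) + (\<Sum>j\<in>J2. P (level_neg (int 1) (\<iota> i)) j) = 0"
      using col_special[OF h] e sum_J
      by (elim disjE) (auto simp: P_def \<iota>_def level_pred_def level_double_def level_neg_def)
  qed (use h disjoint union card card2 in auto)
qed

text \<open>The labels imitate \<open>colQ\<close> at the columns 0, \<open>h\<close> and
  \<open>2 * h\<close>. It remains to split the other \<open>2 * (h - 1)\<close> values into two
  equally large halves, each of sum zero.\<close>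

lemma ex_balanced_labels:
  assumes "4 \<le> h"
  shows "\<exists>f :: nat \<Rightarrow> int. inj_on f {..<2 * h + 1} \<and> (\<forall>j<2 * h + 1. \<bar>f j\<bar> \<le> int h) \<and>
    f 0 = int h \<and> f h = 0 \<and> f (2 * h) = - int h \<and> (\<Sum>j\<in>J1. f j) = 0 \<and> (\<Sum>j\<in>J2. f j) = 0"
proof -
  define D where "D = {- int (h - 1)..int (h - 1)} - {0}"
  have interval: "\<Sum>{- int n..int n} = 0" for n
    using sum_centred_perm[of "\<lambda>x. x" "{- int n..int n}" n] by (auto simp: abs_le_iff)
  have "\<exists>Z\<subseteq>D. card Z = h - 1 \<and> \<Sum>Z = 0"
  proof (cases "odd h")
    case True
    then obtain b where b: "h = 2 * b + 1" by (elim oddE)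
    show ?thesis
    proof (intro exI[of _ "{- int b..int b} - {0}"] conjI)
      show "{- int b..int b} - {0} \<subseteq> D" using b by (auto simp: D_def)
      show "card ({- int b..int b} - {0}) = h - 1" using b by simp
      show "\<Sum>({- int b..int b} - {0}) = 0" using interval[of b] by (simp add: sum_diff1)
    qed
  next
    case False
    then obtain b where b: "h = 2 * b" by (auto elim: evenE)
    \<comment> \<open>Here \<open>h - 1\<close> is odd, so symmetric pairs alone do not give a
      zero-sum half; \<open>1 + 2 - 3 = 0\<close> supplies three elements, and pairs beyond 3 the
      others. The value 3 is available because \<open>4 \<le> h\<close>.\<close>
    define E where "E = {- int (b + 1)..int (b + 1)} - {- 3..3}"
    have sub: "{- 3..3} \<subseteq> {- int (b + 1)..int (b + 1)}" using assms b by auto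
    have cE: "card E = 2 * b - 4" unfolding E_def using sub by (subst card_Diff_subset) auto
    have sE: "\<Sum>E = 0" unfolding E_def using sum_diff[OF _ sub, of "\<lambda>x. x"] interval[of "b + 1"] interval[of 3] by simp
    have disj: "E \<inter> {1, 2, - 3} = {}" by (auto simp: E_def)
    show ?thesis
    proof (intro exI[of _ "E \<union> {1, 2, - 3}"] conjI)
      show "E \<union> {1, 2, - 3} \<subseteq> D" using b assms by (auto simp: D_def E_def)
      have "finite E" by (simp add: E_def)
      thus "card (E \<union> {1, 2, - 3}) = h - 1" using card_Un_disjoint[OF _ _ disj] cE b assms by simp
      show "\<Sum>(E \<union> {1, 2, - 3}) = 0" using sum.union_disjoint[OF \<open>finite E\<close> _ disj, of "\<lambda>x. x"] sE by simp
    qed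
  qed
  then obtain Z where Z: "Z \<subseteq> D" "card Z = h - 1" "\<Sum>Z = 0" by blast
  have finD: "finite D" by (simp add: D_def)
  hence finZ: "finite Z" using Z(1) finite_subset by blast
  have cD: "card D = 2 * (h - 1)" by (simp add: D_def)
  have "\<Sum>D = 0" using interval[of "h - 1"] by (simp add: D_def sum_diff1)
  hence sZ: "\<Sum>(D - Z) = 0" using sum_diff[OF finD Z(1), of "\<lambda>x. x"] Z(3) by simp
  have cZ: "card (D - Z) = h - 1" using card_Diff_subset[OF finZ Z(1)] cD Z(2) by simp
  obtain f1 where f1: "bij_betw f1 J1 Z"
    using finite_same_card_bij[OF finite(1) finZ] card Z(2) by auto
  obtain f2 where f2: "bij_betw f2 J2 (D - Z)"
    using finite_same_card_bij[OF finite(2), of "D - Z"] finD card2 cZ by auto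
  define f where "f j = (if j = 0 then int h else if j = 2 * h then - int h else if j = h then 0
    else if j \<in> J1 then f1 j else f2 j)" for j
  have fJ1: "f j = f1 j" if "j \<in> J1" for j using that bound[of j] by (simp add: f_def)
  have fJ2: "f j = f2 j" if "j \<in> J2" for j using that bound[of j] disjoint by (auto simp: f_def)
  have b1: "bij_betw f J1 Z" using bij_betw_cong[of J1 f f1 Z] fJ1 f1 by blast
  have b2: "bij_betw f J2 (D - Z)" using bij_betw_cong[of J2 f f2 "D - Z"] fJ2 f2 by blast
  have bJ: "bij_betw f (J1 \<union> J2) D"
    using bij_betw_combine[OF b1 b2] Z(1) by (simp add: Un_absorb1)
  have set: "{..<2 * h + 1} = insert 0 (insert h (insert (2 * h) (J1 \<union> J2)))"
    unfolding union using h by auto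
  have fD: "f ` (J1 \<union> J2) = D" "inj_on f (J1 \<union> J2)" using bJ by (auto simp: bij_betw_def)
  have f0: "f 0 = int h" "f h = 0" "f (2 * h) = - int h" using h by (auto simp: f_def)
  have notD: "int h \<notin> D" "- int h \<notin> D" "0 \<notin> D" using h by (auto simp: D_def)
  have "inj_on f {..<2 * h + 1}"
  proof -
    have ins: "inj_on f (insert a S)" if "inj_on f S" "f a \<notin> f ` S" for a S
      using that by (auto simp: inj_on_insert)
    show ?thesis
      unfolding set
    proof (intro ins)
      show "inj_on f (J1 \<union> J2)" by (rule fD)
      show "f (2 * h) \<notin> f ` (J1 \<union> J2)" unfolding fD(1) f0 by (rule notD)
      show "f h \<notin> f ` insert (2 * h) (J1 \<union> J2)" unfolding image_insert fD(1) f0 using notD(3) h by simp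
      show "f 0 \<notin> f ` insert h (insert (2 * h) (J1 \<union> J2))" unfolding image_insert fD(1) f0 using notD(1) h by simp
    qed
  qed
  moreover have "\<bar>f j\<bar> \<le> int h" if "j < 2 * h + 1" for j
  proof -
    have "j \<in> insert 0 (insert h (insert (2 * h) (J1 \<union> J2)))" using that set by blast
    moreover have "\<bar>f j\<bar> \<le> int h" if "j \<in> J1 \<union> J2"
    proof -
      have "f j \<in> D" using fD that by blast
      thus ?thesis by (auto simp: D_def)
    qed
    ultimately show ?thesis using f0 by auto
  qed
  moreover have "(\<Sum>j\<in>J1. f j) = 0" using sum.reindex_bij_betw[OF b1, of "\<lambda>x. x"] Z(3) by simp
  moreover have "(\<Sum>j\<in>J2. f j) = 0" using sum.reindex_bij_betw[OF b2, of "\<lambda>x. x"] sZ by simp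
  ultimately show ?thesis using f0 by blast
qed

text \<open>All levels other than \<open>g - 1\<close>, \<open>g\<close> and \<open>2 g\<close> carry the labels \<open>f\<close> or \<open>- f\<close>. The columns \<open>0\<close>, \<open>h\<close>
  and \<open>2 h\<close> leave an imbalance in the rows \<open>0\<close>, \<open>g\<close> and \<open>\<beta>\<close> only, and \<open>\<iota>\<close> sends just these rows to the three
  exceptional levels, whose sums over \<open>J1\<close> and \<open>J2\<close> compensate it.\<close>

lemma many_row_rectangle:
  assumes g: "2 \<le> g" and h4: "4 \<le> h" and w: "(\<Sum>j\<in>J2. column_weight h j) = int h"
  shows "\<exists>w. magic_rectangle (2 * g + 1) (2 * h + 1) w"
proof -
  obtain f :: "nat \<Rightarrow> int" where f: "inj_on f {..<2 * h + 1}" "\<And>j. j < 2 * h + 1 \<Longrightarrow> \<bar>f j\<bar> \<le> int h"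
    "f 0 = int h" "f h = 0" "f (2 * h) = - int h" "(\<Sum>j\<in>J1. f j) = 0" "(\<Sum>j\<in>J2. f j) = 0"
    using ex_balanced_labels[OF h4] by blast
  define G where "G = int g"
  have G: "2 \<le> G" using g by (simp add: G_def)
  have k: "int (2 * g + 1) = 2 * G + 1" by (simp add: G_def)
  \<comment> \<open>There are \<open>G - 1\<close> levels carrying \<open>f\<close> and as many
    carrying \<open>- f\<close>, so they cancel in every column; the three exceptional levels cancel
    by \<open>col_sum\<close>.\<close>
  define P where "P J = (if J = G - 1 then colQ h else if J = G then colR h else if J = 2 * G then colP h
    else if J < G then f else (\<lambda>j. - f j))" for J
  \<comment> \<open>Row \<beta> meets level \<open>G\<close> in column \<open>h\<close>: it solves
    \<open>- 2 * \<beta> - 2 = G\<close> modulo \<open>2 * G + 1\<close>.\<close>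
  define \<beta> where "\<beta> = (if odd G then (G - 1) div 2 else 3 * (G div 2))"
  \<comment> \<open>Reversing the ranges from 0 to \<open>G - 1\<close> and from \<open>G\<close> to
    \<open>2 * G\<close> sends 0, \<open>G\<close>, \<open>2 * G\<close> to \<open>G - 1\<close>,
    \<open>2 * G\<close>, \<open>G\<close>; exchanging \<beta> with \<open>2 * G\<close> beforehand
    makes \<beta> the row that goes to \<open>G\<close>.\<close>
  define \<sigma> where "\<sigma> i = (if i = \<beta> then 2 * G else if i = 2 * G then \<beta> else i)" for i
  define \<iota> where "\<iota> i = (if \<sigma> i < G then G - 1 - \<sigma> i else 3 * G - \<sigma> i)" for i
  have \<beta>: "0 < \<beta>" "\<beta> < 2 * G + 1" "\<beta> \<noteq> G" "level_double G \<beta> = G"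
    using G unfolding \<beta>_def level_double_def by (cases "odd G"; auto elim!: oddE evenE)+
  have \<sigma>: "\<sigma> i \<in> {0..<2 * G + 1}" if "i \<in> {0..<2 * G + 1}" for i using that \<beta> G by (auto simp: \<sigma>_def)
  have \<iota>_mem: "\<iota> i \<in> {0..<2 * G + 1}" if "i \<in> {0..<2 * G + 1}" for i using \<sigma>[OF that] by (auto simp: \<iota>_def)
  have \<iota>_inj: "i = i'" if "i \<in> {0..<2 * G + 1}" "i' \<in> {0..<2 * G + 1}" "\<iota> i = \<iota> i'" for i i'
  proof -
    have "\<sigma> i = \<sigma> i'" using that \<sigma>[OF that(1)] \<sigma>[OF that(2)] by (auto simp: \<iota>_def split: if_splits)
    thus ?thesis by (auto simp: \<sigma>_def split: if_splits)
  qed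
  have \<iota>_special: "\<iota> 0 = G - 1" "\<iota> G = 2 * G" "\<iota> \<beta> = G"
    using G \<beta> by (auto simp: \<iota>_def \<sigma>_def)
  note sp = col_special[OF h]
  have P2: "P J (2 * h) = (if J < G then - int h else if J = G then 0 else int h)" for J
    using sp f G by (auto simp: P_def)
  have P0: "P J 0 = (if J < G then int h else if J = 2 * G then 0 else - int h)" for J
    using sp f G by (auto simp: P_def)
  have Ph: "P J h = (if J = G then colR h h else if J = 2 * G then - colR h h else 0)" for J
    using sp f G by (auto simp: P_def)
  have PJ: "(\<Sum>j\<in>S. P J j) = (if J = G - 1 then \<Sum>j\<in>S. colQ h j else if J = G then \<Sum>j\<in>S. colR h j
      else if J = 2 * G then \<Sum>j\<in>S. colP h j else 0)" if "(\<Sum>j\<in>S. f j) = 0" for J S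
    using that by (auto simp: P_def sum_negf)
  have e: "(\<Sum>j\<in>J1. colQ h j) + (\<Sum>j\<in>J2. colR h j) = int h"
    using w sum_weight[of J2] sum_J(2) by auto
  show ?thesis
  proof (rule magic_rectangle_columns[where g = g and h = h and P = P and \<iota> = \<iota> and ?J1.0 = J1 and ?J2.0 = J2], unfold k)
    have nf: "inj_on (\<lambda>j. - f j) {..<2 * h + 1}" using f(1) by (auto simp: inj_on_def)
    show "inj_on (P J) {..<2 * h + 1}" for J using col_inj f(1) nf by (auto simp: P_def)
    show "\<bar>P J j\<bar> \<le> int h" if "j < 2 * h + 1" for J j using col_range[OF that] f(2)[OF that] by (auto simp: P_def)
    show "(\<Sum>J\<in>{0..<2 * G + 1}. P J j) = 0" if "j < 2 * h + 1" for j
    proof -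
      have "{0..<2 * G + 1} = insert (2 * G) (insert G (insert (G - 1) ({0..<G - 1} \<union> {G + 1..<2 * G})))"
        using G by auto
      moreover have "(\<Sum>J\<in>{0..<G - 1} \<union> {G + 1..<2 * G}. P J j) = 0"
      proof -
        have "(\<Sum>J\<in>{0..<G - 1} \<union> {G + 1..<2 * G}. P J j) = (\<Sum>J\<in>{0..<G - 1}. P J j) + (\<Sum>J\<in>{G + 1..<2 * G}. P J j)"
          by (rule sum.union_disjoint) auto
        also have "(\<Sum>J\<in>{0..<G - 1}. P J j) = (\<Sum>J\<in>{0..<G - 1}. f j)"
          by (rule sum.cong) (auto simp: P_def)
        also have "(\<Sum>J\<in>{G + 1..<2 * G}. P J j) = (\<Sum>J\<in>{G + 1..<2 * G}. - f j)"
          by (rule sum.cong) (auto simp: P_def)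
        finally show ?thesis using G by simp
      qed
      moreover have "P (2 * G) j + P G j + P (G - 1) j = 0" using col_sum[OF that] G by (simp add: P_def)
      ultimately show ?thesis using G by simp
    qed
    show "inj_on \<iota> {0..<2 * G + 1}" using \<iota>_inj by (rule inj_onI)
    show "\<iota> ` {0..<2 * G + 1} \<subseteq> {0..<2 * G + 1}" using \<iota>_mem by blast
    fix i assume i: "i \<in> {0..<2 * G + 1}"
    \<comment> \<open>Columns 0 and \<open>2 * h\<close> together leave \<open>- h\<close> in row 0
      and \<open>h\<close> in row \<open>G\<close>; column \<open>h\<close> adds
      \<open>- colR h h\<close> in row \<open>G\<close> and \<open>colR h h\<close> in row
      \<beta>.\<close>
    consider "i = 0" | "i = G" | "i = \<beta>" | "i \<noteq> 0" "i \<noteq> G" "i \<noteq> \<beta>" by blast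
    hence "P i (2 * h) + P (level_pred G i) 0 + P (level_double G i) h
      + (\<Sum>j\<in>J1. P (\<iota> i) j) + (\<Sum>j\<in>J2. P (level_neg G (\<iota> i)) j) = 0"
    proof cases
      case 1
      have "level_pred G 0 = 2 * G" "level_double G 0 = 2 * G - 1" "level_neg G (G - 1) = G"
        using G by (auto simp: level_pred_def level_double_def level_neg_def)
      thus ?thesis unfolding 1 \<iota>_special P2 P0 Ph PJ[OF f(6)] PJ[OF f(7)] using G e by simp
    next
      case 2
      have "level_pred G G = G - 1" "level_double G G = 2 * G" "level_neg G (2 * G) = 2 * G"
        using G by (auto simp: level_pred_def level_double_def level_neg_def)
      thus ?thesis unfolding 2 \<iota>_special P2 P0 Ph PJ[OF f(6)] PJ[OF f(7)] using G sum_J(1) by simp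
    next
      case 3
      have "P \<beta> (2 * h) + P (level_pred G \<beta>) 0 = 0"
        unfolding P2 P0 using \<beta> G by (auto simp: level_pred_def)
      moreover have "level_neg G G = G - 1" using G by (simp add: level_neg_def)
      ultimately show ?thesis unfolding 3 \<iota>_special \<beta>(4) Ph PJ[OF f(6)] PJ[OF f(7)] using G e sum_J(2,3) by simp
    next
      case 4
      have "P i (2 * h) + P (level_pred G i) 0 = 0"
        unfolding P2 P0 using 4 i G by (auto simp: level_pred_def)
      moreover have "level_double G i \<noteq> 2 * G"
        using 4(2) i unfolding level_double_def by (auto; presburger)
      moreover have "level_double G i \<noteq> G"
      proof
        assume d: "level_double G i = G"
        have "i = \<beta>"
        proof (cases "i < G")
          case True
          hence "2 * G - 1 - 2 * i = G" using d by (simp add: level_double_def)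
          hence "odd G" "i = (G - 1) div 2" by presburger+
          thus ?thesis by (simp add: \<beta>_def)
        next
          case False
          hence "4 * G - 2 * i = G" using d by (simp add: level_double_def)
          hence "even G" "i = 3 * (G div 2)" by presburger+
          thus ?thesis by (simp add: \<beta>_def)
        qed
        thus False using 4 by simp
      qed
      moreover have "\<iota> i \<noteq> G - 1" "\<iota> i \<noteq> 2 * G" "\<iota> i \<noteq> G"
        using \<iota>_inj[OF i, of 0] \<iota>_inj[OF i, of G] \<iota>_inj[OF i, of \<beta>] \<iota>_special 4 \<beta> G by auto
      moreover from this have "level_neg G (\<iota> i) \<noteq> G - 1" "level_neg G (\<iota> i) \<noteq> 2 * G" "level_neg G (\<iota> i) \<noteq> G"
        using \<iota>_mem[OF i] by (auto simp: level_neg_def)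
      ultimately show ?thesis unfolding Ph PJ[OF f(6)] PJ[OF f(7)] by simp
    qed
    thus "P i (2 * h) + P (level_pred (int g) i) 0 + P (level_double (int g) i) h
      + (\<Sum>j\<in>J1. P (\<iota> i) j) + (\<Sum>j\<in>J2. P (level_neg (int g) (\<iota> i)) j) = 0" by (simp only: G_def)
  qed (use h g disjoint union card card2 in auto)
qed

end

text \<open>The weights of the columns from 1 to \<open>2 * h - 1\<close> total \<open>h\<close>, so
  the complement of \<open>K\<close> weighs \<open>h - \<theta>\<close>. Both orders of the parts
  are provided, because the three-row construction takes \<open>J1\<close> as its second
  part.\<close>

lemma column_set_partition:
  assumes "column_set h \<theta>" "1 \<le> h"
  obtains J1 J2 where "column_partition h J1 J2" "column_partition h J2 J1"
    "(\<Sum>j\<in>J1. column_weight h j) = int \<theta> - colR h h" "(\<Sum>j\<in>J2. column_weight h j) = int h - int \<theta>"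
proof -
  obtain K where K: "K \<subseteq> {1..2 * h - 1}" "h \<in> K" "card K = h" "(\<Sum>j\<in>K. column_weight h j) = int \<theta>"
    using assms(1) unfolding column_set_def by blast
  have finK: "finite K" using K(1) finite_subset by blast
  define J1 J2 where "J1 = K - {h}" and "J2 = {1..2 * h - 1} - K"
  have cp1: "column_partition h J1 J2"
  proof
    show "J1 \<inter> J2 = {}" by (auto simp: J1_def J2_def)
    show "J1 \<union> J2 = {1..2 * h - 1} - {h}" using K(1,2) by (auto simp: J1_def J2_def)
    show "card J1 = h - 1" using K(2,3) finK by (simp add: J1_def)
  qed (rule assms(2))
  have cp2: "column_partition h J2 J1"
  proof
    show "J2 \<inter> J1 = {}" by (auto simp: J1_def J2_def)
    show "J2 \<union> J1 = {1..2 * h - 1} - {h}" using K(1,2) by (auto simp: J1_def J2_def)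
    show "card J2 = h - 1" using card_Diff_subset[OF finK K(1)] K(3) by (simp add: J2_def)
  qed (rule assms(2))
  have "column_weight h h = colR h h"
    using colR_minus_colQ[of h h] col_special(7)[OF assms(2)] by simp
  hence w1: "(\<Sum>j\<in>J1. column_weight h j) = int \<theta> - colR h h"
    using sum_diff1[OF finK, of "column_weight h" h] K(2,4) by (simp add: J1_def)
  have "(\<Sum>j\<in>J1. column_weight h j) + (\<Sum>j\<in>J2. column_weight h j) = int h - colR h h"
    using column_partition.sum_weight[OF cp1, of J1] column_partition.sum_weight[OF cp1, of J2]
      column_partition.sum_J(2,3)[OF cp1] by simp
  hence "(\<Sum>j\<in>J2. column_weight h j) = int h - int \<theta>" using w1 by simp
  thus ?thesis using that cp1 cp2 w1 by blast
qed

section \<open>Small rectangles given by tables\<close>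

text \<open>A list of rows turns distinctness, range and line sums into closed conditions that
  simplification evaluates.\<close>

lemma magic_rectangle_table:
  fixes A :: "nat list list"
  assumes len: "length A = k" "\<forall>row\<in>set A. length row = s" and s: "0 < s"
    and dist: "distinct (concat A)" and ran: "\<forall>x\<in>set (concat A). 1 \<le> x \<and> x \<le> k * s"
    and rows: "\<forall>row\<in>set A. sum_list row = u"
    and cols: "\<forall>j\<in>set [0..<s]. (\<Sum>i\<leftarrow>[0..<k]. A ! i ! j) = v"
  shows "magic_rectangle k s (\<lambda>i j. int (A ! i ! j))"
  unfolding magic_rectangle_def
proof (intro conjI)
  have row: "A ! i \<in> set A" "length (A ! i) = s" if "i < k" for i using that len by auto
  show "inj_on (\<lambda>(i, j). int (A ! i ! j)) ({..<k} \<times> {..<s})"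
  proof (rule inj_onI, clarsimp)
    fix i j i' j' assume *: "i < k" "j < s" "i' < k" "j' < s" "A ! i ! j = A ! i' ! j'"
    have "[] \<notin> set A" using len(2) s by auto
    hence dA: "distinct A" "\<And>row. row \<in> set A \<Longrightarrow> distinct row"
      "\<And>r r'. r \<in> set A \<Longrightarrow> r' \<in> set A \<Longrightarrow> r \<noteq> r' \<Longrightarrow> set r \<inter> set r' = {}"
      using dist unfolding distinct_concat_iff by (auto simp: removeAll_id)
    have "A ! i ! j \<in> set (A ! i) \<inter> set (A ! i')" using * row[of i] row[of i'] by (metis IntI nth_mem)
    hence "A ! i = A ! i'" using dA(3)[OF row(1)[OF *(1)] row(1)[OF *(3)]] by blast
    hence "i = i'" using dA(1) * len(1) by (simp add: nth_eq_iff_index_eq)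
    moreover have "j = j'" using *(5) dA(2)[OF row(1)[OF *(1)]] * row(2)[OF *(1)] \<open>i = i'\<close>
      by (simp add: nth_eq_iff_index_eq)
    ultimately show "i = i' \<and> j = j'" by simp
  qed
  have "1 \<le> int (A ! i ! j) \<and> int (A ! i ! j) < 1 + int (k * s)" if "i < k" "j < s" for i j
  proof -
    have "A ! i ! j \<in> set (A ! i)" using row[OF that(1)] that(2) by simp
    hence "A ! i ! j \<in> set (concat A)" using row(1)[OF that(1)] by auto
    hence "1 \<le> A ! i ! j \<and> A ! i ! j \<le> k * s" using ran by blast
    thus ?thesis by linarith
  qed
  thus "\<exists>a. \<forall>i<k. \<forall>j<s. a \<le> int (A ! i ! j) \<and> int (A ! i ! j) < a + int (k * s)" by blast
  have "(\<Sum>j<s. int (A ! i ! j)) = int u" if "i < k" for i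
    using rows row[OF that] sum_list_sum_nth[of "A ! i"] by (simp add: lessThan_atLeast0 flip: of_nat_sum)
  thus "\<exists>u. \<forall>i<k. (\<Sum>j<s. int (A ! i ! j)) = u" by blast
  have "(\<Sum>i<k. int (A ! i ! j)) = int v" if "j < s" for j
    using cols that by (simp add: lessThan_atLeast0 interv_sum_list_conv_sum_set_nat flip: of_nat_sum)
  thus "\<exists>u. \<forall>j<s. (\<Sum>i<k. int (A ! i ! j)) = u" by blast
qed

lemma magic_rectangle_3_5: "\<exists>w. magic_rectangle 3 5 w"
  by (rule exI, rule magic_rectangle_table[where u = 40 and v = 24 and
      A = "[[10, 8, 6, 9, 7], [2, 5, 15, 14, 4], [12, 11, 3, 1, 13]]"]) (simp_all add: upt_rec)

lemma magic_rectangle_3_7: "\<exists>w. magic_rectangle 3 7 w"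
  by (rule exI, rule magic_rectangle_table[where u = 77 and v = 33 and
      A = "[[7, 6, 17, 18, 14, 2, 13], [21, 19, 1, 3, 9, 20, 4], [5, 8, 15, 12, 10, 11, 16]]"]) (simp_all add: upt_rec)

lemma magic_rectangle_5_7: "\<exists>w. magic_rectangle 5 7 w"
  by (rule exI, rule magic_rectangle_table[where u = 126 and v = 90 and
      A = "[[9, 12, 20, 26, 19, 33, 7], [8, 5, 11, 34, 29, 15, 24], [28, 18, 35, 10, 2, 6, 27],
            [32, 25, 21, 16, 17, 14, 1], [13, 30, 3, 4, 23, 22, 31]]"]) (simp_all add: upt_rec)

section \<open>Assembling the odd case\<close>

lemma ex_magic_rectangle:
  assumes "odd k" "odd s" "3 \<le> k" "k < s" "\<not> 3 dvd s"
  shows "\<exists>w. magic_rectangle k s w"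
proof -
  define g h where "g = k div 2" and "h = s div 2"
  have ks: "k = 2 * g + 1" "s = 2 * h + 1" using assms by (auto simp: g_def h_def)
  have h3: "h mod 3 \<noteq> 1" using assms(5) ks(2) by presburger
  show ?thesis
  proof (cases "5 \<le> h")
    case True
    hence h1: "1 \<le> h" by simp
    show ?thesis
    proof (cases "k = 3")
      case k3: True
      have "column_set h h" using column_set_exists h3 True by blast
      then obtain J1 J2 where J: "column_partition h J1 J2" "column_partition h J2 J1"
        "(\<Sum>j\<in>J1. column_weight h j) = int h - colR h h" "(\<Sum>j\<in>J2. column_weight h j) = int h - int h"
        using h1 by (rule column_set_partition)
      show ?thesis using column_partition.three_row_rectangle[OF J(2,3)] k3 ks(2) by simp
    next
      case False
      hence "2 \<le> g" using assms ks by auto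
      have "column_set h 0" using column_set_exists h3 True by blast
      then obtain J1 J2 where J: "column_partition h J1 J2" "column_partition h J2 J1"
        "(\<Sum>j\<in>J1. column_weight h j) = int 0 - colR h h" "(\<Sum>j\<in>J2. column_weight h j) = int h - int 0"
        using h1 by (rule column_set_partition)
      show ?thesis using column_partition.many_row_rectangle[OF J(1) \<open>2 \<le> g\<close>] J(4) ks True by simp
    qed
  next
    case False
    \<comment> \<open>The values \<open>h = 1\<close> and \<open>h = 4\<close> would mean
      \<open>s = 3\<close> and \<open>s = 9\<close>, both divisible by 3.\<close>
    hence "h = 2 \<or> h = 3" using h3 assms ks by presburger
    hence "k = 3 \<and> s = 5 \<or> k = 3 \<and> s = 7 \<or> k = 5 \<and> s = 7" using assms ks by presburger
    thus ?thesis using magic_rectangle_3_5 magic_rectangle_3_7 magic_rectangle_5_7 by auto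
  qed
qed

text \<open>With \<open>k = 3 * U\<close>, stacking \<open>U\<close> rectangles of three rows gives
  \<open>k\<close> rows; only the row length \<open>s\<close> then has to be prime to 3.\<close>

lemma MRS_exists_rectangle_divisible_3:
  assumes "odd k" "odd s" "odd C" "3 dvd k" "\<not> 3 dvd s" "3 \<le> s"
  shows "MRS_exists k s s k C"
proof -
  obtain U where U: "k = 3 * U" using assms by blast
  have "s \<noteq> 3" using assms by auto
  hence "\<exists>w. magic_rectangle 3 s w" using assms by (intro ex_magic_rectangle) auto
  then obtain w where w: "magic_rectangle 3 s w" by blast
  have "odd (C * U * 1)" using assms U by simp
  hence "MRS_exists 3 s s 3 (C * U * 1)" using w assms by (intro MRS_exists_magic_rectangles) auto
  from MRS_exists_merge[OF this] show ?thesis using U by simp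
qed

lemma MRS_exists_rectangle:
  assumes "odd k" "odd s" "odd C" "3 \<le> k" "3 \<le> s" "coprime k s"
  shows "MRS_exists k s s k C"
proof -
  have tr: "MRS_exists k s s k C" if "MRS_exists s k k s C"
    using MRS_exists_transpose[OF that] by (simp add: mult.commute)
  have rect: "MRS_exists k s s k C" if "odd k" "odd s" "3 \<le> k" "k < s" "\<not> 3 dvd s" for k s
    using ex_magic_rectangle[OF that] MRS_exists_magic_rectangles that assms(3) by (meson less_imp_le order_trans)
  have "\<not> (3 dvd k \<and> 3 dvd s)" using assms(6) coprime_common_divisor_nat[of k s 3] by auto
  moreover have "k \<noteq> s" using assms by auto
  ultimately consider "3 dvd k" "\<not> 3 dvd s" | "3 dvd s" "\<not> 3 dvd k" | "\<not> 3 dvd s" "k < s" | "\<not> 3 dvd k" "s < k"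
    by linarith
  thus ?thesis
  proof cases
    case 1 thus ?thesis using MRS_exists_rectangle_divisible_3 assms by blast
  next
    case 2 thus ?thesis using MRS_exists_rectangle_divisible_3[of s k C] assms tr by blast
  next
    case 3 thus ?thesis using rect assms by blast
  next
    case 4 thus ?thesis using rect[of s k] assms tr by blast
  qed
qed

text \<open>With \<open>s = d * s'\<close>, \<open>k = d * k'\<close> and \<open>s'\<close>,
  \<open>k'\<close> coprime, the equation \<open>m * s = n * k\<close> gives
  \<open>m = k' * e\<close> and \<open>n = s' * e\<close>. For \<open>d = 1\<close> the arrays
  consist of \<open>e\<close> full blocks; otherwise \<open>k'\<close> times \<open>s'\<close>
  squares of side \<open>e\<close> are merged, and \<open>s \<le> n\<close> yields
  \<open>d \<le> e\<close>.\<close>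

lemma MRS_exists_odd:
  assumes "odd (n * k * c)" "2 \<le> s" "s \<le> n" "2 \<le> k" "m * s = n * k"
  shows "MRS_exists m n s k c"
proof -
  have odd: "odd n" "odd k" "odd c" "odd (m * s)" using assms by auto
  hence ms: "odd m" "odd s" by auto
  define d where "d = gcd s k"
  have "0 < d" using assms by (simp add: d_def)
  obtain s' k' where sk: "s = d * s'" "k = d * k'" "coprime s' k'"
    using gcd_coprime_exists[of s k] \<open>0 < d\<close> unfolding d_def by (metis gcd_pos_nat less_numeral_extra(3) mult.commute)
  have odd': "odd d" "odd s'" "odd k'" using odd ms sk by auto
  have eq: "m * s' = n * k'" using assms(5) sk \<open>0 < d\<close> by (simp add: ac_simps)
  hence "k' dvd m" using sk(3) by (metis coprime_commute coprime_dvd_mult_left_iff dvd_triv_right)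
  then obtain e where e: "m = k' * e" by blast
  have "0 < k'" using assms sk by (cases k') auto
  hence n: "n = s' * e" using eq e by (simp add: ac_simps)
  have "odd e" using ms e by auto
  show ?thesis
  proof (cases "d = 1")
    case True
    hence "3 \<le> k" "3 \<le> s" using assms odd ms by presburger+
    moreover have "coprime k s" using sk True by (simp add: coprime_commute)
    ultimately have "MRS_exists k s s k (c * e)"
      using odd ms \<open>odd e\<close> by (intro MRS_exists_rectangle) auto
    from MRS_exists_block_diagonal[OF this] show ?thesis using e n sk True by simp
  next
    case False
    hence "3 \<le> d" using odd' by presburger
    moreover have "0 < s'" using assms sk by (cases s') auto
    hence "d \<le> e" using assms(3) sk(1) n by (simp add: mult.commute)
    moreover have "odd (c * k' * s')" using odd odd' by simp
    ultimately have "MRS_exists e e d d (c * k' * s')"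
      using odd' \<open>odd e\<close> by (intro MRS_exists_odd_square) auto
    from MRS_exists_merge[OF this] show ?thesis using e n sk by (simp add: ac_simps)
  qed
qed

theorem mainTheorem1:
  fixes m n s k c :: nat
  assumes "0 < m" "0 < n" "0 < s" "0 < k" "0 < c"
    and "2 \<le> s" "s \<le> n" "2 \<le> k" "k \<le> m" "m * s = n * k"
  shows "MRS_exists m n s k c \<longleftrightarrow> (odd (n * k * c) \<or> (even s \<and> even k \<and> s * k > 4))"
proof
  assume "MRS_exists m n s k c"
  thus "odd (n * k * c) \<or> (even s \<and> even k \<and> s * k > 4)"
    using assms by (intro MRS_exists_necessary)
next
  assume "odd (n * k * c) \<or> (even s \<and> even k \<and> s * k > 4)"
  thus "MRS_exists m n s k c"
  proof
    assume "odd (n * k * c)"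
    thus ?thesis using assms by (intro MRS_exists_odd)
  next
    assume "even s \<and> even k \<and> s * k > 4"
    thus ?thesis using assms by (intro MRS_exists_even) auto
  qed
qed

end
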